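(* Let $H$ be a quasi-Hopf algebra over a field $\mathbf k$ and let $(M,\rho)$ be a (right) quasi-Hopf $H$-bimodule. Consider $N:=M^{coH}$ as a left $H$-module with the action $\triangleright$, $a\triangleright n=E(a\cdot n)$, and consider $N\otimes H$ as a quasi-Hopf $H$-bimodule via $$a\cdot(n\otimes x)\cdot b=(a_{(1)}\triangleright n)\otimes a_{(2)}xb,\qquad \rho_{N\otimes H}(n\otimes x)=\bar X^i\triangleright n\otimes \bar Y^i x_{(1)}\otimes\bar Z^i x_{(2)}\qquad(a,b,x\in H,\ n\in N).$$ Then the map $$\nu:N\otimes H\to M,\qquad \nu(n\otimes a)=n\cdot a,$$ is an isomorphism of quasi-Hopf $H$-bimodules, with inverse $$\nu^{-1}(m)=E(m_{(0)})\otimes m_{(1)},\qquad m\in M.$$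
   Context: Quasi-Hopf algebras. $\mathbf k$ is a field, algebras are unital. A quasi-bialgebra $(H,\Delta,\epsilon,\phi)$ is a unital $\mathbf k$-algebra $H$ with unital algebra morphisms $\Delta:H\to H\otimes H$, $\epsilon:H\to\mathbf k$ and an invertible $\phi\in H\otimes H\otimes H$ such that $(\mathrm{id}\otimes\Delta)(\Delta(a))\,\phi=\phi\,(\Delta\otimes\mathrm{id})(\Delta(a))$ for all $a\in H$; $(\mathrm{id}\otimes\mathrm{id}\otimes\Delta)(\phi)(\Delta\otimes\mathrm{id}\otimes\mathrm{id})(\phi)=(\mathbf 1\otimes\phi)(\mathrm{id}\otimes\Delta\otimes\mathrm{id})(\phi)(\phi\otimes\mathbf 1)$; $(\epsilon\otimes\mathrm{id})\circ\Delta=\mathrm{id}=(\mathrm{id}\otimes\epsilon)\circ\Delta$; $(\mathrm{id}\otimes\epsilon\otimes\mathrm{id})(\phi)=\mathbf 1\otimes\mathbf 1$. Write $\Delta(a)=a_{(1)}\otimes a_{(2)}$, $\phi=X^j\otimes Y^j\otimes Z^j$, $\phi^{-1}=\bar X^j\otimes\bar Y^j\otimes\bar Z^j$ (summation suppressed). $H$ is a quasi-Hopf algebra if there are an algebra anti-morphism $S:H\to H$ and $\alpha,\beta\in H$ with $S(a_{(1)})\alpha a_{(2)}=\epsilon(a)\alpha$, $a_{(1)}\beta S(a_{(2)})=\epsilon(a)\beta$ for all $a$, and $X^j\beta S(Y^j)\alpha Z^j=\mathbf 1=S(\bar X^j)\alpha\bar Y^j\beta S(\bar Z^j)$. Standing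 conventions: $S$ is invertible and $\epsilon(\alpha)=\epsilon(\beta)=1$. Quasi-Hopf bimodules. For an $H$-bimodule $M$, $M\otimes H$ is an $H$-bimodule via $a\cdot(m\otimes x)\cdot b=\Delta(a)(m\otimes x)\Delta(b)$ (acting factorwise). A (right) quasi-Hopf $H$-bimodule is an $H$-bimodule $M$ with an $H$-bimodule map $\rho:M\to M\otimes H$, written $\rho(m)=m_{(0)}\otimes m_{(1)}$, such that $(\mathrm{id}_M\otimes\epsilon)\circ\rho=\mathrm{id}_M$ and $\phi\cdot(\rho\otimes\mathrm{id})(\rho(m))=(\mathrm{id}_M\otimes\Delta)(\rho(m))\cdot\phi$ for all $m\in M$. A morphism $(M,\rho)\to(M',\rho')$ is an $H$-bimodule map $f$ with $\rho'\circ f=(f\otimes\mathrm{id})\circ\rho$. Coinvariants. Let $q_R=q_R^1\otimes q_R^2:=X^i\otimes S^{-1}(\alpha Z^i)Y^i$. For $m\in M$, $a\in H$ put $E(m):=q_R^1\cdot m_{(0)}\cdot\beta S(q_R^2m_{(1)})$ and $a\triangleright m:=E(a\cdot m)$. The space of coinvariants is $M^{coH}:=E(M)=\{n\in M\mid E(n)=n\}=\{n\in M\mid E(n_{(0)})\otimes n_{(1)}=E(n)\otimes\mathbf 1\}$ (these sets coincide). *)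

theory Defs
  imports "HOL-Algebra.Module" "HOL-Algebra.AbelCoset"
begin

section \<open>Tensor products of modules over a commutative ring\<close>

text \<open>
  The tensor product \<open>V \<otimes> W\<close> is the quotient of the free module on
  \<open>carrier V \<times> carrier W\<close> by the submodule generated by the usual relators; its elements
  are cosets of finitely supported coefficient functions.
\<close>

definition free_module :: "('k, 'r) ring_scheme \<Rightarrow> 'x set \<Rightarrow> ('k, 'x \<Rightarrow> 'k) module" where
  "free_module R X =
    \<lparr>carrier = {f. (\<forall>x. f x \<in> carrier R) \<and> (\<forall>x. x \<notin> X \<longrightarrow> f x = \<zero>\<^bsub>R\<^esub>) \<and> finite {x \<in> X. f x \<noteq> \<zero>\<^bsub>R\<^esub>}},
     mult = undefined, one = undefined,
     zero = (\<lambda>x. \<zero>\<^bsub>R\<^esub>), add = (\<lambda>f g x. f x \<oplus>\<^bsub>R\<^esub> g x),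
     smult = (\<lambda>a f x. a \<otimes>\<^bsub>R\<^esub> f x)\<rparr>"

definition free_gen :: "('k, 'r) ring_scheme \<Rightarrow> 'x \<Rightarrow> 'x \<Rightarrow> 'k" where
  "free_gen R x = (\<lambda>y. if y = x then \<one>\<^bsub>R\<^esub> else \<zero>\<^bsub>R\<^esub>)"

abbreviation tensor_free ::
  "('k, 'r) ring_scheme \<Rightarrow> ('k, 'v, 'a) module_scheme \<Rightarrow> ('k, 'w, 'b) module_scheme
    \<Rightarrow> ('k, 'v \<times> 'w \<Rightarrow> 'k) module" where
  "tensor_free R V W \<equiv> free_module R (carrier V \<times> carrier W)"

inductive_set tensor_relators ::
  "('k, 'r) ring_scheme \<Rightarrow> ('k, 'v, 'a) module_scheme \<Rightarrow> ('k, 'w, 'b) module_scheme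
    \<Rightarrow> ('v \<times> 'w \<Rightarrow> 'k) set"
  for R V W where
  add_left: "\<lbrakk>v \<in> carrier V; v' \<in> carrier V; w \<in> carrier W\<rbrakk> \<Longrightarrow>
    free_gen R (v \<oplus>\<^bsub>V\<^esub> v', w) \<ominus>\<^bsub>tensor_free R V W\<^esub>
      (free_gen R (v, w) \<oplus>\<^bsub>tensor_free R V W\<^esub> free_gen R (v', w)) \<in> tensor_relators R V W"
| add_right: "\<lbrakk>v \<in> carrier V; w \<in> carrier W; w' \<in> carrier W\<rbrakk> \<Longrightarrow>
    free_gen R (v, w \<oplus>\<^bsub>W\<^esub> w') \<ominus>\<^bsub>tensor_free R V W\<^esub>
      (free_gen R (v, w) \<oplus>\<^bsub>tensor_free R V W\<^esub> free_gen R (v, w')) \<in> tensor_relators R V W"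
| smult_left: "\<lbrakk>a \<in> carrier R; v \<in> carrier V; w \<in> carrier W\<rbrakk> \<Longrightarrow>
    free_gen R (a \<odot>\<^bsub>V\<^esub> v, w) \<ominus>\<^bsub>tensor_free R V W\<^esub>
      (a \<odot>\<^bsub>tensor_free R V W\<^esub> free_gen R (v, w)) \<in> tensor_relators R V W"
| smult_right: "\<lbrakk>a \<in> carrier R; v \<in> carrier V; w \<in> carrier W\<rbrakk> \<Longrightarrow>
    free_gen R (v, a \<odot>\<^bsub>W\<^esub> w) \<ominus>\<^bsub>tensor_free R V W\<^esub>
      (a \<odot>\<^bsub>tensor_free R V W\<^esub> free_gen R (v, w)) \<in> tensor_relators R V W"

definition tensor_kernel ::
  "('k, 'r) ring_scheme \<Rightarrow> ('k, 'v, 'a) module_scheme \<Rightarrow> ('k, 'w, 'b) module_scheme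
    \<Rightarrow> ('v \<times> 'w \<Rightarrow> 'k) set" where
  "tensor_kernel R V W =
    \<Inter>{S. submodule S R (tensor_free R V W) \<and> tensor_relators R V W \<subseteq> S}"

definition tensor_module ::
  "('k, 'r) ring_scheme \<Rightarrow> ('k, 'v, 'a) module_scheme \<Rightarrow> ('k, 'w, 'b) module_scheme
    \<Rightarrow> ('k, ('v \<times> 'w \<Rightarrow> 'k) set) module" where
  "tensor_module R V W =
    \<lparr>carrier = a_rcosets\<^bsub>tensor_free R V W\<^esub> (tensor_kernel R V W),
     mult = undefined, one = undefined,
     zero = tensor_kernel R V W,
     add = set_add (tensor_free R V W),
     smult = (\<lambda>a T. \<Union>f\<in>T. tensor_kernel R V W +>\<^bsub>tensor_free R V W\<^esub> (a \<odot>\<^bsub>tensor_free R V W\<^esub> f))\<rparr>"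

definition pure_tensor ::
  "('k, 'r) ring_scheme \<Rightarrow> ('k, 'v, 'a) module_scheme \<Rightarrow> ('k, 'w, 'b) module_scheme
    \<Rightarrow> 'v \<Rightarrow> 'w \<Rightarrow> ('v \<times> 'w \<Rightarrow> 'k) set" where
  "pure_tensor R V W v w = tensor_kernel R V W +>\<^bsub>tensor_free R V W\<^esub> free_gen R (v, w)"

text \<open>
  \<open>tensor_lift R V W U f\<close> is the linear map \<open>V \<otimes> W \<rightarrow> U\<close> induced by a bilinear map
  \<open>f\<close>, that is, \<open>\<Sum>\<^sub>i v\<^sub>i \<otimes> w\<^sub>i \<mapsto> \<Sum>\<^sub>i f v\<^sub>i w\<^sub>i\<close>.
  It renders Sweedler notation: if \<open>t = t\<^sub>1 \<otimes> t\<^sub>2\<close> (summation suppressed), then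
  \<open>tensor_lift R V W U (\<lambda>t\<^sub>1 t\<^sub>2. f t\<^sub>1 t\<^sub>2) t\<close> is \<open>f t\<^sub>1 t\<^sub>2\<close>.
\<close>

definition tensor_lift ::
  "('k, 'r) ring_scheme \<Rightarrow> ('k, 'v, 'a) module_scheme \<Rightarrow> ('k, 'w, 'b) module_scheme
    \<Rightarrow> ('k, 'u, 'c) module_scheme \<Rightarrow> ('v \<Rightarrow> 'w \<Rightarrow> 'u) \<Rightarrow> ('v \<times> 'w \<Rightarrow> 'k) set \<Rightarrow> 'u" where
  "tensor_lift R V W U f t =
    (THE u. \<exists>c\<in>t. u =
      (\<Oplus>\<^bsub>U\<^esub>p\<in>{p \<in> carrier V \<times> carrier W. c p \<noteq> \<zero>\<^bsub>R\<^esub>}. c p \<odot>\<^bsub>U\<^esub> f (fst p) (snd p)))"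

text \<open>
  For bilinear \<open>f : A \<times> V \<rightarrow> A'\<close> and \<open>g : B \<times> W \<rightarrow> B'\<close>, the factorwise operation
  \<open>(a \<otimes> b) \<cdot> (v \<otimes> w) = f a v \<otimes> g b w\<close> from \<open>(A \<otimes> B) \<times> (V \<otimes> W)\<close> to
  \<open>A' \<otimes> B'\<close>.
\<close>

definition tensor_op ::
  "('k, 'r) ring_scheme \<Rightarrow> ('k, 'a, 'z1) module_scheme \<Rightarrow> ('k, 'b, 'z2) module_scheme
    \<Rightarrow> ('k, 'v, 'z3) module_scheme \<Rightarrow> ('k, 'w, 'z4) module_scheme
    \<Rightarrow> ('k, 'a2, 'z5) module_scheme \<Rightarrow> ('k, 'b2, 'z6) module_scheme
    \<Rightarrow> ('a \<Rightarrow> 'v \<Rightarrow> 'a2) \<Rightarrow> ('b \<Rightarrow> 'w \<Rightarrow> 'b2)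
    \<Rightarrow> ('a \<times> 'b \<Rightarrow> 'k) set \<Rightarrow> ('v \<times> 'w \<Rightarrow> 'k) set \<Rightarrow> ('a2 \<times> 'b2 \<Rightarrow> 'k) set" where
  "tensor_op R A B V W A' B' f g s t =
    tensor_lift R A B (tensor_module R A' B')
      (\<lambda>a b. tensor_lift R V W (tensor_module R A' B')
        (\<lambda>v w. pure_tensor R A' B' (f a v) (g b w)) t) s"

text \<open>
  The fields \<open>mult\<close> and \<open>one\<close> of \<open>tensor R V W\<close> are meaningful only when \<open>V\<close> and
  \<open>W\<close> are algebras, in which case they make it the tensor product algebra; for mere modules they
  are ignored.
\<close>

definition tensor ::
  "('k, 'r) ring_scheme \<Rightarrow> ('k, 'v, 'a) module_scheme \<Rightarrow> ('k, 'w, 'b) module_scheme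
    \<Rightarrow> ('k, ('v \<times> 'w \<Rightarrow> 'k) set) module" where
  "tensor R V W = (tensor_module R V W)
    \<lparr>mult := tensor_op R V W V W V W (mult V) (mult W),
     one := pure_tensor R V W \<one>\<^bsub>V\<^esub> \<one>\<^bsub>W\<^esub>\<rparr>"

definition tensor_map ::
  "('k, 'r) ring_scheme \<Rightarrow> ('k, 'v, 'z1) module_scheme \<Rightarrow> ('k, 'w, 'z2) module_scheme
    \<Rightarrow> ('k, 'v2, 'z3) module_scheme \<Rightarrow> ('k, 'w2, 'z4) module_scheme
    \<Rightarrow> ('v \<Rightarrow> 'v2) \<Rightarrow> ('w \<Rightarrow> 'w2) \<Rightarrow> ('v \<times> 'w \<Rightarrow> 'k) set \<Rightarrow> ('v2 \<times> 'w2 \<Rightarrow> 'k) set" where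
  "tensor_map R V W V' W' f g =
    tensor_lift R V W (tensor R V' W') (\<lambda>v w. pure_tensor R V' W' (f v) (g w))"

text \<open>
  Iterated tensor products are bracketed to the left: \<open>U \<otimes> V \<otimes> W\<close> stands for
  \<open>(U \<otimes> V) \<otimes> W\<close>. The canonical isomorphism \<open>U \<otimes> (V \<otimes> W) \<rightarrow> (U \<otimes> V) \<otimes> W\<close> that
  is implicit in the usual notation is \<open>tensor_assoc\<close>.
\<close>

abbreviation tensor3 where
  "tensor3 R U V W \<equiv> tensor R (tensor R U V) W"

definition tensor_assoc ::
  "('k, 'r) ring_scheme \<Rightarrow> ('k, 'u, 'z1) module_scheme \<Rightarrow> ('k, 'v, 'z2) module_scheme
    \<Rightarrow> ('k, 'w, 'z3) module_scheme
    \<Rightarrow> ('u \<times> ('v \<times> 'w \<Rightarrow> 'k) set \<Rightarrow> 'k) set \<Rightarrow> (('u \<times> 'v \<Rightarrow> 'k) set \<times> 'w \<Rightarrow> 'k) set" where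
  "tensor_assoc R U V W =
    tensor_lift R U (tensor R V W) (tensor3 R U V W)
      (\<lambda>u. tensor_lift R V W (tensor3 R U V W)
        (\<lambda>v w. pure_tensor R (tensor R U V) W (pure_tensor R U V u v) w))"

definition tensor_lift3 ::
  "('k, 'r) ring_scheme \<Rightarrow> ('k, 'u, 'z1) module_scheme \<Rightarrow> ('k, 'v, 'z2) module_scheme
    \<Rightarrow> ('k, 'w, 'z3) module_scheme \<Rightarrow> ('k, 'x, 'z4) module_scheme
    \<Rightarrow> ('u \<Rightarrow> 'v \<Rightarrow> 'w \<Rightarrow> 'x) \<Rightarrow> (('u \<times> 'v \<Rightarrow> 'k) set \<times> 'w \<Rightarrow> 'k) set \<Rightarrow> 'x" where
  "tensor_lift3 R U V W X f =
    tensor_lift R (tensor R U V) W X (\<lambda>s w. tensor_lift R U V X (\<lambda>u v. f u v w) s)"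

definition linear_maps ::
  "('k, 'r) ring_scheme \<Rightarrow> ('k, 'v, 'a) module_scheme \<Rightarrow> ('k, 'w, 'b) module_scheme
    \<Rightarrow> ('v \<Rightarrow> 'w) set" where
  "linear_maps R V W = {f \<in> carrier V \<rightarrow> carrier W.
    (\<forall>x\<in>carrier V. \<forall>y\<in>carrier V. f (x \<oplus>\<^bsub>V\<^esub> y) = f x \<oplus>\<^bsub>W\<^esub> f y) \<and>
    (\<forall>a\<in>carrier R. \<forall>x\<in>carrier V. f (a \<odot>\<^bsub>V\<^esub> x) = a \<odot>\<^bsub>W\<^esub> f x)}"


section \<open>Quasi-Hopf algebras\<close>

text \<open>The locale \<open>algebra\<close> of the library requires commutativity.\<close>

locale unital_algebra = module R A + field R + ring A
  for R :: "('k, 'r) ring_scheme" (structure) and A :: "('k, 'h, 'a) module_scheme" (structure) +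
  assumes smult_mult_left: "\<lbrakk>a \<in> carrier R; x \<in> carrier A; y \<in> carrier A\<rbrakk> \<Longrightarrow>
      (a \<odot>\<^bsub>A\<^esub> x) \<otimes>\<^bsub>A\<^esub> y = a \<odot>\<^bsub>A\<^esub> (x \<otimes>\<^bsub>A\<^esub> y)"
    and smult_mult_right: "\<lbrakk>a \<in> carrier R; x \<in> carrier A; y \<in> carrier A\<rbrakk> \<Longrightarrow>
      x \<otimes>\<^bsub>A\<^esub> (a \<odot>\<^bsub>A\<^esub> y) = a \<odot>\<^bsub>A\<^esub> (x \<otimes>\<^bsub>A\<^esub> y)"

record ('k, 'h) quasi_bialgebra = "('k, 'h) module" +
  comult :: "'h \<Rightarrow> ('h \<times> 'h \<Rightarrow> 'k) set"
  counit :: "'h \<Rightarrow> 'k"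
  reassoc :: "(('h \<times> 'h \<Rightarrow> 'k) set \<times> 'h \<Rightarrow> 'k) set"  \<comment> \<open>the element \<open>\<phi>\<close> of \<open>H \<otimes> H \<otimes> H\<close>\<close>

record ('k, 'h) quasi_hopf_algebra = "('k, 'h) quasi_bialgebra" +
  antipode :: "'h \<Rightarrow> 'h"
  alpha :: 'h
  beta :: 'h

text \<open>
  In \<open>quasi_coassoc\<close> and \<open>pentagon\<close>, all identities are read in \<open>(H \<otimes> H) \<otimes> H\<close> and
  \<open>((H \<otimes> H) \<otimes> H) \<otimes> H\<close>, using \<open>tensor_assoc\<close> where needed. In the counit axioms
  \<open>\<k> \<otimes> H\<close> and \<open>H \<otimes> \<k>\<close> are identified with \<open>H\<close>, so that \<open>\<epsilon> \<otimes> id\<close> is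
  \<open>x \<otimes> y \<mapsto> \<epsilon>(x) y\<close>.
\<close>

locale quasi_bialgebra = unital_algebra R H
  for R :: "('k, 'r) ring_scheme" (structure)
    and H :: "('k, 'h, 'a) quasi_bialgebra_scheme" (structure) +
  assumes comult_linear: "comult H \<in> linear_maps R H (tensor R H H)"
    and comult_hom: "comult H \<in> ring_hom H (tensor R H H)"
    and counit_hom: "counit H \<in> ring_hom H R"
    and counit_smult: "\<lbrakk>c \<in> carrier R; x \<in> carrier H\<rbrakk> \<Longrightarrow>
      counit H (c \<odot>\<^bsub>H\<^esub> x) = c \<otimes>\<^bsub>R\<^esub> counit H x"
    and reassoc_unit: "reassoc H \<in> Units (tensor3 R H H H)"
    and quasi_coassoc: "a \<in> carrier H \<Longrightarrow>
      tensor_assoc R H H H (tensor_map R H H H (tensor R H H) id (comult H) (comult H a))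
          \<otimes>\<^bsub>tensor3 R H H H\<^esub> reassoc H
        = reassoc H \<otimes>\<^bsub>tensor3 R H H H\<^esub>
          tensor_map R H H (tensor R H H) H (comult H) id (comult H a)"
    and pentagon:
      "tensor_assoc R (tensor R H H) H H
          (tensor_map R (tensor R H H) H (tensor R H H) (tensor R H H) id (comult H) (reassoc H))
        \<otimes>\<^bsub>tensor R (tensor3 R H H H) H\<^esub>
          tensor_map R (tensor R H H) H (tensor3 R H H H) H
            (tensor_map R H H (tensor R H H) H (comult H) id) id (reassoc H)
      = tensor_map R (tensor R H (tensor R H H)) H (tensor3 R H H H) H (tensor_assoc R H H H) id
          (tensor_assoc R H (tensor R H H) H (pure_tensor R H (tensor3 R H H H) \<one>\<^bsub>H\<^esub> (reassoc H)))
        \<otimes>\<^bsub>tensor R (tensor3 R H H H) H\<^esub>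
          tensor_map R (tensor R H H) H (tensor3 R H H H) H
            (tensor_assoc R H H H \<circ> tensor_map R H H H (tensor R H H) id (comult H)) id (reassoc H)
        \<otimes>\<^bsub>tensor R (tensor3 R H H H) H\<^esub>
          pure_tensor R (tensor3 R H H H) H (reassoc H) \<one>\<^bsub>H\<^esub>"
    and counit_left: "a \<in> carrier H \<Longrightarrow>
      tensor_lift R H H H (\<lambda>x y. counit H x \<odot>\<^bsub>H\<^esub> y) (comult H a) = a"
    and counit_right: "a \<in> carrier H \<Longrightarrow>
      tensor_lift R H H H (\<lambda>x y. counit H y \<odot>\<^bsub>H\<^esub> x) (comult H a) = a"
    and counit_reassoc:
      "tensor_map R (tensor R H H) H H H (tensor_lift R H H H (\<lambda>x y. counit H y \<odot>\<^bsub>H\<^esub> x)) id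
        (reassoc H) = pure_tensor R H H \<one>\<^bsub>H\<^esub> \<one>\<^bsub>H\<^esub>"

locale quasi_hopf_algebra = quasi_bialgebra R H
  for R :: "('k, 'r) ring_scheme" (structure)
    and H :: "('k, 'h, 'a) quasi_hopf_algebra_scheme" (structure) +
  assumes antipode_linear: "antipode H \<in> linear_maps R H H"
    and antipode_one: "antipode H \<one>\<^bsub>H\<^esub> = \<one>\<^bsub>H\<^esub>"
    and antipode_mult: "\<lbrakk>x \<in> carrier H; y \<in> carrier H\<rbrakk> \<Longrightarrow>
      antipode H (x \<otimes>\<^bsub>H\<^esub> y) = antipode H y \<otimes>\<^bsub>H\<^esub> antipode H x"
    and antipode_bij: "bij_betw (antipode H) (carrier H) (carrier H)"
    and alpha_closed: "alpha H \<in> carrier H"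
    and beta_closed: "beta H \<in> carrier H"
    and antipode_alpha: "a \<in> carrier H \<Longrightarrow>
      tensor_lift R H H H (\<lambda>a1 a2. antipode H a1 \<otimes>\<^bsub>H\<^esub> alpha H \<otimes>\<^bsub>H\<^esub> a2) (comult H a)
        = counit H a \<odot>\<^bsub>H\<^esub> alpha H"
    and antipode_beta: "a \<in> carrier H \<Longrightarrow>
      tensor_lift R H H H (\<lambda>a1 a2. a1 \<otimes>\<^bsub>H\<^esub> beta H \<otimes>\<^bsub>H\<^esub> antipode H a2) (comult H a)
        = counit H a \<odot>\<^bsub>H\<^esub> beta H"
    and antipode_reassoc:
      "tensor_lift3 R H H H H
        (\<lambda>X Y Z. X \<otimes>\<^bsub>H\<^esub> beta H \<otimes>\<^bsub>H\<^esub> antipode H Y \<otimes>\<^bsub>H\<^esub> alpha H \<otimes>\<^bsub>H\<^esub> Z)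
        (reassoc H) = \<one>\<^bsub>H\<^esub>"
    and antipode_reassoc_inv:
      "tensor_lift3 R H H H H
        (\<lambda>X Y Z. antipode H X \<otimes>\<^bsub>H\<^esub> alpha H \<otimes>\<^bsub>H\<^esub> Y \<otimes>\<^bsub>H\<^esub> beta H \<otimes>\<^bsub>H\<^esub> antipode H Z)
        (inv\<^bsub>tensor3 R H H H\<^esub> reassoc H) = \<one>\<^bsub>H\<^esub>"
    and counit_alpha: "counit H (alpha H) = \<one>\<^bsub>R\<^esub>"
    and counit_beta: "counit H (beta H) = \<one>\<^bsub>R\<^esub>"


section \<open>Quasi-Hopf bimodules\<close>

record ('k, 'h, 'm) left_module = "('k, 'm) module" +
  lact :: "'h \<Rightarrow> 'm \<Rightarrow> 'm"

record ('k, 'h, 'm) quasi_hopf_bimodule = "('k, 'h, 'm) left_module" +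
  ract :: "'m \<Rightarrow> 'h \<Rightarrow> 'm"
  coact :: "'m \<Rightarrow> ('m \<times> 'h \<Rightarrow> 'k) set"

locale left_module = module R M
  for R :: "('k, 'r) ring_scheme" (structure)
    and H :: "('k, 'h, 'a) module_scheme"
    and M :: "('k, 'h, 'm, 'b) left_module_scheme" (structure) +
  assumes lact_linear: "a \<in> carrier H \<Longrightarrow> lact M a \<in> linear_maps R M M"
    and lact_add: "\<lbrakk>a \<in> carrier H; b \<in> carrier H; m \<in> carrier M\<rbrakk> \<Longrightarrow>
      lact M (a \<oplus>\<^bsub>H\<^esub> b) m = lact M a m \<oplus>\<^bsub>M\<^esub> lact M b m"
    and lact_smult: "\<lbrakk>c \<in> carrier R; a \<in> carrier H; m \<in> carrier M\<rbrakk> \<Longrightarrow>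
      lact M (c \<odot>\<^bsub>H\<^esub> a) m = c \<odot>\<^bsub>M\<^esub> lact M a m"
    and lact_one: "m \<in> carrier M \<Longrightarrow> lact M \<one>\<^bsub>H\<^esub> m = m"
    and lact_mult: "\<lbrakk>a \<in> carrier H; b \<in> carrier H; m \<in> carrier M\<rbrakk> \<Longrightarrow>
      lact M (a \<otimes>\<^bsub>H\<^esub> b) m = lact M a (lact M b m)"

locale bimodule = left_module R H M
  for R :: "('k, 'r) ring_scheme" (structure)
    and H :: "('k, 'h, 'a) module_scheme"
    and M :: "('k, 'h, 'm, 'b) quasi_hopf_bimodule_scheme" (structure) +
  assumes ract_linear: "a \<in> carrier H \<Longrightarrow> (\<lambda>m. ract M m a) \<in> linear_maps R M M"
    and ract_add: "\<lbrakk>a \<in> carrier H; b \<in> carrier H; m \<in> carrier M\<rbrakk> \<Longrightarrow>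
      ract M m (a \<oplus>\<^bsub>H\<^esub> b) = ract M m a \<oplus>\<^bsub>M\<^esub> ract M m b"
    and ract_smult: "\<lbrakk>c \<in> carrier R; a \<in> carrier H; m \<in> carrier M\<rbrakk> \<Longrightarrow>
      ract M m (c \<odot>\<^bsub>H\<^esub> a) = c \<odot>\<^bsub>M\<^esub> ract M m a"
    and ract_one: "m \<in> carrier M \<Longrightarrow> ract M m \<one>\<^bsub>H\<^esub> = m"
    and ract_mult: "\<lbrakk>a \<in> carrier H; b \<in> carrier H; m \<in> carrier M\<rbrakk> \<Longrightarrow>
      ract M m (a \<otimes>\<^bsub>H\<^esub> b) = ract M (ract M m a) b"
    and lact_ract: "\<lbrakk>a \<in> carrier H; b \<in> carrier H; m \<in> carrier M\<rbrakk> \<Longrightarrow>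
      ract M (lact M a m) b = lact M a (ract M m b)"

text \<open>
  The factorwise actions of \<open>H \<otimes> H\<close> on \<open>M \<otimes> H\<close> and of \<open>H \<otimes> H \<otimes> H\<close> on
  \<open>M \<otimes> H \<otimes> H\<close>, where \<open>H\<close> acts on itself by multiplication.
\<close>

definition lact2 where
  "lact2 R H M = tensor_op R H H M H M H (lact M) (mult H)"

definition ract2 where
  "ract2 R H M = tensor_op R M H H H M H (ract M) (mult H)"

definition lact3 where
  "lact3 R H M = tensor_op R (tensor R H H) H (tensor R M H) H (tensor R M H) H
    (lact2 R H M) (mult H)"

definition ract3 where
  "ract3 R H M = tensor_op R (tensor R M H) H (tensor R H H) H (tensor R M H) H
    (ract2 R H M) (mult H)"

locale quasi_hopf_bimodule = bimodule R H M
  for R :: "('k, 'r) ring_scheme" (structure)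
    and H :: "('k, 'h, 'a) quasi_bialgebra_scheme"
    and M :: "('k, 'h, 'm, 'b) quasi_hopf_bimodule_scheme" (structure) +
  assumes coact_linear: "coact M \<in> linear_maps R M (tensor R M H)"
    and coact_lact: "\<lbrakk>a \<in> carrier H; m \<in> carrier M\<rbrakk> \<Longrightarrow>
      coact M (lact M a m) = lact2 R H M (comult H a) (coact M m)"
    and coact_ract: "\<lbrakk>a \<in> carrier H; m \<in> carrier M\<rbrakk> \<Longrightarrow>
      coact M (ract M m a) = ract2 R H M (coact M m) (comult H a)"
    and coact_counit: "m \<in> carrier M \<Longrightarrow>
      tensor_lift R M H M (\<lambda>n x. counit H x \<odot>\<^bsub>M\<^esub> n) (coact M m) = m"
    and coact_coassoc: "m \<in> carrier M \<Longrightarrow>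
      lact3 R H M (reassoc H) (tensor_map R M H (tensor R M H) H (coact M) id (coact M m))
        = ract3 R H M
            (tensor_assoc R M H H (tensor_map R M H M (tensor R H H) id (comult H) (coact M m)))
            (reassoc H)"

definition quasi_hopf_bimodule_hom ::
  "('k, 'r) ring_scheme \<Rightarrow> ('k, 'h, 'a) quasi_bialgebra_scheme
    \<Rightarrow> ('k, 'h, 'm, 'b) quasi_hopf_bimodule_scheme \<Rightarrow> ('k, 'h, 'n, 'c) quasi_hopf_bimodule_scheme
    \<Rightarrow> ('m \<Rightarrow> 'n) set" where
  "quasi_hopf_bimodule_hom R H M M' = {f \<in> linear_maps R M M'.
    (\<forall>a\<in>carrier H. \<forall>m\<in>carrier M. f (lact M a m) = lact M' a (f m)) \<and>
    (\<forall>a\<in>carrier H. \<forall>m\<in>carrier M. f (ract M m a) = ract M' (f m) a) \<and>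
    (\<forall>m\<in>carrier M. coact M' (f m) = tensor_map R M H M' H f id (coact M m))}"

definition quasi_hopf_bimodule_iso ::
  "('k, 'r) ring_scheme \<Rightarrow> ('k, 'h, 'a) quasi_bialgebra_scheme
    \<Rightarrow> ('k, 'h, 'm, 'b) quasi_hopf_bimodule_scheme \<Rightarrow> ('k, 'h, 'n, 'c) quasi_hopf_bimodule_scheme
    \<Rightarrow> ('m \<Rightarrow> 'n) set" where
  "quasi_hopf_bimodule_iso R H M M' = {f \<in> quasi_hopf_bimodule_hom R H M M'.
    \<exists>g\<in>quasi_hopf_bimodule_hom R H M' M.
      (\<forall>m\<in>carrier M. g (f m) = m) \<and> (\<forall>n\<in>carrier M'. f (g n) = n)}"


section \<open>Coinvariants\<close>

definition q_R ::
  "('k, 'r) ring_scheme \<Rightarrow> ('k, 'h, 'a) quasi_hopf_algebra_scheme \<Rightarrow> ('h \<times> 'h \<Rightarrow> 'k) set" where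
  "q_R R H = tensor_lift3 R H H H (tensor R H H)
    (\<lambda>X Y Z. pure_tensor R H H X
      (inv_into (carrier H) (antipode H) (alpha H \<otimes>\<^bsub>H\<^esub> Z) \<otimes>\<^bsub>H\<^esub> Y))
    (reassoc H)"

definition coinv_proj ::
  "('k, 'r) ring_scheme \<Rightarrow> ('k, 'h, 'a) quasi_hopf_algebra_scheme
    \<Rightarrow> ('k, 'h, 'm, 'b) quasi_hopf_bimodule_scheme \<Rightarrow> 'm \<Rightarrow> 'm" where
  "coinv_proj R H M m =
    tensor_lift R H H M
      (\<lambda>q1 q2. tensor_lift R M H M
        (\<lambda>m0 m1. ract M (lact M q1 m0) (beta H \<otimes>\<^bsub>H\<^esub> antipode H (q2 \<otimes>\<^bsub>H\<^esub> m1)))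
        (coact M m))
      (q_R R H)"

text \<open>
  The coinvariants \<open>E(M)\<close>, as a subspace of \<open>M\<close>, with the left action
  \<open>a \<triangleright> n = E(a \<cdot> n)\<close>.
\<close>

definition coinvariants ::
  "('k, 'r) ring_scheme \<Rightarrow> ('k, 'h, 'a) quasi_hopf_algebra_scheme
    \<Rightarrow> ('k, 'h, 'm, 'b) quasi_hopf_bimodule_scheme \<Rightarrow> ('k, 'h, 'm) left_module" where
  "coinvariants R H M =
    \<lparr>carrier = coinv_proj R H M ` carrier M, mult = mult M, one = one M,
     zero = zero M, add = add M, smult = smult M,
     lact = (\<lambda>a n. coinv_proj R H M (lact M a n))\<rparr>"

text \<open>The quasi-Hopf bimodule structure on \<open>N \<otimes> H\<close> for a left \<open>H\<close>-module \<open>N\<close>.\<close>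

definition induced_bimodule ::
  "('k, 'r) ring_scheme \<Rightarrow> ('k, 'h, 'a) quasi_bialgebra_scheme
    \<Rightarrow> ('k, 'h, 'm, 'b) left_module_scheme
    \<Rightarrow> ('k, 'h, ('m \<times> 'h \<Rightarrow> 'k) set) quasi_hopf_bimodule" where
  "induced_bimodule R H N =
    \<lparr>carrier = carrier (tensor R N H), mult = mult (tensor R N H), one = one (tensor R N H),
     zero = zero (tensor R N H), add = add (tensor R N H), smult = smult (tensor R N H),
     lact = (\<lambda>a. tensor_lift R N H (tensor R N H)
       (\<lambda>n x. tensor_lift R H H (tensor R N H)
         (\<lambda>a1 a2. pure_tensor R N H (lact N a1 n) (a2 \<otimes>\<^bsub>H\<^esub> x)) (comult H a))),
     ract = (\<lambda>t b. tensor_lift R N H (tensor R N H)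
       (\<lambda>n x. pure_tensor R N H n (x \<otimes>\<^bsub>H\<^esub> b)) t),
     coact = tensor_lift R N H (tensor3 R N H H)
       (\<lambda>n x. tensor_lift3 R H H H (tensor3 R N H H)
         (\<lambda>X Y Z. tensor_lift R H H (tensor3 R N H H)
           (\<lambda>x1 x2. pure_tensor R (tensor R N H) H
             (pure_tensor R N H (lact N X n) (Y \<otimes>\<^bsub>H\<^esub> x1)) (Z \<otimes>\<^bsub>H\<^esub> x2))
           (comult H x))
         (inv\<^bsub>tensor3 R H H H\<^esub> reassoc H))\<rparr>"

end

theory Submission
  imports Defs
begin

text \<open>
  The relation \<open>S(S\<^sup>-\<^sup>1(\<alpha>Z) Y m\<^sub>1) = S(m\<^sub>1) S(Y) \<alpha> Z\<close> turns the projection into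
  \<open>E(m) = X m\<^sub>0 \<beta> S(m\<^sub>1) S(Y) \<alpha> Z\<close>, which no longer contains \<open>S\<^sup>-\<^sup>1\<close>. The quasi-coassociativity
  of \<open>\<Delta>\<close> and \<open>\<rho>\<close> and the antipode axioms then give \<open>E(m a) = \<epsilon>(a) E(m)\<close>,
  \<open>a E(m) = E(a\<^sub>1 m) a\<^sub>2\<close> and \<open>E(m\<^sub>0) m\<^sub>1 = m\<close>. The last identity is \<open>\<nu> \<circ> \<nu>\<^sup>-\<^sup>1 = id\<close>; the other
  composition is \<open>E(E(m)\<^sub>0) \<otimes> E(m)\<^sub>1 = E(m) \<otimes> 1\<close>, which rests on a consequence of the pentagon
  equation, \<open>X\<^sub>1 x \<otimes> X\<^sub>2 y \<beta> S(z) S(Y) \<alpha> Z = 1 \<otimes> 1\<close>, where \<open>\<phi> = X \<otimes> Y \<otimes> Z\<close> and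
  \<open>\<phi>\<^sup>-\<^sup>1 = x \<otimes> y \<otimes> z\<close>. Since \<open>\<nu>\<close> is a linear bijection that intertwines both actions and the
  coaction (by \<open>\<rho>(n) = E(x n) y \<otimes> z\<close> for coinvariant \<open>n\<close>), the axioms of a quasi-Hopf bimodule
  are transported from \<open>M\<close> to \<open>N \<otimes> H\<close> and need not be verified there.
\<close>

section \<open>Linear maps\<close>

text \<open>Elements of a tensor product are cosets, so the computations avoid them. Each axiom is
  evaluated under an arbitrary multilinear map into an arbitrary module U. In the resulting
  \<open>_sum\<close> lemmas the test map can be specialised to any expression in \<open>S\<close>,
  \<open>\<alpha>\<close>, \<open>\<beta>\<close>, the actions and \<open>E\<close>. The price is
  that sums must be exchanged and multilinearity proved at every step, which shapes the general
  lemmas on \<open>tensor_lift\<close>.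

  The pentagon consequence arises by solving the pentagon for (\<Delta> \<otimes> id \<otimes>
  id)(\<phi>) (\<phi>^-1 \<otimes> 1) and applying a \<otimes> b \<otimes> c \<otimes> d \<mapsto> a
  \<otimes> b \<beta> S(c) \<alpha> d. This leaves the counit on the last leg of \<phi>^-1, whereas
  the axioms describe it only on the middle leg of \<phi>. Hence the counit on the outer legs has to
  be derived from the pentagon too.

  The rule E(m a) = \<epsilon>(a) E(m) is used throughout to let \<open>E\<close> absorb right
  factors, in particular the first leg of a copy of \<phi> acting from the right, which then
  disappears.\<close>

lemma linear_mapsI:
  assumes "\<And>x. x \<in> carrier V \<Longrightarrow> f x \<in> carrier W"
    and "\<And>x y. x \<in> carrier V \<Longrightarrow> y \<in> carrier V \<Longrightarrow> f (x \<oplus>\<^bsub>V\<^esub> y) = f x \<oplus>\<^bsub>W\<^esub> f y"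
    and "\<And>a x. a \<in> carrier R \<Longrightarrow> x \<in> carrier V \<Longrightarrow> f (a \<odot>\<^bsub>V\<^esub> x) = a \<odot>\<^bsub>W\<^esub> f x"
  shows "f \<in> linear_maps R V W"
  using assms by (auto simp: linear_maps_def)

lemma linear_maps_closed: "f \<in> linear_maps R V W \<Longrightarrow> x \<in> carrier V \<Longrightarrow> f x \<in> carrier W"
  by (auto simp: linear_maps_def)

lemma linear_maps_add:
  "f \<in> linear_maps R V W \<Longrightarrow> x \<in> carrier V \<Longrightarrow> y \<in> carrier V \<Longrightarrow> f (x \<oplus>\<^bsub>V\<^esub> y) = f x \<oplus>\<^bsub>W\<^esub> f y"
  by (auto simp: linear_maps_def)

lemma linear_maps_smult:
  "f \<in> linear_maps R V W \<Longrightarrow> a \<in> carrier R \<Longrightarrow> x \<in> carrier V \<Longrightarrow> f (a \<odot>\<^bsub>V\<^esub> x) = a \<odot>\<^bsub>W\<^esub> f x"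
  by (auto simp: linear_maps_def)

lemma linear_maps_id [simp]: "(\<lambda>x. x) \<in> linear_maps R V V"
  by (auto simp: linear_maps_def)

lemma linear_maps_compose:
  "f \<in> linear_maps R V W \<Longrightarrow> g \<in> linear_maps R W U \<Longrightarrow> (\<lambda>x. g (f x)) \<in> linear_maps R V U"
  by (auto simp: linear_maps_def Pi_iff)

lemma linear_maps_zero:
  assumes "module R V" "module R W" "f \<in> linear_maps R V W"
  shows "f \<zero>\<^bsub>V\<^esub> = \<zero>\<^bsub>W\<^esub>"
proof -
  interpret V: module R V by fact
  interpret W: module R W by fact
  have "f \<zero>\<^bsub>V\<^esub> = f (\<zero>\<^bsub>R\<^esub> \<odot>\<^bsub>V\<^esub> \<zero>\<^bsub>V\<^esub>)" by simp
  also have "\<dots> = \<zero>\<^bsub>R\<^esub> \<odot>\<^bsub>W\<^esub> f \<zero>\<^bsub>V\<^esub>"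
    by (rule linear_maps_smult[OF assms(3)]) auto
  also have "\<dots> = \<zero>\<^bsub>W\<^esub>" by (simp add: linear_maps_closed[OF assms(3)])
  finally show ?thesis .
qed

lemma linear_maps_add_fun:
  assumes "module R W" "f \<in> linear_maps R V W" "g \<in> linear_maps R V W"
  shows "(\<lambda>x. f x \<oplus>\<^bsub>W\<^esub> g x) \<in> linear_maps R V W"
proof -
  interpret W: module R W by fact
  show ?thesis
    by (rule linear_mapsI) (use assms in \<open>auto simp: linear_maps_closed linear_maps_add linear_maps_smult
      W.smult_r_distr W.a_ac\<close>)
qed

lemma linear_maps_smult_fun:
  assumes "module R W" "a \<in> carrier R" "f \<in> linear_maps R V W"
  shows "(\<lambda>x. a \<odot>\<^bsub>W\<^esub> f x) \<in> linear_maps R V W"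
proof -
  interpret W: module R W by fact
  show ?thesis
    by (rule linear_mapsI) (use assms in \<open>auto simp: linear_maps_closed linear_maps_add linear_maps_smult
      W.smult_r_distr W.smult_assoc1[symmetric] W.R.m_comm\<close>)
qed

definition bilinear_maps where
  "bilinear_maps R V W U =
    {f. (\<forall>v\<in>carrier V. f v \<in> linear_maps R W U) \<and> (\<forall>w\<in>carrier W. (\<lambda>v. f v w) \<in> linear_maps R V U)}"

lemma bilinear_mapsI [intro]:
  assumes "\<And>v. v \<in> carrier V \<Longrightarrow> (\<lambda>w. f v w) \<in> linear_maps R W U"
    and "\<And>w. w \<in> carrier W \<Longrightarrow> (\<lambda>v. f v w) \<in> linear_maps R V U"
  shows "f \<in> bilinear_maps R V W U"
  using assms by (auto simp: bilinear_maps_def)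

lemma bilinear_mapsD:
  assumes "f \<in> bilinear_maps R V W U"
  shows "v \<in> carrier V \<Longrightarrow> f v \<in> linear_maps R W U"
    and "w \<in> carrier W \<Longrightarrow> (\<lambda>v. f v w) \<in> linear_maps R V U"
    and "v \<in> carrier V \<Longrightarrow> w \<in> carrier W \<Longrightarrow> f v w \<in> carrier U"
  using assms by (auto simp: bilinear_maps_def intro: linear_maps_closed)

lemma bilinear_maps_pair:
  assumes "f \<in> bilinear_maps R V W U"
  shows "(\<lambda>p. f (fst p) (snd p)) \<in> carrier V \<times> carrier W \<rightarrow> carrier U"
  using bilinear_mapsD(3)[OF assms] by (intro Pi_I) (simp add: mem_Times_iff)


section \<open>Free modules\<close>

lemma free_module_simps:
  "carrier (free_module R X) = {f. (\<forall>x. f x \<in> carrier R) \<and> (\<forall>x. x \<notin> X \<longrightarrow> f x = \<zero>\<^bsub>R\<^esub>) \<and> finite {x \<in> X. f x \<noteq> \<zero>\<^bsub>R\<^esub>}}"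
  "zero (free_module R X) = (\<lambda>x. \<zero>\<^bsub>R\<^esub>)"
  "add (free_module R X) = (\<lambda>f g x. f x \<oplus>\<^bsub>R\<^esub> g x)"
  "smult (free_module R X) = (\<lambda>a f x. a \<otimes>\<^bsub>R\<^esub> f x)"
  by (simp_all add: free_module_def)

lemma free_module_module:
  assumes "cring R"
  shows "module R (free_module R X)"
proof -
  interpret R: cring R by fact
  have fin: "finite {x \<in> X. f x \<oplus>\<^bsub>R\<^esub> g x \<noteq> \<zero>\<^bsub>R\<^esub>}"
    if "finite {x \<in> X. f x \<noteq> \<zero>\<^bsub>R\<^esub>}" "finite {x \<in> X. g x \<noteq> \<zero>\<^bsub>R\<^esub>}" for f g
    by (rule finite_subset[OF _ finite_UnI[OF that]]) auto
  have fin': "finite {x \<in> X. a \<otimes>\<^bsub>R\<^esub> f x \<noteq> \<zero>\<^bsub>R\<^esub>}"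
    if "finite {x \<in> X. f x \<noteq> \<zero>\<^bsub>R\<^esub>}" "a \<in> carrier R" for a f
    by (rule finite_subset[OF _ that(1)]) (use that(2) in auto)
  have neg: "\<exists>g. (\<forall>x. g x \<in> carrier R) \<and> (\<forall>x. x \<notin> X \<longrightarrow> g x = \<zero>\<^bsub>R\<^esub>) \<and> finite {x \<in> X. g x \<noteq> \<zero>\<^bsub>R\<^esub>}
       \<and> (\<lambda>x. f x \<oplus>\<^bsub>R\<^esub> g x) = (\<lambda>x. \<zero>\<^bsub>R\<^esub>)"
    if "\<forall>x. f x \<in> carrier R" "\<forall>x. x \<notin> X \<longrightarrow> f x = \<zero>\<^bsub>R\<^esub>" "finite {x \<in> X. f x \<noteq> \<zero>\<^bsub>R\<^esub>}" for f
  proof (intro exI[of _ "\<lambda>x. \<ominus>\<^bsub>R\<^esub> f x"] conjI)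
    show "finite {x \<in> X. \<ominus>\<^bsub>R\<^esub> f x \<noteq> \<zero>\<^bsub>R\<^esub>}"
      by (rule finite_subset[OF _ that(3)]) auto
  qed (use that in \<open>auto simp: R.r_neg\<close>)
  show ?thesis
    by (intro moduleI abelian_groupI assms)
      (auto simp: free_module_simps fin fin' R.a_ac R.m_assoc R.l_distr R.r_distr Bex_def neg)
qed

lemma free_gen_closed:
  assumes "cring R" "x \<in> X"
  shows "free_gen R x \<in> carrier (free_module R X)"
proof -
  interpret R: cring R by fact
  have "finite {y \<in> X. free_gen R x y \<noteq> \<zero>\<^bsub>R\<^esub>}"
    by (rule finite_subset[of _ "{x}"]) (auto simp: free_gen_def)
  then show ?thesis
    using assms(2) by (auto simp: free_module_simps free_gen_def)
qed

text \<open>The sum has exactly the shape of the one inside \<open>tensor_lift\<close>, which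
  therefore unfolds to \<open>free_ext\<close> at a representative of the coset.\<close>

definition free_ext where
  "free_ext R X U g c = (\<Oplus>\<^bsub>U\<^esub>x\<in>{x \<in> X. c x \<noteq> \<zero>\<^bsub>R\<^esub>}. c x \<odot>\<^bsub>U\<^esub> g x)"

text \<open>Terms outside the support vanish. The free choice of S allows two functions with
  different supports to be summed over one index set.\<close>

lemma free_ext_superset:
  assumes "module R U" "g \<in> X \<rightarrow> carrier U" "c \<in> carrier (free_module R X)"
    and "finite S" "S \<subseteq> X" "{x \<in> X. c x \<noteq> \<zero>\<^bsub>R\<^esub>} \<subseteq> S"
  shows "free_ext R X U g c = (\<Oplus>\<^bsub>U\<^esub>x\<in>S. c x \<odot>\<^bsub>U\<^esub> g x)"
proof -
  interpret U: module R U by fact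
  have c: "c x \<in> carrier R" for x using assms(3) by (simp add: free_module_simps)
  have g: "g x \<in> carrier U" if "x \<in> S" for x using assms(2,5) that by blast
  show ?thesis
    unfolding free_ext_def
  proof (rule U.add.finprod_mono_neutral_cong_left[OF assms(4,6)])
    show "c i \<odot>\<^bsub>U\<^esub> g i = \<zero>\<^bsub>U\<^esub>" if "i \<in> S - {x \<in> X. c x \<noteq> \<zero>\<^bsub>R\<^esub>}" for i
    proof -
      have "c i = \<zero>\<^bsub>R\<^esub>" "i \<in> S" using that assms(5) by blast+
      then show ?thesis by (simp add: g)
    qed
  qed (simp_all add: c g)
qed

lemma free_ext_linear:
  assumes "module R U" "g \<in> X \<rightarrow> carrier U"
  shows "free_ext R X U g \<in> linear_maps R (free_module R X) U"
proof -
  interpret U: module R U by fact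
  interpret F: module R "free_module R X" by (rule free_module_module) unfold_locales
  have fin: "finite {x \<in> X. c x \<noteq> \<zero>\<^bsub>R\<^esub>}" if "c \<in> carrier (free_module R X)" for c
    using that by (simp add: free_module_simps)
  have cl: "c x \<in> carrier R" if "c \<in> carrier (free_module R X)" for c x
    using that by (simp add: free_module_simps)
  have g: "g x \<in> carrier U" if "x \<in> X" for x using that assms(2) by auto
  show ?thesis
  proof (rule linear_mapsI)
    show "free_ext R X U g c \<in> carrier U" if "c \<in> carrier (free_module R X)" for c
      unfolding free_ext_def using that by (auto intro!: U.finsum_closed simp: cl g)
  next
    fix c d assume c: "c \<in> carrier (free_module R X)" and d: "d \<in> carrier (free_module R X)"
    let ?S = "{x \<in> X. c x \<noteq> \<zero>\<^bsub>R\<^esub>} \<union> {x \<in> X. d x \<noteq> \<zero>\<^bsub>R\<^esub>}"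
    have S: "finite ?S" "?S \<subseteq> X" using fin[OF c] fin[OF d] by auto
    have "free_ext R X U g (c \<oplus>\<^bsub>free_module R X\<^esub> d)
        = (\<Oplus>\<^bsub>U\<^esub>x\<in>?S. (c x \<oplus>\<^bsub>R\<^esub> d x) \<odot>\<^bsub>U\<^esub> g x)"
      by (subst free_ext_superset[OF assms _ S]) (use c d in \<open>auto simp: free_module_simps\<close>,
          use c d F.a_closed in \<open>auto simp: free_module_simps\<close>)
    also have "\<dots> = (\<Oplus>\<^bsub>U\<^esub>x\<in>?S. c x \<odot>\<^bsub>U\<^esub> g x \<oplus>\<^bsub>U\<^esub> d x \<odot>\<^bsub>U\<^esub> g x)"
      by (rule U.finsum_cong') (auto simp: cl[OF c] cl[OF d] g U.smult_l_distr)
    also have "\<dots> = (\<Oplus>\<^bsub>U\<^esub>x\<in>?S. c x \<odot>\<^bsub>U\<^esub> g x) \<oplus>\<^bsub>U\<^esub> (\<Oplus>\<^bsub>U\<^esub>x\<in>?S. d x \<odot>\<^bsub>U\<^esub> g x)"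
      by (rule U.finsum_addf) (auto simp: cl[OF c] cl[OF d] g)
    also have "\<dots> = free_ext R X U g c \<oplus>\<^bsub>U\<^esub> free_ext R X U g d"
      by (subst (1 2) free_ext_superset[OF assms _ S]) (use c d in auto)
    finally show "free_ext R X U g (c \<oplus>\<^bsub>free_module R X\<^esub> d) = \<dots>" .
  next
    fix a c assume a: "a \<in> carrier R" and c: "c \<in> carrier (free_module R X)"
    let ?S = "{x \<in> X. c x \<noteq> \<zero>\<^bsub>R\<^esub>}"
    have S: "finite ?S" "?S \<subseteq> X" using fin[OF c] by auto
    have "free_ext R X U g (a \<odot>\<^bsub>free_module R X\<^esub> c)
        = (\<Oplus>\<^bsub>U\<^esub>x\<in>?S. (a \<odot>\<^bsub>free_module R X\<^esub> c) x \<odot>\<^bsub>U\<^esub> g x)"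
      using a c by (intro free_ext_superset[OF assms _ S] F.smult_closed) (auto simp: free_module_simps)
    also have "\<dots> = (\<Oplus>\<^bsub>U\<^esub>x\<in>?S. a \<odot>\<^bsub>U\<^esub> (c x \<odot>\<^bsub>U\<^esub> g x))"
      by (rule U.finsum_cong') (auto simp: a cl[OF c] g U.smult_assoc1 free_module_simps)
    also have "\<dots> = a \<odot>\<^bsub>U\<^esub> free_ext R X U g c"
      unfolding free_ext_def
      by (rule U.finsum_smult_ldistr[symmetric]) (use S in \<open>auto simp: a cl[OF c] g\<close>)
    finally show "free_ext R X U g (a \<odot>\<^bsub>free_module R X\<^esub> c) = \<dots>" .
  qed
qed

lemma free_ext_gen:
  assumes "module R U" "g \<in> X \<rightarrow> carrier U" "x \<in> X"
  shows "free_ext R X U g (free_gen R x) = g x"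
proof -
  interpret U: module R U by fact
  have g: "g x \<in> carrier U" using assms by auto
  \<comment> \<open>The index set {x} contains the support even over the zero ring, where the
    support is empty.\<close>
  have "free_ext R X U g (free_gen R x) = (\<Oplus>\<^bsub>U\<^esub>y\<in>{x}. free_gen R x y \<odot>\<^bsub>U\<^esub> g y)"
    by (rule free_ext_superset[OF assms(1,2) free_gen_closed])
      (use assms in \<open>auto simp: free_gen_def U.R.is_cring\<close>)
  also have "\<dots> = g x"
    using g by (simp add: free_gen_def)
  finally show ?thesis .
qed

text \<open>Induction on the finite support: one point x is split off as a multiple of its
  generator, and resetting c to zero at x removes x from the support.\<close>

lemma free_module_induct [consumes 2, case_names zero add]:
  assumes "cring R" "c \<in> carrier (free_module R X)"
    and zero: "P (\<lambda>x. \<zero>\<^bsub>R\<^esub>)"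
    and step: "\<And>a x d. a \<in> carrier R \<Longrightarrow> x \<in> X \<Longrightarrow> d \<in> carrier (free_module R X) \<Longrightarrow> P d \<Longrightarrow>
       P ((a \<odot>\<^bsub>free_module R X\<^esub> free_gen R x) \<oplus>\<^bsub>free_module R X\<^esub> d)"
  shows "P c"
proof -
  interpret R: cring R by fact
  have *: "P c" if "finite S" "c \<in> carrier (free_module R X)" "{x \<in> X. c x \<noteq> \<zero>\<^bsub>R\<^esub>} = S" for S c
    using that
  proof (induction S arbitrary: c rule: finite_induct)
    case empty
    have "\<forall>x. x \<notin> X \<longrightarrow> c x = \<zero>\<^bsub>R\<^esub>"
      using empty(1) by (simp add: free_module_simps)
    moreover have "\<forall>x\<in>X. c x = \<zero>\<^bsub>R\<^esub>"
      using empty(2) by (simp add: set_eq_iff)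
    ultimately have "c x = \<zero>\<^bsub>R\<^esub>" for x
      by (cases "x \<in> X") simp_all
    then have "c = (\<lambda>x. \<zero>\<^bsub>R\<^esub>)" by (rule ext)
    then show ?case using zero by (simp only:)
  next
    case (insert x S)
    define d where "d = c(x := \<zero>\<^bsub>R\<^esub>)"
    have x: "x \<in> X" using insert.prems(2) by blast
    have S: "{y \<in> X. d y \<noteq> \<zero>\<^bsub>R\<^esub>} = S" using insert.hyps(2) insert.prems(2) by (auto simp: d_def)
    have c_cl: "c y \<in> carrier R" and c_out: "y \<notin> X \<Longrightarrow> c y = \<zero>\<^bsub>R\<^esub>" for y
      using insert.prems(1) by (simp_all add: free_module_simps)
    have d: "d \<in> carrier (free_module R X)"
      unfolding free_module_simps mem_Collect_eq S using insert.hyps(1) c_cl c_out by (simp add: d_def)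
    have "c = ((c x \<odot>\<^bsub>free_module R X\<^esub> free_gen R x) \<oplus>\<^bsub>free_module R X\<^esub> d)"
      using c_cl by (intro ext) (simp add: free_module_simps d_def free_gen_def)
    moreover have "P ((c x \<odot>\<^bsub>free_module R X\<^esub> free_gen R x) \<oplus>\<^bsub>free_module R X\<^esub> d)"
      by (intro step c_cl x d insert.IH S)
    ultimately show ?case by (simp only:)
  qed
  show ?thesis
    by (rule *[OF _ assms(2) refl]) (use assms(2) in \<open>simp add: free_module_simps\<close>)
qed


section \<open>Tensor products of modules\<close>

lemma tensor_relators_closed:
  assumes "module R V" "module R W"
  shows "tensor_relators R V W \<subseteq> carrier (tensor_free R V W)"
proof -
  interpret V: module R V by fact
  interpret W: module R W by fact
  interpret F: module R "tensor_free R V W" by (rule free_module_module) unfold_locales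
  have g: "free_gen R (v, w) \<in> carrier (tensor_free R V W)" if "v \<in> carrier V" "w \<in> carrier W" for v w
    using that by (intro free_gen_closed V.R.is_cring SigmaI)
  show ?thesis
  proof
    fix r assume "r \<in> tensor_relators R V W"
    then show "r \<in> carrier (tensor_free R V W)"
      by cases (simp_all only:, (intro F.minus_closed F.a_closed F.smult_closed g V.a_closed W.a_closed
        V.smult_closed W.smult_closed; assumption)+)
  qed
qed

lemma tensor_kernel_submodule:
  assumes "module R V" "module R W"
  shows "submodule (tensor_kernel R V W) R (tensor_free R V W)"
proof -
  interpret V: module R V by fact
  interpret F: module R "tensor_free R V W" by (rule free_module_module) unfold_locales
  let ?SS = "{S. submodule S R (tensor_free R V W) \<and> tensor_relators R V W \<subseteq> S}"
  \<comment> \<open>The whole free module is a member of the family, so the intersection is not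
    taken over the empty family and stays inside the carrier.\<close>
  have *: "carrier (tensor_free R V W) \<in> ?SS"
    using F.carrier_is_submodule tensor_relators_closed[OF assms] by auto
  note E = F.submoduleE
  show ?thesis
    unfolding tensor_kernel_def
  proof (rule F.submoduleI)
    show "\<Inter> ?SS \<subseteq> carrier (tensor_free R V W)" using * by (rule Inter_lower)
    have "\<zero>\<^bsub>tensor_free R V W\<^esub> \<in> S" if "submodule S R (tensor_free R V W)" for S
      using subgroup.one_closed[OF submodule.axioms(1)[OF that]] by simp
    then show "\<zero>\<^bsub>tensor_free R V W\<^esub> \<in> \<Inter> ?SS" by blast
    show "\<ominus>\<^bsub>tensor_free R V W\<^esub> c \<in> \<Inter> ?SS" if "c \<in> \<Inter> ?SS" for c
      using that E(3) by blast
    show "c \<oplus>\<^bsub>tensor_free R V W\<^esub> d \<in> \<Inter> ?SS" if "c \<in> \<Inter> ?SS" "d \<in> \<Inter> ?SS" for c d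
      using that E(5) by blast
    show "a \<odot>\<^bsub>tensor_free R V W\<^esub> c \<in> \<Inter> ?SS" if "a \<in> carrier R" "c \<in> \<Inter> ?SS" for a c
      using that E(4) by blast
  qed
qed

lemma tensor_relators_kernel: "tensor_relators R V W \<subseteq> tensor_kernel R V W"
  by (auto simp: tensor_kernel_def)

lemma tensor_kernel_subset:
  "submodule S R (tensor_free R V W) \<Longrightarrow> tensor_relators R V W \<subseteq> S \<Longrightarrow> tensor_kernel R V W \<subseteq> S"
  by (auto simp: tensor_kernel_def)

lemma tensor_kernel_abelian_subgroup:
  assumes "module R V" "module R W"
  shows "abelian_subgroup (tensor_kernel R V W) (tensor_free R V W)"
proof -
  interpret V: module R V by fact
  interpret F: module R "tensor_free R V W" by (rule free_module_module) unfold_locales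
  show ?thesis
    by (intro abelian_subgroupI3 additive_subgroup.intro F.abelian_group_axioms
        submodule.axioms(1)[OF tensor_kernel_submodule[OF assms]])
qed

section \<open>The quotient module structure and its universal property\<close>

abbreviation tensor_class where
  "tensor_class R V W c \<equiv> tensor_kernel R V W +>\<^bsub>tensor_free R V W\<^esub> c"

lemma tensor_simps:
  "carrier (tensor R V W) = a_rcosets\<^bsub>tensor_free R V W\<^esub> (tensor_kernel R V W)"
  "zero (tensor R V W) = tensor_kernel R V W"
  "add (tensor R V W) = set_add (tensor_free R V W)"
  "smult (tensor R V W) = (\<lambda>a T. \<Union>f\<in>T. tensor_class R V W (a \<odot>\<^bsub>tensor_free R V W\<^esub> f))"
  "mult (tensor R V W) = tensor_op R V W V W V W (mult V) (mult W)"
  "one (tensor R V W) = pure_tensor R V W \<one>\<^bsub>V\<^esub> \<one>\<^bsub>W\<^esub>"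
  by (simp_all add: tensor_def tensor_module_def)

locale module_pair = V: module R V + W: module R W
  for R :: "('k, 'r) ring_scheme"
    and V :: "('k, 'v, 'a) module_scheme" and W :: "('k, 'w, 'b) module_scheme"
begin

sublocale F: module R "tensor_free R V W"
  by (rule free_module_module) unfold_locales

sublocale K: abelian_subgroup "tensor_kernel R V W" "tensor_free R V W"
  by (rule tensor_kernel_abelian_subgroup) unfold_locales

lemma kernel_smult:
  "a \<in> carrier R \<Longrightarrow> c \<in> tensor_kernel R V W \<Longrightarrow> a \<odot>\<^bsub>tensor_free R V W\<^esub> c \<in> tensor_kernel R V W"
  by (rule submodule.smult_closed[OF tensor_kernel_submodule]) unfold_locales

lemma class_closed: "c \<in> carrier (tensor_free R V W) \<Longrightarrow> tensor_class R V W c \<in> carrier (tensor R V W)"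
  unfolding tensor_simps by (intro F.a_rcosetsI K.a_subset)

lemma class_exhaust:
  assumes "t \<in> carrier (tensor R V W)"
  obtains c where "c \<in> carrier (tensor_free R V W)" "t = tensor_class R V W c"
  using assms unfolding tensor_simps A_RCOSETS_def' a_r_coset_def' by blast

lemma class_add:
  "c \<in> carrier (tensor_free R V W) \<Longrightarrow> d \<in> carrier (tensor_free R V W) \<Longrightarrow>
    tensor_class R V W c \<oplus>\<^bsub>tensor R V W\<^esub> tensor_class R V W d = tensor_class R V W (c \<oplus>\<^bsub>tensor_free R V W\<^esub> d)"
  unfolding tensor_simps by (rule K.a_rcos_sum)

lemma class_eqI:
  assumes "c \<in> carrier (tensor_free R V W)" "d \<in> carrier (tensor_free R V W)"
    and "c \<ominus>\<^bsub>tensor_free R V W\<^esub> d \<in> tensor_kernel R V W"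
  shows "tensor_class R V W c = tensor_class R V W d"
  using K.a_rcos_module_rev[OF assms(2,1)] K.a_repr_independence'[OF _ assms(2), of c] assms(3)
  unfolding a_minus_def by simp

lemma class_eqD:
  assumes "c \<in> carrier (tensor_free R V W)" "d \<in> tensor_class R V W c"
  shows "d \<in> carrier (tensor_free R V W)" "d \<ominus>\<^bsub>tensor_free R V W\<^esub> c \<in> tensor_kernel R V W"
    "tensor_class R V W d = tensor_class R V W c"
  using K.a_elemrcos_carrier[OF assms] K.a_rcos_module_imp[OF assms]
    K.a_repr_independence'[OF assms(2,1)] unfolding a_minus_def by simp_all

text \<open>The scalar action on a coset is defined as a union over all representatives. As the
  kernel is closed under scalars, every representative contributes the same coset, and the union
  collapses.\<close>

lemma class_smult:
  assumes "a \<in> carrier R" "c \<in> carrier (tensor_free R V W)"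
  shows "a \<odot>\<^bsub>tensor R V W\<^esub> tensor_class R V W c = tensor_class R V W (a \<odot>\<^bsub>tensor_free R V W\<^esub> c)"
proof -
  have "tensor_class R V W (a \<odot>\<^bsub>tensor_free R V W\<^esub> d) = tensor_class R V W (a \<odot>\<^bsub>tensor_free R V W\<^esub> c)"
    if "d \<in> tensor_class R V W c" for d
  proof (rule class_eqI)
    note d = class_eqD[OF assms(2) that]
    have "a \<odot>\<^bsub>tensor_free R V W\<^esub> (d \<ominus>\<^bsub>tensor_free R V W\<^esub> c) \<in> tensor_kernel R V W"
      using kernel_smult assms d by blast
    then show "a \<odot>\<^bsub>tensor_free R V W\<^esub> d \<ominus>\<^bsub>tensor_free R V W\<^esub> a \<odot>\<^bsub>tensor_free R V W\<^esub> c \<in> tensor_kernel R V W"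
      using assms d by (simp only: a_minus_def F.smult_r_distr F.smult_r_minus F.a_inv_closed)
    show "a \<odot>\<^bsub>tensor_free R V W\<^esub> d \<in> carrier (tensor_free R V W)"
      "a \<odot>\<^bsub>tensor_free R V W\<^esub> c \<in> carrier (tensor_free R V W)" using assms d by (blast intro: F.smult_closed)+
  qed
  then show ?thesis
    using K.a_rcos_self[OF assms(2)] unfolding tensor_simps by blast
qed

lemma class_zero: "tensor_class R V W \<zero>\<^bsub>tensor_free R V W\<^esub> = \<zero>\<^bsub>tensor R V W\<^esub>"
  unfolding tensor_simps by (rule K.a_rcos_const) (rule K.zero_closed)

lemma tensor_module_axioms: "module R (tensor R V W)"
proof -
  let ?T = "tensor R V W"
  have closed: "x \<oplus>\<^bsub>?T\<^esub> y \<in> carrier ?T" if "x \<in> carrier ?T" "y \<in> carrier ?T" for x y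
    using that by (elim class_exhaust) (simp only: class_add class_closed F.a_closed)
  have zero: "\<zero>\<^bsub>?T\<^esub> \<in> carrier ?T"
    unfolding class_zero[symmetric] by (rule class_closed) (rule F.zero_closed)
  have assoc: "x \<oplus>\<^bsub>?T\<^esub> y \<oplus>\<^bsub>?T\<^esub> z = x \<oplus>\<^bsub>?T\<^esub> (y \<oplus>\<^bsub>?T\<^esub> z)"
    if "x \<in> carrier ?T" "y \<in> carrier ?T" "z \<in> carrier ?T" for x y z
    using that by (elim class_exhaust) (simp only: class_add F.a_closed F.a_assoc)
  have comm: "x \<oplus>\<^bsub>?T\<^esub> y = y \<oplus>\<^bsub>?T\<^esub> x" if "x \<in> carrier ?T" "y \<in> carrier ?T" for x y
    using that by (elim class_exhaust) (simp only: class_add F.a_comm)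
  have l_zero: "\<zero>\<^bsub>?T\<^esub> \<oplus>\<^bsub>?T\<^esub> x = x" if "x \<in> carrier ?T" for x
    using that unfolding class_zero[symmetric]
    by (elim class_exhaust) (simp only: class_add F.zero_closed F.l_zero)
  have neg: "\<exists>y\<in>carrier ?T. y \<oplus>\<^bsub>?T\<^esub> x = \<zero>\<^bsub>?T\<^esub>" if x: "x \<in> carrier ?T" for x
  proof -
    obtain c where c: "c \<in> carrier (tensor_free R V W)" "x = tensor_class R V W c"
      by (rule class_exhaust[OF x])
    show ?thesis
      unfolding c(2)
      by (rule bexI[of _ "tensor_class R V W (\<ominus>\<^bsub>tensor_free R V W\<^esub> c)"])
        (simp_all only: class_add class_closed F.a_inv_closed c(1) F.l_neg class_zero)
  qed
  have one: "\<one>\<^bsub>R\<^esub> \<odot>\<^bsub>?T\<^esub> x = x" if "x \<in> carrier ?T" for x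
    using that by (elim class_exhaust) (simp only: class_smult F.smult_one V.R.one_closed)
  have smult_closed: "a \<odot>\<^bsub>?T\<^esub> x \<in> carrier ?T" if "a \<in> carrier R" "x \<in> carrier ?T" for a x
    using that by (elim class_exhaust) (simp only: class_smult class_closed F.smult_closed)
  have l_distr: "(a \<oplus>\<^bsub>R\<^esub> b) \<odot>\<^bsub>?T\<^esub> x = a \<odot>\<^bsub>?T\<^esub> x \<oplus>\<^bsub>?T\<^esub> b \<odot>\<^bsub>?T\<^esub> x"
    if "a \<in> carrier R" "b \<in> carrier R" "x \<in> carrier ?T" for a b x
    using that by (elim class_exhaust)
      (simp only: class_smult class_add F.smult_closed V.R.a_closed F.smult_l_distr)
  have r_distr: "a \<odot>\<^bsub>?T\<^esub> (x \<oplus>\<^bsub>?T\<^esub> y) = a \<odot>\<^bsub>?T\<^esub> x \<oplus>\<^bsub>?T\<^esub> a \<odot>\<^bsub>?T\<^esub> y"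
    if "a \<in> carrier R" "x \<in> carrier ?T" "y \<in> carrier ?T" for a x y
    using that by (elim class_exhaust)
      (simp only: class_smult class_add F.smult_closed F.a_closed F.smult_r_distr)
  have smult_assoc: "(a \<otimes>\<^bsub>R\<^esub> b) \<odot>\<^bsub>?T\<^esub> x = a \<odot>\<^bsub>?T\<^esub> (b \<odot>\<^bsub>?T\<^esub> x)"
    if "a \<in> carrier R" "b \<in> carrier R" "x \<in> carrier ?T" for a b x
    using that by (elim class_exhaust)
      (simp only: class_smult F.smult_closed V.R.m_closed F.smult_assoc1)
  show ?thesis
    by (intro moduleI abelian_groupI V.R.is_cring)
      (fact closed zero assoc comm l_zero neg one smult_closed l_distr r_distr smult_assoc)+
qed

lemma gen_closed: "v \<in> carrier V \<Longrightarrow> w \<in> carrier W \<Longrightarrow> free_gen R (v, w) \<in> carrier (tensor_free R V W)"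
  by (intro free_gen_closed V.R.is_cring SigmaI)

lemma pure_closed: "v \<in> carrier V \<Longrightarrow> w \<in> carrier W \<Longrightarrow> pure_tensor R V W v w \<in> carrier (tensor R V W)"
  unfolding pure_tensor_def by (intro class_closed gen_closed)

text \<open>Each of the four laws is one of the four kinds of relators, and these lie in the
  kernel.\<close>

lemma pure_bilinear: "pure_tensor R V W \<in> bilinear_maps R V W (tensor R V W)"
proof -
  have *: "tensor_class R V W c = tensor_class R V W d"
    if "c \<ominus>\<^bsub>tensor_free R V W\<^esub> d \<in> tensor_relators R V W"
      "c \<in> carrier (tensor_free R V W)" "d \<in> carrier (tensor_free R V W)" for c d
    using that class_eqI tensor_relators_kernel by blast
  have add_right: "pure_tensor R V W v (w \<oplus>\<^bsub>W\<^esub> w')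
      = pure_tensor R V W v w \<oplus>\<^bsub>tensor R V W\<^esub> pure_tensor R V W v w'"
    if "v \<in> carrier V" "w \<in> carrier W" "w' \<in> carrier W" for v w w'
    unfolding pure_tensor_def
    by (subst class_add[OF gen_closed gen_closed])
      (intro * tensor_relators.intros gen_closed F.a_closed W.a_closed that)+
  have add_left: "pure_tensor R V W (v \<oplus>\<^bsub>V\<^esub> v') w
      = pure_tensor R V W v w \<oplus>\<^bsub>tensor R V W\<^esub> pure_tensor R V W v' w"
    if "v \<in> carrier V" "w \<in> carrier W" "v' \<in> carrier V" for v w v'
    unfolding pure_tensor_def
    by (subst class_add[OF gen_closed gen_closed])
      (intro * tensor_relators.intros gen_closed F.a_closed V.a_closed that)+
  have smult_right: "pure_tensor R V W v (a \<odot>\<^bsub>W\<^esub> w) = a \<odot>\<^bsub>tensor R V W\<^esub> pure_tensor R V W v w"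
    if "v \<in> carrier V" "w \<in> carrier W" "a \<in> carrier R" for v w a
    unfolding pure_tensor_def
    by (subst class_smult[OF _ gen_closed])
      (intro * tensor_relators.intros gen_closed F.smult_closed W.smult_closed that)+
  have smult_left: "pure_tensor R V W (a \<odot>\<^bsub>V\<^esub> v) w = a \<odot>\<^bsub>tensor R V W\<^esub> pure_tensor R V W v w"
    if "v \<in> carrier V" "w \<in> carrier W" "a \<in> carrier R" for v w a
    unfolding pure_tensor_def
    by (subst class_smult[OF _ gen_closed])
      (intro * tensor_relators.intros gen_closed F.smult_closed V.smult_closed that)+
  show ?thesis
    by (intro bilinear_mapsI linear_mapsI pure_closed add_right add_left smult_right smult_left)
qed

text \<open>The definite description in \<open>tensor_lift\<close> is justified here: bilinearity
  makes the linear extension of f vanish on the relators, hence on the smallest submodule containing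
  them, hence it takes a single value on each coset.\<close>

lemma lift_class:
  assumes "module R U" "f \<in> bilinear_maps R V W U" "c \<in> carrier (tensor_free R V W)"
  shows "tensor_lift R V W U f (tensor_class R V W c)
    = free_ext R (carrier V \<times> carrier W) U (\<lambda>p. f (fst p) (snd p)) c"
proof -
  interpret U: module R U by fact
  let ?g = "\<lambda>p. f (fst p) (snd p)"
  let ?X = "carrier V \<times> carrier W"
  let ?\<Phi> = "free_ext R ?X U ?g"
  note f = bilinear_mapsD[OF assms(2)]
  have g: "?g \<in> ?X \<rightarrow> carrier U" by (rule bilinear_maps_pair[OF assms(2)])
  have lin: "?\<Phi> \<in> linear_maps R (tensor_free R V W) U" by (rule free_ext_linear[OF assms(1) g])
  note lin_simps = linear_maps_closed[OF lin] linear_maps_add[OF lin] linear_maps_smult[OF lin]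
  have minus: "?\<Phi> (\<ominus>\<^bsub>tensor_free R V W\<^esub> c) = \<ominus>\<^bsub>U\<^esub> ?\<Phi> c" if "c \<in> carrier (tensor_free R V W)" for c
  proof -
    have "\<ominus>\<^bsub>tensor_free R V W\<^esub> c = (\<ominus>\<^bsub>R\<^esub> \<one>\<^bsub>R\<^esub>) \<odot>\<^bsub>tensor_free R V W\<^esub> c"
      using that by (simp add: F.smult_l_minus)
    then show ?thesis using that by (simp add: lin_simps U.smult_l_minus)
  qed
  have zero: "?\<Phi> \<zero>\<^bsub>tensor_free R V W\<^esub> = \<zero>\<^bsub>U\<^esub>"
    by (rule linear_maps_zero[OF F.module_axioms assms(1) lin])
  have gen: "?\<Phi> (free_gen R (v, w)) = f v w" if "v \<in> carrier V" "w \<in> carrier W" for v w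
    using free_ext_gen[OF assms(1) g, of "(v, w)"] that by simp
  have rel: "?\<Phi> r = \<zero>\<^bsub>U\<^esub>" if "r \<in> tensor_relators R V W" for r
    using that
    by cases (auto simp: a_minus_def minus lin_simps gen_closed gen f U.r_neg
        linear_maps_add[OF f(1)] linear_maps_add[OF f(2)] linear_maps_smult[OF f(1)] linear_maps_smult[OF f(2)])
  have "tensor_kernel R V W \<subseteq> {r \<in> carrier (tensor_free R V W). ?\<Phi> r = \<zero>\<^bsub>U\<^esub>}"
  proof (rule tensor_kernel_subset)
    show "submodule {r \<in> carrier (tensor_free R V W). ?\<Phi> r = \<zero>\<^bsub>U\<^esub>} R (tensor_free R V W)"
      by (rule F.submoduleI) (auto simp: lin_simps zero minus)
    show "tensor_relators R V W \<subseteq> {r \<in> carrier (tensor_free R V W). ?\<Phi> r = \<zero>\<^bsub>U\<^esub>}"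
      using rel tensor_relators_closed[OF V.module_axioms W.module_axioms] by auto
  qed
  then have ker: "?\<Phi> r = \<zero>\<^bsub>U\<^esub>" if "r \<in> tensor_kernel R V W" for r using that by auto
  have const: "?\<Phi> d = ?\<Phi> c" if "d \<in> tensor_class R V W c" for d
  proof -
    note d = class_eqD[OF assms(3) that]
    have "\<zero>\<^bsub>U\<^esub> = ?\<Phi> (d \<ominus>\<^bsub>tensor_free R V W\<^esub> c)" using ker d(2) by simp
    also have "\<dots> = ?\<Phi> d \<ominus>\<^bsub>U\<^esub> ?\<Phi> c" using assms(3) d(1) by (simp add: a_minus_def minus lin_simps)
    finally have "\<ominus>\<^bsub>U\<^esub> (\<ominus>\<^bsub>U\<^esub> ?\<Phi> c) = ?\<Phi> d"
      by (intro U.minus_equality) (simp_all add: a_minus_def lin_simps assms(3) d(1))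
    then show ?thesis by (simp add: lin_simps assms(3))
  qed
  have "tensor_lift R V W U f (tensor_class R V W c) = (THE u. \<exists>d\<in>tensor_class R V W c. u = ?\<Phi> d)"
    by (simp add: tensor_lift_def free_ext_def)
  also have "\<dots> = ?\<Phi> c"
    by (rule the_equality) (rule bexI[OF refl K.a_rcos_self[OF assms(3)]], elim bexE, simp only: const)
  finally show ?thesis .
qed

lemma lift_linear:
  assumes "module R U" "f \<in> bilinear_maps R V W U"
  shows "tensor_lift R V W U f \<in> linear_maps R (tensor R V W) U"
proof -
  interpret U: module R U by fact
  let ?\<Phi> = "free_ext R (carrier V \<times> carrier W) U (\<lambda>p. f (fst p) (snd p))"
  have lin: "?\<Phi> \<in> linear_maps R (tensor_free R V W) U"
    by (intro free_ext_linear[OF assms(1)] bilinear_maps_pair[OF assms(2)])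
  show ?thesis
  proof (rule linear_mapsI)
    fix s t a assume s: "s \<in> carrier (tensor R V W)"
    then obtain c where c: "c \<in> carrier (tensor_free R V W)" "s = tensor_class R V W c" by (rule class_exhaust)
    show "tensor_lift R V W U f s \<in> carrier U"
      using c by (simp add: lift_class[OF assms] linear_maps_closed[OF lin])
    show "tensor_lift R V W U f (a \<odot>\<^bsub>tensor R V W\<^esub> s) = a \<odot>\<^bsub>U\<^esub> tensor_lift R V W U f s"
      if "a \<in> carrier R"
      using c that by (simp add: lift_class[OF assms] linear_maps_smult[OF lin] class_smult)
    assume t: "t \<in> carrier (tensor R V W)"
    then obtain d where d: "d \<in> carrier (tensor_free R V W)" "t = tensor_class R V W d" by (rule class_exhaust)
    show "tensor_lift R V W U f (s \<oplus>\<^bsub>tensor R V W\<^esub> t)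
        = tensor_lift R V W U f s \<oplus>\<^bsub>U\<^esub> tensor_lift R V W U f t"
      using c d by (simp add: lift_class[OF assms] linear_maps_add[OF lin] class_add)
  qed
qed

lemma lift_pure:
  assumes "module R U" "f \<in> bilinear_maps R V W U" "v \<in> carrier V" "w \<in> carrier W"
  shows "tensor_lift R V W U f (pure_tensor R V W v w) = f v w"
  using free_ext_gen[OF assms(1) bilinear_maps_pair[OF assms(2)], of "(v, w)"] assms(3,4)
  by (simp add: pure_tensor_def lift_class[OF assms(1,2)] gen_closed)

end

section \<open>Extensionality on pure tensors and congruence for Sweedler sums\<close>

lemma tensor_module [simp]: "module R V \<Longrightarrow> module R W \<Longrightarrow> module R (tensor R V W)"
  by (rule module_pair.tensor_module_axioms[OF module_pair.intro])

lemma pure_tensor_closed [simp]: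
  "module R V \<Longrightarrow> module R W \<Longrightarrow> v \<in> carrier V \<Longrightarrow> w \<in> carrier W \<Longrightarrow> pure_tensor R V W v w \<in> carrier (tensor R V W)"
  by (rule module_pair.pure_closed[OF module_pair.intro])

text \<open>Pure tensors generate the tensor product already additively: a scalar is absorbed by the
  left factor, and zero is the pure tensor of two zeros.\<close>

lemma tensor_induct [consumes 3, case_names pure add]:
  assumes "module R V" "module R W" "t \<in> carrier (tensor R V W)"
    and pure: "\<And>v w. v \<in> carrier V \<Longrightarrow> w \<in> carrier W \<Longrightarrow> P (pure_tensor R V W v w)"
    and add: "\<And>s t. s \<in> carrier (tensor R V W) \<Longrightarrow> t \<in> carrier (tensor R V W) \<Longrightarrow> P s \<Longrightarrow> P t
      \<Longrightarrow> P (s \<oplus>\<^bsub>tensor R V W\<^esub> t)"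
  shows "P t"
proof -
  interpret module_pair R V W using assms by (intro module_pair.intro)
  interpret T: module R "tensor R V W" by (rule tensor_module_axioms)
  note B = bilinear_mapsD[OF pure_bilinear]
  obtain c where c: "c \<in> carrier (tensor_free R V W)" "t = tensor_class R V W c"
    using assms(3) by (rule class_exhaust)
  have "P (tensor_class R V W c)"
    using V.R.is_cring c(1)
  proof (induction rule: free_module_induct)
    case zero
    have "tensor_class R V W (\<lambda>x. \<zero>\<^bsub>R\<^esub>) = \<zero>\<^bsub>tensor R V W\<^esub>"
      using class_zero by (simp add: free_module_simps)
    also have "\<dots> = pure_tensor R V W \<zero>\<^bsub>V\<^esub> \<zero>\<^bsub>W\<^esub>"
      using linear_maps_zero[OF W.module_axioms tensor_module_axioms B(1)[of "\<zero>\<^bsub>V\<^esub>"]] by simp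
    finally show ?case using pure by simp
  next
    case (add a x d)
    obtain v w where x: "x = (v, w)" "v \<in> carrier V" "w \<in> carrier W" using add(2) by auto
    have "tensor_class R V W (a \<odot>\<^bsub>tensor_free R V W\<^esub> free_gen R x)
        = pure_tensor R V W (a \<odot>\<^bsub>V\<^esub> v) w"
      using x add(1) linear_maps_smult[OF B(2), of w a v]
      by (simp add: pure_tensor_def class_smult gen_closed)
    then have "P (tensor_class R V W (a \<odot>\<^bsub>tensor_free R V W\<^esub> free_gen R x) \<oplus>\<^bsub>tensor R V W\<^esub> tensor_class R V W d)"
      using x add pure by (intro assms(5)) (simp_all add: class_closed pure_closed)
    then show ?case
      using x add by (simp add: class_add gen_closed)
  qed
  then show ?thesis by (simp add: c)
qed

text \<open>Immediate from \<open>tensor_induct\<close>, and the standard way below to reduce an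
  identity that is linear in a tensor to generators.\<close>

lemma tensor_linear_maps_eqI:
  assumes "module R V" "module R W" "module R U"
    and "f \<in> linear_maps R (tensor R V W) U" "g \<in> linear_maps R (tensor R V W) U"
    and "\<And>v w. v \<in> carrier V \<Longrightarrow> w \<in> carrier W \<Longrightarrow> f (pure_tensor R V W v w) = g (pure_tensor R V W v w)"
    and "t \<in> carrier (tensor R V W)"
  shows "f t = g t"
  using assms(1,2,7)
  by (induction rule: tensor_induct)
    (use assms(4-6) in \<open>auto simp: linear_maps_add\<close>)

text \<open>The fold meets f only at elements of A, so agreement on A suffices without any closure
  condition. This keeps \<open>tensor_lift_cong\<close> free of bilinearity assumptions.\<close>

lemma foldSetD_cong:
  assumes "(A, y) \<in> foldSetD D f e" "\<And>x z. x \<in> A \<Longrightarrow> f x z = g x z"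
  shows "(A, y) \<in> foldSetD D g e"
  using assms
proof (induction rule: foldSetD.induct)
  case emptyI
  from emptyI(1) show ?case by (rule foldSetD.emptyI)
next
  case (insertI x A y)
  have "(insert x A, g x y) \<in> foldSetD D g e"
    using insertI by (intro foldSetD.insertI) simp_all
  then show ?case using insertI.prems by simp
qed

lemma finprod_cong_simple:
  assumes "\<And>x. x \<in> A \<Longrightarrow> f x = g x"
  shows "finprod G f A = finprod G g A"
proof -
  have "(A, y) \<in> foldSetD (carrier G) (mult G \<circ> f) \<one>\<^bsub>G\<^esub>
      \<longleftrightarrow> (A, y) \<in> foldSetD (carrier G) (mult G \<circ> g) \<one>\<^bsub>G\<^esub>" for y
    using assms by (auto intro: foldSetD_cong)
  then show ?thesis by (simp add: finprod_def foldD_def)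
qed

text \<open>As a congruence rule it tells the simplifier that the Sweedler components v and w lie in
  the carriers, which is what side conditions under the sums require.\<close>

lemma tensor_lift_cong [cong]:
  assumes "R = R'" "V = V'" "W = W'" "U = U'" "t = t'"
    and "\<And>v w. v \<in> carrier V' \<Longrightarrow> w \<in> carrier W' \<Longrightarrow> f v w = g v w"
  shows "tensor_lift R V W U f t = tensor_lift R' V' W' U' g t'"
proof -
  have "(\<Oplus>\<^bsub>U'\<^esub>p\<in>{p \<in> carrier V' \<times> carrier W'. c p \<noteq> \<zero>\<^bsub>R'\<^esub>}. c p \<odot>\<^bsub>U'\<^esub> f (fst p) (snd p))
      = (\<Oplus>\<^bsub>U'\<^esub>p\<in>{p \<in> carrier V' \<times> carrier W'. c p \<noteq> \<zero>\<^bsub>R'\<^esub>}. c p \<odot>\<^bsub>U'\<^esub> g (fst p) (snd p))" for c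
    unfolding finsum_def by (rule finprod_cong_simple) (auto simp: assms(6))
  then show ?thesis unfolding assms(1-5) tensor_lift_def by simp
qed

lemma tensor_lift3_cong [cong]:
  assumes "R = R'" "A = A'" "B = B'" "C = C'" "U = U'" "t = t'"
    and "\<And>a b c. a \<in> carrier A' \<Longrightarrow> b \<in> carrier B' \<Longrightarrow> c \<in> carrier C' \<Longrightarrow> f a b c = g a b c"
  shows "tensor_lift3 R A B C U f t = tensor_lift3 R' A' B' C' U' g t'"
  unfolding tensor_lift3_def assms(1-6) by (simp add: assms(7))

section \<open>Linearity of Sweedler sums and exchange of two sums\<close>

lemma tensor_lift_linear:
  assumes "module R V" "module R W" "module R U" "f \<in> bilinear_maps R V W U"
  shows "tensor_lift R V W U f \<in> linear_maps R (tensor R V W) U"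
  using assms by (intro module_pair.lift_linear module_pair.intro)

lemma tensor_lift_pure [simp]:
  assumes "module R V" "module R W" "module R U" "f \<in> bilinear_maps R V W U" "v \<in> carrier V" "w \<in> carrier W"
  shows "tensor_lift R V W U f (pure_tensor R V W v w) = f v w"
  using assms by (intro module_pair.lift_pure module_pair.intro)

lemma tensor_lift_closed [simp]:
  assumes "module R V" "module R W" "module R U" "f \<in> bilinear_maps R V W U" "t \<in> carrier (tensor R V W)"
  shows "tensor_lift R V W U f t \<in> carrier U"
  using linear_maps_closed[OF tensor_lift_linear] assms by blast

lemma tensor_lift_arg_linear [simp]:
  assumes "module R V" "module R W" "module R U" "f \<in> bilinear_maps R V W U"
    and "g \<in> linear_maps R X (tensor R V W)"
  shows "(\<lambda>x. tensor_lift R V W U f (g x)) \<in> linear_maps R X U"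
  using assms by (intro linear_maps_compose[OF _ tensor_lift_linear])

text \<open>Here the tensor t is fixed and the summand depends on a parameter x. Both sides of each
  linearity law are linear in t, so they are compared on pure tensors, where \<open>lin\<close>
  applies.\<close>

lemma tensor_lift_body_linear [simp]:
  assumes "module R V" "module R W" "module R U" "module R X" "t \<in> carrier (tensor R V W)"
    and bi: "\<And>x. x \<in> carrier X \<Longrightarrow> f x \<in> bilinear_maps R V W U"
    and lin: "\<And>v w. v \<in> carrier V \<Longrightarrow> w \<in> carrier W \<Longrightarrow> (\<lambda>x. f x v w) \<in> linear_maps R X U"
  shows "(\<lambda>x. tensor_lift R V W U (f x) t) \<in> linear_maps R X U"
proof -
  interpret X: module R X by fact
  show ?thesis
  proof (rule linear_mapsI)
    fix x y assume x: "x \<in> carrier X" and y: "y \<in> carrier X"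
    have 1: "(\<lambda>t. tensor_lift R V W U (f x) t \<oplus>\<^bsub>U\<^esub> tensor_lift R V W U (f y) t) \<in> linear_maps R (tensor R V W) U"
      by (intro linear_maps_add_fun tensor_lift_linear assms(1-3) bi x y)
    have 2: "tensor_lift R V W U (f (x \<oplus>\<^bsub>X\<^esub> y)) \<in> linear_maps R (tensor R V W) U"
      by (intro tensor_lift_linear assms(1-3) bi X.a_closed x y)
    show "tensor_lift R V W U (f (x \<oplus>\<^bsub>X\<^esub> y)) t = tensor_lift R V W U (f x) t \<oplus>\<^bsub>U\<^esub> tensor_lift R V W U (f y) t"
      by (rule tensor_linear_maps_eqI[OF assms(1-3) 2 1 _ assms(5)])
        (simp cong del: tensor_lift_cong add: assms(1-3) bi x y linear_maps_add[OF lin])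
  next
    fix a x assume a: "a \<in> carrier R" and x: "x \<in> carrier X"
    have 1: "(\<lambda>t. a \<odot>\<^bsub>U\<^esub> tensor_lift R V W U (f x) t) \<in> linear_maps R (tensor R V W) U"
      by (intro linear_maps_smult_fun tensor_lift_linear assms(1-3) bi x a)
    have 2: "tensor_lift R V W U (f (a \<odot>\<^bsub>X\<^esub> x)) \<in> linear_maps R (tensor R V W) U"
      by (intro tensor_lift_linear assms(1-3) bi X.smult_closed x a)
    show "tensor_lift R V W U (f (a \<odot>\<^bsub>X\<^esub> x)) t = a \<odot>\<^bsub>U\<^esub> tensor_lift R V W U (f x) t"
      by (rule tensor_linear_maps_eqI[OF assms(1-3) 2 1 _ assms(5)])
        (simp cong del: tensor_lift_cong add: assms(1-3) bi x a linear_maps_smult[OF lin])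
  qed (simp add: assms(1-3,5) bi)
qed

text \<open>Both sides are linear in t and agree on pure tensors. With this rule an axiom of the
  form "a Sweedler sum equals an element" is transferred to an arbitrary linear image.\<close>

lemma linear_tensor_lift:
  assumes "module R V" "module R W" "module R U" "module R U'"
    and "h \<in> linear_maps R U U'" "f \<in> bilinear_maps R V W U" "t \<in> carrier (tensor R V W)"
  shows "h (tensor_lift R V W U f t) = tensor_lift R V W U' (\<lambda>v w. h (f v w)) t"
proof -
  have *: "(\<lambda>v w. h (f v w)) \<in> bilinear_maps R V W U'"
    using bilinear_mapsD[OF assms(6)]
    by (intro bilinear_mapsI) (simp_all add: linear_maps_compose[OF _ assms(5)])
  show ?thesis
    by (rule tensor_linear_maps_eqI[OF assms(1,2,4) _ _ _ assms(7),
          of "\<lambda>t. h (tensor_lift R V W U f t)" "tensor_lift R V W U' (\<lambda>v w. h (f v w))"])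
      (simp_all add: assms * tensor_lift_linear linear_maps_compose[OF tensor_lift_linear])
qed

lemma tensor_lift_tensor_lift [simp]:
  assumes "module R V" "module R W" "module R A" "module R B" "module R U"
    and "g \<in> bilinear_maps R A B U" "f \<in> bilinear_maps R V W (tensor R A B)" "t \<in> carrier (tensor R V W)"
  shows "tensor_lift R A B U g (tensor_lift R V W (tensor R A B) f t)
    = tensor_lift R V W U (\<lambda>v w. tensor_lift R A B U g (f v w)) t"
  using assms by (intro linear_tensor_lift[of R V W "tensor R A B" U "tensor_lift R A B U g" f]) (simp_all add: tensor_lift_linear)

text \<open>A Fubini rule: both sides are linear in s, and for pure s the sum over s disappears on
  either side.\<close>

lemma tensor_lift_swap:
  assumes "module R A" "module R B" "module R C" "module R D" "module R U"
    and "s \<in> carrier (tensor R A B)" "t \<in> carrier (tensor R C D)"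
    and "\<And>b c d. b \<in> carrier B \<Longrightarrow> c \<in> carrier C \<Longrightarrow> d \<in> carrier D \<Longrightarrow> (\<lambda>a. f a b c d) \<in> linear_maps R A U"
    and "\<And>a c d. a \<in> carrier A \<Longrightarrow> c \<in> carrier C \<Longrightarrow> d \<in> carrier D \<Longrightarrow> (\<lambda>b. f a b c d) \<in> linear_maps R B U"
    and "\<And>a b d. a \<in> carrier A \<Longrightarrow> b \<in> carrier B \<Longrightarrow> d \<in> carrier D \<Longrightarrow> (\<lambda>c. f a b c d) \<in> linear_maps R C U"
    and "\<And>a b c. a \<in> carrier A \<Longrightarrow> b \<in> carrier B \<Longrightarrow> c \<in> carrier C \<Longrightarrow> (\<lambda>d. f a b c d) \<in> linear_maps R D U"
  shows "tensor_lift R A B U (\<lambda>a b. tensor_lift R C D U (\<lambda>c d. f a b c d) t) s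
    = tensor_lift R C D U (\<lambda>c d. tensor_lift R A B U (\<lambda>a b. f a b c d) s) t"
proof -
  have AB: "(\<lambda>a b. f a b c d) \<in> bilinear_maps R A B U" if "c \<in> carrier C" "d \<in> carrier D" for c d
    using that by (intro bilinear_mapsI assms)
  have CD: "(\<lambda>c d. f a b c d) \<in> bilinear_maps R C D U" if "a \<in> carrier A" "b \<in> carrier B" for a b
    using that by (intro bilinear_mapsI assms)
  have 1: "(\<lambda>a b. tensor_lift R C D U (\<lambda>c d. f a b c d) t) \<in> bilinear_maps R A B U"
    by (intro bilinear_mapsI tensor_lift_body_linear assms(1-5,7-11) CD)
  have 2: "(\<lambda>c d. tensor_lift R A B U (\<lambda>a b. f a b c d) s) \<in> bilinear_maps R C D U"
    if "s \<in> carrier (tensor R A B)" for s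
    by (intro bilinear_mapsI tensor_lift_body_linear assms(1-5,8-11) that AB)
  have 3: "(\<lambda>s. tensor_lift R C D U (\<lambda>c d. tensor_lift R A B U (\<lambda>a b. f a b c d) s) t)
      \<in> linear_maps R (tensor R A B) U"
    by (intro tensor_lift_body_linear tensor_module tensor_lift_linear AB 2 assms(1-7))
  show ?thesis
    by (rule tensor_linear_maps_eqI[OF assms(1,2,5) tensor_lift_linear[OF assms(1,2,5) 1] 3 _ assms(6)])
      (simp add: assms(1-5) 1 AB)
qed

lemma bilinear_maps_iff:
  "f \<in> bilinear_maps R V W U \<longleftrightarrow> (\<forall>v\<in>carrier V. (\<lambda>w. f v w) \<in> linear_maps R W U)
    \<and> (\<forall>w\<in>carrier W. (\<lambda>v. f v w) \<in> linear_maps R V U)"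
  by (simp add: bilinear_maps_def)

text \<open>Stated for a composite \<open>f x\<close> rather than for x itself, so that linearity of
  a nested expression follows by descending through its constructors one at a time.\<close>

lemma pure_tensor_left_linear [simp]:
  assumes "module R V" "module R W" "f \<in> linear_maps R X V" "w \<in> carrier W"
  shows "(\<lambda>x. pure_tensor R V W (f x) w) \<in> linear_maps R X (tensor R V W)"
  by (rule linear_maps_compose[OF assms(3) bilinear_mapsD(2)[OF module_pair.pure_bilinear]])
    (intro module_pair.intro assms)+

lemma pure_tensor_right_linear [simp]:
  assumes "module R V" "module R W" "f \<in> linear_maps R X W" "v \<in> carrier V"
  shows "(\<lambda>x. pure_tensor R V W v (f x)) \<in> linear_maps R X (tensor R V W)"
  by (rule linear_maps_compose[OF assms(3) bilinear_mapsD(1)[OF module_pair.pure_bilinear]])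
    (intro module_pair.intro assms)+

section \<open>Sums over threefold tensors\<close>

definition trilinear_maps where
  "trilinear_maps R A B C U =
    {f. (\<forall>a\<in>carrier A. \<forall>b\<in>carrier B. (\<lambda>c. f a b c) \<in> linear_maps R C U)
      \<and> (\<forall>a\<in>carrier A. \<forall>c\<in>carrier C. (\<lambda>b. f a b c) \<in> linear_maps R B U)
      \<and> (\<forall>b\<in>carrier B. \<forall>c\<in>carrier C. (\<lambda>a. f a b c) \<in> linear_maps R A U)}"

lemma trilinear_maps_iff:
  "f \<in> trilinear_maps R A B C U \<longleftrightarrow>
     (\<forall>a\<in>carrier A. \<forall>b\<in>carrier B. (\<lambda>c. f a b c) \<in> linear_maps R C U)
      \<and> (\<forall>a\<in>carrier A. \<forall>c\<in>carrier C. (\<lambda>b. f a b c) \<in> linear_maps R B U)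
      \<and> (\<forall>b\<in>carrier B. \<forall>c\<in>carrier C. (\<lambda>a. f a b c) \<in> linear_maps R A U)"
  by (simp add: trilinear_maps_def)

lemma trilinear_mapsD:
  assumes "f \<in> trilinear_maps R A B C U"
  shows "\<lbrakk>a \<in> carrier A; b \<in> carrier B\<rbrakk> \<Longrightarrow> (\<lambda>c. f a b c) \<in> linear_maps R C U"
    and "\<lbrakk>a \<in> carrier A; c \<in> carrier C\<rbrakk> \<Longrightarrow> (\<lambda>b. f a b c) \<in> linear_maps R B U"
    and "\<lbrakk>b \<in> carrier B; c \<in> carrier C\<rbrakk> \<Longrightarrow> (\<lambda>a. f a b c) \<in> linear_maps R A U"
    and "\<lbrakk>a \<in> carrier A; b \<in> carrier B; c \<in> carrier C\<rbrakk> \<Longrightarrow> f a b c \<in> carrier U"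
  using assms unfolding trilinear_maps_def by (blast intro: linear_maps_closed)+

lemma tensor_lift3_inner_bilinear:
  assumes "module R A" "module R B" "module R C" "module R U" "f \<in> trilinear_maps R A B C U"
  shows "(\<lambda>s c. tensor_lift R A B U (\<lambda>a b. f a b c) s) \<in> bilinear_maps R (tensor R A B) C U"
  unfolding bilinear_maps_iff
  using assms trilinear_mapsD[OF assms(5)]
  by (auto intro!: tensor_lift_body_linear tensor_lift_linear simp: bilinear_maps_iff)

lemma tensor_lift3_linear:
  assumes "module R A" "module R B" "module R C" "module R U" "f \<in> trilinear_maps R A B C U"
  shows "tensor_lift3 R A B C U f \<in> linear_maps R (tensor3 R A B C) U"
  unfolding tensor_lift3_def using assms
  by (intro tensor_lift_linear tensor_lift3_inner_bilinear tensor_module)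

lemma tensor_lift3_closed [simp]:
  assumes "module R A" "module R B" "module R C" "module R U" "f \<in> trilinear_maps R A B C U"
    and "t \<in> carrier (tensor3 R A B C)"
  shows "tensor_lift3 R A B C U f t \<in> carrier U"
  using linear_maps_closed[OF tensor_lift3_linear] assms by blast

lemma tensor_lift3_pure [simp]:
  assumes "module R A" "module R B" "module R C" "module R U" "f \<in> trilinear_maps R A B C U"
    and "s \<in> carrier (tensor R A B)" "c \<in> carrier C"
  shows "tensor_lift3 R A B C U f (pure_tensor R (tensor R A B) C s c)
    = tensor_lift R A B U (\<lambda>a b. f a b c) s"
  unfolding tensor_lift3_def
  using assms by (intro tensor_lift_pure tensor_lift3_inner_bilinear tensor_module)

lemma tensor_lift3_arg_linear [simp]:
  assumes "module R A" "module R B" "module R C" "module R U" "f \<in> trilinear_maps R A B C U"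
    and "g \<in> linear_maps R X (tensor3 R A B C)"
  shows "(\<lambda>x. tensor_lift3 R A B C U f (g x)) \<in> linear_maps R X U"
  using assms by (intro linear_maps_compose[OF _ tensor_lift3_linear])

lemma tensor_lift3_body_linear [simp]:
  assumes "module R A" "module R B" "module R C" "module R U" "module R X" "t \<in> carrier (tensor3 R A B C)"
    and "\<And>x. x \<in> carrier X \<Longrightarrow> f x \<in> trilinear_maps R A B C U"
    and "\<And>a b c. a \<in> carrier A \<Longrightarrow> b \<in> carrier B \<Longrightarrow> c \<in> carrier C \<Longrightarrow> (\<lambda>x. f x a b c) \<in> linear_maps R X U"
  shows "(\<lambda>x. tensor_lift3 R A B C U (f x) t) \<in> linear_maps R X U"
  unfolding tensor_lift3_def
  using assms trilinear_mapsD[OF assms(7)]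
  by (intro tensor_lift_body_linear tensor_lift3_inner_bilinear tensor_module) (auto simp: bilinear_maps_iff)

lemma linear_tensor_lift3:
  assumes "module R A" "module R B" "module R C" "module R U" "module R U'"
    and "h \<in> linear_maps R U U'" "f \<in> trilinear_maps R A B C U" "t \<in> carrier (tensor3 R A B C)"
  shows "h (tensor_lift3 R A B C U f t) = tensor_lift3 R A B C U' (\<lambda>a b c. h (f a b c)) t"
proof -
  have bi: "(\<lambda>a b. f a b c) \<in> bilinear_maps R A B U" if "c \<in> carrier C" for c
    using trilinear_mapsD[OF assms(7)] that by (auto simp: bilinear_maps_iff)
  have "h (tensor_lift3 R A B C U f t)
      = tensor_lift R (tensor R A B) C U' (\<lambda>s c. h (tensor_lift R A B U (\<lambda>a b. f a b c) s)) t"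
    unfolding tensor_lift3_def
    using assms by (intro linear_tensor_lift tensor_lift3_inner_bilinear tensor_module)
  also have "\<dots> = tensor_lift R (tensor R A B) C U' (\<lambda>s c. tensor_lift R A B U' (\<lambda>a b. h (f a b c)) s) t"
    by (intro tensor_lift_cong refl linear_tensor_lift[OF assms(1,2,4,5,6)] bi)
  finally show ?thesis by (simp only: tensor_lift3_def)
qed

lemma tensor_lift_tensor_lift3 [simp]:
  assumes "module R V" "module R W" "module R A" "module R B" "module R C" "module R U"
    and "g \<in> bilinear_maps R V W U" "f \<in> trilinear_maps R A B C (tensor R V W)" "t \<in> carrier (tensor3 R A B C)"
  shows "tensor_lift R V W U g (tensor_lift3 R A B C (tensor R V W) f t)
    = tensor_lift3 R A B C U (\<lambda>a b c. tensor_lift R V W U g (f a b c)) t"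
  using assms by (intro linear_tensor_lift3[of R A B C "tensor R V W" U "tensor_lift R V W U g" f])
    (simp_all add: tensor_lift_linear)

text \<open>A threefold sum is a nest of two twofold sums; the sum over t is moved out of the inner
  one and then out of the outer one.\<close>

lemma tensor_lift3_swap:
  assumes mods: "module R A" "module R B" "module R E" "module R C" "module R D" "module R U"
    and s: "s \<in> carrier (tensor3 R A B E)" and t: "t \<in> carrier (tensor R C D)"
    and tri: "\<And>c d. c \<in> carrier C \<Longrightarrow> d \<in> carrier D \<Longrightarrow> (\<lambda>a b e. f a b e c d) \<in> trilinear_maps R A B E U"
    and bi: "\<And>a b e. a \<in> carrier A \<Longrightarrow> b \<in> carrier B \<Longrightarrow> e \<in> carrier E \<Longrightarrow>
      (\<lambda>c d. f a b e c d) \<in> bilinear_maps R C D U"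
  shows "tensor_lift3 R A B E U (\<lambda>a b e. tensor_lift R C D U (\<lambda>c d. f a b e c d) t) s
    = tensor_lift R C D U (\<lambda>c d. tensor_lift3 R A B E U (\<lambda>a b e. f a b e c d) s) t"
proof -
  note T = trilinear_mapsD[OF tri] note B = bilinear_mapsD[OF bi]
  have "tensor_lift3 R A B E U (\<lambda>a b e. tensor_lift R C D U (\<lambda>c d. f a b e c d) t) s
      = tensor_lift R (tensor R A B) E U (\<lambda>r e. tensor_lift R C D U (\<lambda>c d.
          tensor_lift R A B U (\<lambda>a b. f a b e c d) r) t) s"
    unfolding tensor_lift3_def
    by (intro tensor_lift_cong refl tensor_lift_swap mods t T B)
  also have "\<dots> = tensor_lift R C D U (\<lambda>c d. tensor_lift R (tensor R A B) E U (\<lambda>r e.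
          tensor_lift R A B U (\<lambda>a b. f a b e c d) r) s) t"
    by (intro tensor_lift_swap mods s t tensor_module tensor_lift_linear tensor_lift_body_linear bilinear_mapsI T B)
  finally show ?thesis by (simp only: tensor_lift3_def)
qed

lemma tensor_lift33_swap:
  assumes mods: "module R A" "module R B" "module R E" "module R C" "module R D" "module R F" "module R U"
    and s: "s \<in> carrier (tensor3 R A B E)" and t: "t \<in> carrier (tensor3 R C D F)"
    and tri: "\<And>c d g. c \<in> carrier C \<Longrightarrow> d \<in> carrier D \<Longrightarrow> g \<in> carrier F \<Longrightarrow>
      (\<lambda>a b e. f a b e c d g) \<in> trilinear_maps R A B E U"
    and tri': "\<And>a b e. a \<in> carrier A \<Longrightarrow> b \<in> carrier B \<Longrightarrow> e \<in> carrier E \<Longrightarrow>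
      (\<lambda>c d g. f a b e c d g) \<in> trilinear_maps R C D F U"
  shows "tensor_lift3 R A B E U (\<lambda>a b e. tensor_lift3 R C D F U (\<lambda>c d g. f a b e c d g) t) s
    = tensor_lift3 R C D F U (\<lambda>c d g. tensor_lift3 R A B E U (\<lambda>a b e. f a b e c d g) s) t"
proof -
  note T = trilinear_mapsD[OF tri] note T' = trilinear_mapsD[OF tri']
  have "tensor_lift3 R A B E U (\<lambda>a b e. tensor_lift3 R C D F U (\<lambda>c d g. f a b e c d g) t) s
      = tensor_lift R (tensor R C D) F U (\<lambda>r g. tensor_lift3 R A B E U (\<lambda>a b e.
          tensor_lift R C D U (\<lambda>c d. f a b e c d g) r) s) t"
    unfolding tensor_lift3_def[of R C D F]
    by (intro tensor_lift3_swap mods s t tensor_module bilinear_mapsI tensor_lift_linear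
        tensor_lift_body_linear T T' trilinear_maps_iff[THEN iffD2] conjI ballI)
  also have "\<dots> = tensor_lift3 R C D F U (\<lambda>c d g. tensor_lift3 R A B E U (\<lambda>a b e. f a b e c d g) s) t"
    unfolding tensor_lift3_def[of R C D F]
    by (intro tensor_lift_cong tensor_lift3_swap refl mods s bilinear_mapsI T T' trilinear_maps_iff[THEN iffD2] conjI ballI)
  finally show ?thesis .
qed

declare tensor_lift_linear [simp] tensor_lift3_linear [simp]

lemma id_linear [simp]: "id \<in> linear_maps R V V"
  by (simp add: id_def)

lemma trilinear_compose:
  assumes "f \<in> trilinear_maps R A B C U"
  shows "\<lbrakk>g \<in> linear_maps R X C; a \<in> carrier A; b \<in> carrier B\<rbrakk> \<Longrightarrow> (\<lambda>x. f a b (g x)) \<in> linear_maps R X U"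
    and "\<lbrakk>g' \<in> linear_maps R X B; a \<in> carrier A; c \<in> carrier C\<rbrakk> \<Longrightarrow> (\<lambda>x. f a (g' x) c) \<in> linear_maps R X U"
    and "\<lbrakk>g'' \<in> linear_maps R X A; b \<in> carrier B; c \<in> carrier C\<rbrakk> \<Longrightarrow> (\<lambda>x. f (g'' x) b c) \<in> linear_maps R X U"
  using linear_maps_compose trilinear_mapsD[OF assms] by blast+

lemma smult_compose_linear [simp]:
  assumes "module R U" "f \<in> linear_maps R X U" "a \<in> carrier R"
  shows "(\<lambda>x. a \<odot>\<^bsub>U\<^esub> f x) \<in> linear_maps R X U"
  using assms by (intro linear_maps_smult_fun)

lemma module_smult_one [simp]: "module R U \<Longrightarrow> u \<in> carrier U \<Longrightarrow> \<one>\<^bsub>R\<^esub> \<odot>\<^bsub>U\<^esub> u = u"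
  by (rule module.smult_one)

lemma module_smult_smult: "module R U \<Longrightarrow> a \<in> carrier R \<Longrightarrow> b \<in> carrier R \<Longrightarrow> u \<in> carrier U \<Longrightarrow>
  (a \<otimes>\<^bsub>R\<^esub> b) \<odot>\<^bsub>U\<^esub> u = a \<odot>\<^bsub>U\<^esub> (b \<odot>\<^bsub>U\<^esub> u)"
  by (rule module.smult_assoc1)

lemma smult_left_commute:
  assumes "module R U" "a \<in> carrier R" "b \<in> carrier R" "u \<in> carrier U"
  shows "a \<odot>\<^bsub>U\<^esub> (b \<odot>\<^bsub>U\<^esub> u) = b \<odot>\<^bsub>U\<^esub> (a \<odot>\<^bsub>U\<^esub> u)"
proof -
  interpret module R U by fact
  show ?thesis using assms by (simp add: smult_assoc1[symmetric] R.m_comm)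
qed

lemma tensor_lift_smult:
  assumes "module R V" "module R W" "module R U" "f \<in> bilinear_maps R V W U" "c \<in> carrier R" "t \<in> carrier (tensor R V W)"
  shows "tensor_lift R V W U (\<lambda>v w. c \<odot>\<^bsub>U\<^esub> f v w) t = c \<odot>\<^bsub>U\<^esub> tensor_lift R V W U f t"
  by (rule linear_tensor_lift[symmetric]) (simp_all add: assms)

lemma tensor_lift3_smult:
  assumes "module R A" "module R B" "module R C" "module R U" "f \<in> trilinear_maps R A B C U" "c \<in> carrier R"
    "t \<in> carrier (tensor3 R A B C)"
  shows "tensor_lift3 R A B C U (\<lambda>x y z. c \<odot>\<^bsub>U\<^esub> f x y z) t = c \<odot>\<^bsub>U\<^esub> tensor_lift3 R A B C U f t"
  by (rule linear_tensor_lift3[symmetric]) (simp_all add: assms)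

text \<open>The operation \<open>tensor_op\<close> lands in \<open>tensor_module\<close>, because
  the multiplication of \<open>tensor\<close> is itself defined by it. A lift sees only the additive
  structure and the scalars of its target, which the two records share.\<close>

lemma tensor_lift_tensor_module: "tensor_lift R V W (tensor_module R A B) = tensor_lift R V W (tensor R A B)"
proof -
  have "smult (tensor_module R A B) = smult (tensor R A B)"
    "add_monoid (tensor_module R A B) = add_monoid (tensor R A B)"
    by (simp_all add: tensor_def)
  then show ?thesis unfolding tensor_lift_def finsum_def by simp
qed

lemma bilinear_maps_compose_linear:
  assumes "f \<in> bilinear_maps R V W U"
  shows "g \<in> linear_maps R X V \<Longrightarrow> w \<in> carrier W \<Longrightarrow> (\<lambda>x. f (g x) w) \<in> linear_maps R X U"
    and "h \<in> linear_maps R X W \<Longrightarrow> v \<in> carrier V \<Longrightarrow> (\<lambda>x. f v (h x)) \<in> linear_maps R X U"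
  using linear_maps_compose bilinear_mapsD[OF assms] by blast+

lemma pure_tensor_bilinear: "module R V \<Longrightarrow> module R W \<Longrightarrow> pure_tensor R V W \<in> bilinear_maps R V W (tensor R V W)"
  by (intro module_pair.pure_bilinear module_pair.intro)

section \<open>Factorwise operations, tensor products of maps, reassociation\<close>

context
  fixes R :: "('k, 'r) ring_scheme"
    and A :: "('k, 'a, 'z1) module_scheme" and B :: "('k, 'b, 'z2) module_scheme"
    and V :: "('k, 'v, 'z3) module_scheme" and W :: "('k, 'w, 'z4) module_scheme"
    and A' :: "('k, 'a2, 'z5) module_scheme" and B' :: "('k, 'b2, 'z6) module_scheme"
    and f g
  assumes mods [simp]: "module R A" "module R B" "module R V" "module R W" "module R A'" "module R B'"
    and f: "f \<in> bilinear_maps R A V A'" and g: "g \<in> bilinear_maps R B W B'"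
begin

lemmas bilinear_simps = f g bilinear_mapsD[OF f] bilinear_mapsD[OF g]
  bilinear_maps_compose_linear[OF f] bilinear_maps_compose_linear[OF g]

lemma tensor_op_bilinear:
  "tensor_op R A B V W A' B' f g \<in> bilinear_maps R (tensor R A B) (tensor R V W) (tensor R A' B')"
  by (simp add: bilinear_maps_iff tensor_op_def tensor_lift_tensor_module bilinear_simps)

lemma tensor_op_pure:
  assumes "a \<in> carrier A" "b \<in> carrier B" "v \<in> carrier V" "w \<in> carrier W"
  shows "tensor_op R A B V W A' B' f g (pure_tensor R A B a b) (pure_tensor R V W v w)
    = pure_tensor R A' B' (f a v) (g b w)"
  by (simp add: bilinear_maps_iff tensor_op_def tensor_lift_tensor_module bilinear_simps assms)

lemma tensor_lift_tensor_op:
  assumes "module R U" "h \<in> bilinear_maps R A' B' U"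
    and "s \<in> carrier (tensor R A B)" "t \<in> carrier (tensor R V W)"
  shows "tensor_lift R A' B' U h (tensor_op R A B V W A' B' f g s t)
    = tensor_lift R A B U (\<lambda>a b. tensor_lift R V W U (\<lambda>v w. h (f a v) (g b w)) t) s"
  by (simp add: bilinear_maps_iff tensor_op_def tensor_lift_tensor_module bilinear_simps assms
      bilinear_mapsD[OF assms(2)] bilinear_maps_compose_linear[OF assms(2)])

end

lemma tensor_lift3_tensor_op:
  fixes R :: "('k, 'r) ring_scheme"
  assumes mods [simp]: "module R A" "module R B" "module R C" "module R V" "module R W" "module R X"
      "module R A'" "module R B'" "module R C'" "module R U"
    and f: "f \<in> bilinear_maps R A V A'" and g: "g \<in> bilinear_maps R B W B'" and k: "k \<in> bilinear_maps R C X C'"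
    and h: "h \<in> trilinear_maps R A' B' C' U"
    and s [simp]: "s \<in> carrier (tensor3 R A B C)" and t [simp]: "t \<in> carrier (tensor3 R V W X)"
  shows "tensor_lift3 R A' B' C' U h
      (tensor_op R (tensor R A B) C (tensor R V W) X (tensor R A' B') C'
        (tensor_op R A B V W A' B' f g) k s t)
    = tensor_lift3 R A B C U (\<lambda>a b c. tensor_lift3 R V W X U (\<lambda>v w x. h (f a v) (g b w) (k c x)) t) s"
proof -
  note [simp] = bilinear_mapsD[OF f] bilinear_mapsD[OF g] bilinear_mapsD[OF k] trilinear_mapsD[OF h]
    bilinear_maps_compose_linear[OF f] bilinear_maps_compose_linear[OF g] bilinear_maps_compose_linear[OF k]
    linear_maps_compose[OF _ trilinear_mapsD(1)[OF h]] linear_maps_compose[OF _ trilinear_mapsD(2)[OF h]]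
    linear_maps_compose[OF _ trilinear_mapsD(3)[OF h]]
  have h2: "(\<lambda>a b. h a b c) \<in> bilinear_maps R A' B' U" if "c \<in> carrier C'" for c
    using that by (simp add: bilinear_maps_iff)
  have "tensor_lift3 R A' B' C' U h
      (tensor_op R (tensor R A B) C (tensor R V W) X (tensor R A' B') C'
        (tensor_op R A B V W A' B' f g) k s t)
     = tensor_lift R (tensor R A B) C U (\<lambda>p c. tensor_lift R (tensor R V W) X U (\<lambda>q x.
         tensor_lift R A' B' U (\<lambda>a b. h a b (k c x)) (tensor_op R A B V W A' B' f g p q)) t) s"
    unfolding tensor_lift3_def
    by (intro tensor_lift_tensor_op tensor_op_bilinear f g k s t mods tensor_module tensor_lift3_inner_bilinear h)
  also have "\<dots> = tensor_lift R (tensor R A B) C U (\<lambda>p c. tensor_lift R (tensor R V W) X U (\<lambda>q x.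
         tensor_lift R A B U (\<lambda>a b. tensor_lift R V W U (\<lambda>v w. h (f a v) (g b w) (k c x)) q) p) t) s"
    by (intro tensor_lift_cong refl tensor_lift_tensor_op[OF _ _ _ _ _ _ f g] mods h2) (simp_all)
  \<comment> \<open>The sum over t is exchanged with the sum over the pair p, so that all components
    of s stand outside those of t.\<close>
  also have "\<dots> = tensor_lift R (tensor R A B) C U (\<lambda>p c. tensor_lift R A B U (\<lambda>a b.
         tensor_lift R (tensor R V W) X U (\<lambda>q x. tensor_lift R V W U (\<lambda>v w. h (f a v) (g b w) (k c x)) q) t) p) s"
    by (intro tensor_lift_cong refl tensor_lift_swap) (simp_all add: bilinear_maps_iff)
  finally show ?thesis by (simp only: tensor_lift3_def)
qed

lemma tensor_lift_tensor_map:
  assumes [simp]: "module R A" "module R B" "module R V" "module R W" "module R U"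
    and "f \<in> linear_maps R A V" "g \<in> linear_maps R B W" "h \<in> bilinear_maps R V W U" "t \<in> carrier (tensor R A B)"
  shows "tensor_lift R V W U h (tensor_map R A B V W f g t) = tensor_lift R A B U (\<lambda>a b. h (f a) (g b)) t"
  using assms(6-) by (simp add: tensor_map_def bilinear_maps_iff linear_maps_closed)

lemma tensor_map_linear:
  assumes [simp]: "module R A" "module R B" "module R V" "module R W"
    and "f \<in> linear_maps R A V" "g \<in> linear_maps R B W"
  shows "tensor_map R A B V W f g \<in> linear_maps R (tensor R A B) (tensor R V W)"
  using assms(5-) by (simp add: tensor_map_def bilinear_maps_iff linear_maps_closed)

lemma tensor_map_pure:
  assumes [simp]: "module R A" "module R B" "module R V" "module R W"
    and "f \<in> linear_maps R A V" "g \<in> linear_maps R B W" "a \<in> carrier A" "b \<in> carrier B"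
  shows "tensor_map R A B V W f g (pure_tensor R A B a b) = pure_tensor R V W (f a) (g b)"
  using assms(5-) by (simp add: tensor_map_def bilinear_maps_iff linear_maps_closed)

lemma tensor_lift3_tensor_map:
  assumes [simp]: "module R A" "module R B" "module R V" "module R W" "module R X" "module R U"
    and "f \<in> linear_maps R A (tensor R V W)" "g \<in> linear_maps R B X"
    and "h \<in> trilinear_maps R V W X U" "t \<in> carrier (tensor R A B)"
  shows "tensor_lift3 R V W X U h (tensor_map R A B (tensor R V W) X f g t)
    = tensor_lift R A B U (\<lambda>a b. tensor_lift R V W U (\<lambda>v w. h v w (g b)) (f a)) t"
  unfolding tensor_lift3_def
  using assms(6-) by (intro tensor_lift_tensor_map tensor_lift3_inner_bilinear) simp_all

lemma tensor_assoc_linear: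
  assumes [simp]: "module R A" "module R B" "module R C"
  shows "tensor_assoc R A B C \<in> linear_maps R (tensor R A (tensor R B C)) (tensor3 R A B C)"
  by (simp add: tensor_assoc_def bilinear_maps_iff)

lemma tensor_lift_tensor_assoc:
  assumes [simp]: "module R A" "module R B" "module R C" "module R U"
    and h: "h \<in> bilinear_maps R (tensor R A B) C U" and "t \<in> carrier (tensor R A (tensor R B C))"
  shows "tensor_lift R (tensor R A B) C U h (tensor_assoc R A B C t)
    = tensor_lift R A (tensor R B C) U (\<lambda>a s. tensor_lift R B C U (\<lambda>b c. h (pure_tensor R A B a b) c) s) t"
  using assms(6-) by (simp add: tensor_assoc_def bilinear_maps_iff h bilinear_mapsD[OF h] bilinear_maps_compose_linear[OF h])

lemma tensor_lift3_tensor_assoc: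
  assumes [simp]: "module R A" "module R B" "module R C" "module R U"
    and h: "h \<in> trilinear_maps R A B C U" and t: "t \<in> carrier (tensor R A (tensor R B C))"
  shows "tensor_lift3 R A B C U h (tensor_assoc R A B C t)
    = tensor_lift R A (tensor R B C) U (\<lambda>a s. tensor_lift R B C U (\<lambda>b c. h a b c) s) t"
  unfolding tensor_lift3_def
  by (simp add: tensor_lift_tensor_assoc tensor_lift3_inner_bilinear h t bilinear_maps_iff trilinear_mapsD[OF h]
    cong: tensor_lift_cong)

lemma tensor_assoc_pure:
  assumes [simp]: "module R A" "module R B" "module R C"
    and "a \<in> carrier A" "b \<in> carrier B" "c \<in> carrier C"
  shows "tensor_assoc R A B C (pure_tensor R A (tensor R B C) a (pure_tensor R B C b c))
    = pure_tensor R (tensor R A B) C (pure_tensor R A B a b) c"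
  using assms(4-) by (simp add: tensor_assoc_def bilinear_maps_iff)

text \<open>A comparison across record types: \<open>induced_bimodule\<close> stores the fields of a
  tensor product in a larger record, so the two can be compared only field by field.\<close>

definition same_module where
  "same_module V V' \<longleftrightarrow> carrier V = carrier V' \<and> zero V = zero V' \<and> add V = add V' \<and> smult V = smult V'"

lemma module_same:
  assumes "same_module V V'" "module R V'"
  shows "module R V"
proof -
  interpret V': module R V' by fact
  show ?thesis
    using assms(1) V'.add.inv_closed V'.l_neg unfolding same_module_def
    by (intro moduleI abelian_groupI V'.R.is_cring)
      (auto simp: V'.a_ac V'.smult_l_distr V'.smult_r_distr V'.smult_assoc1)
qed

lemma linear_maps_same:
  assumes "same_module V V'"
  shows "linear_maps R V W = linear_maps R V' W" "linear_maps R W V = linear_maps R W V'"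
  using assms by (simp_all add: linear_maps_def same_module_def)

lemma finsum_same:
  assumes "same_module V V'"
  shows "finsum V f A = finsum V' f A"
  using assms unfolding finsum_def finprod_def by (simp add: same_module_def)

lemma tensor_lift_same:
  assumes "same_module V V'"
  shows "tensor_lift R V W = tensor_lift R V' W" "tensor_lift R A B V = tensor_lift R A B V'"
proof -
  have c: "smult V = smult V'" "carrier V = carrier V'"
    using assms by (simp_all add: same_module_def)
  show "tensor_lift R V W = tensor_lift R V' W" "tensor_lift R A B V = tensor_lift R A B V'"
    unfolding tensor_lift_def c finsum_same[OF assms] by simp_all
qed

lemma tensor_relators_same:
  assumes "same_module V V'"
  shows "tensor_relators R V W = tensor_relators R V' W"
proof -
  have *: "tensor_relators R V W \<subseteq> tensor_relators R V' W" if "same_module V V'" for V V'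
  proof
    fix r assume "r \<in> tensor_relators R V W"
    then show "r \<in> tensor_relators R V' W"
      using that unfolding same_module_def
      by cases (simp_all add: tensor_relators.intros)
  qed
  show ?thesis
    using *[of V V'] *[of V' V] assms by (simp add: same_module_def)
qed

text \<open>Multiplication and unit have to be compared as well, since \<open>tensor\<close> builds
  its own from them even if V is a mere module.\<close>

lemma tensor_same:
  assumes "same_module V V'" "mult V = mult V'" "one V = one V'"
  shows "tensor R V W = tensor R V' W" "pure_tensor R V W = pure_tensor R V' W"
proof -
  have c: "carrier V = carrier V'" using assms(1) by (simp add: same_module_def)
  have k: "tensor_kernel R V W = tensor_kernel R V' W"
    unfolding tensor_kernel_def tensor_relators_same[OF assms(1)] c by simp
  show p: "pure_tensor R V W = pure_tensor R V' W"
    unfolding pure_tensor_def k c by simp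
  have m: "tensor_module R V W = tensor_module R V' W"
    unfolding tensor_module_def k c by simp
  have "tensor_op R V W V W V W = tensor_op R V' W V' W V' W"
    unfolding tensor_op_def m p tensor_lift_same(1)[OF assms(1)] by simp
  then show "tensor R V W = tensor R V' W"
    unfolding tensor_def m p assms(2,3) by simp
qed

lemma tensor_lift_pure_tensor:
  assumes [simp]: "module R V" "module R W" and "t \<in> carrier (tensor R V W)"
  shows "tensor_lift R V W (tensor R V W) (pure_tensor R V W) t = t"
  by (rule tensor_linear_maps_eqI[where U = "tensor R V W", OF _ _ _ _ _ _ assms(3)])
    (simp_all add: bilinear_maps_iff)

lemma tensor_map_tensor_map:
  assumes [simp]: "module R A" "module R B" "module R V" "module R W" "module R X" "module R Y"
    and "f \<in> linear_maps R A V" "g \<in> linear_maps R B W" "h \<in> linear_maps R V X" "k \<in> linear_maps R W Y"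
    and "t \<in> carrier (tensor R A B)"
  shows "tensor_map R V W X Y h k (tensor_map R A B V W f g t) = tensor_map R A B X Y (\<lambda>a. h (f a)) (\<lambda>b. k (g b)) t"
  unfolding tensor_map_def[of R V W X Y] tensor_map_def[of R A B X Y]
  using assms(7-) by (intro tensor_lift_tensor_map) (simp_all add: bilinear_maps_iff linear_maps_closed)

lemma tensor_map_id:
  assumes [simp]: "module R V" "module R W" and "t \<in> carrier (tensor R V W)"
  shows "tensor_map R V W V W (\<lambda>x. x) (\<lambda>x. x) t = t"
  unfolding tensor_map_def using assms by (simp add: tensor_lift_pure_tensor)

lemma tensor_map_cong:
  assumes "\<And>v. v \<in> carrier V \<Longrightarrow> f v = f' v" "\<And>w. w \<in> carrier W \<Longrightarrow> g w = g' w"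
  shows "tensor_map R V W A B f g t = tensor_map R V W A B f' g' t"
  unfolding tensor_map_def by (intro tensor_lift_cong refl) (simp add: assms)

text \<open>Naturality of factorwise operations: both sides expand to the same double sum. It
  carries the actions \<open>lact2\<close>, \<open>ract2\<close>, \<open>lact3\<close> and
  \<open>ract3\<close> along an intertwining map.\<close>

lemma tensor_map_tensor_op:
  assumes [simp]: "module R A" "module R B" "module R V" "module R W" "module R X" "module R Y"
      "module R A'" "module R B'" "module R V'" "module R W'" "module R X'" "module R Y'"
    and f: "f \<in> bilinear_maps R A V X" and g: "g \<in> bilinear_maps R B W Y"
    and f': "f' \<in> bilinear_maps R A' V' X'" and g': "g' \<in> bilinear_maps R B' W' Y'"
    and a: "a \<in> linear_maps R A A'" and b: "b \<in> linear_maps R B B'"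
    and v: "v \<in> linear_maps R V V'" and w: "w \<in> linear_maps R W W'"
    and x: "x \<in> linear_maps R X X'" and y: "y \<in> linear_maps R Y Y'"
    and fx: "\<And>p q. p \<in> carrier A \<Longrightarrow> q \<in> carrier V \<Longrightarrow> x (f p q) = f' (a p) (v q)"
    and gy: "\<And>p q. p \<in> carrier B \<Longrightarrow> q \<in> carrier W \<Longrightarrow> y (g p q) = g' (b p) (w q)"
    and s: "s \<in> carrier (tensor R A B)" and t: "t \<in> carrier (tensor R V W)"
  shows "tensor_map R X Y X' Y' x y (tensor_op R A B V W X Y f g s t)
    = tensor_op R A' B' V' W' X' Y' f' g' (tensor_map R A B A' B' a b s) (tensor_map R V W V' W' v w t)"
proof -
  note F' = f' g' bilinear_mapsD[OF f'] bilinear_mapsD[OF g']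
    bilinear_maps_compose_linear[OF f'] bilinear_maps_compose_linear[OF g']
  note P = bilinear_maps_compose_linear[OF pure_tensor_bilinear]
  note c = linear_maps_closed[OF a] linear_maps_closed[OF b] linear_maps_closed[OF v] linear_maps_closed[OF w]
  note T = tensor_map_linear[OF _ _ _ _ a b] tensor_map_linear[OF _ _ _ _ v w]
  have 1: "(\<lambda>p q. pure_tensor R X' Y' (x p) (y q)) \<in> bilinear_maps R X Y (tensor R X' Y')"
    by (simp add: bilinear_maps_iff x y linear_maps_closed[OF x] linear_maps_closed[OF y])
  have t': "tensor_map R V W V' W' v w t \<in> carrier (tensor R V' W')"
    by (simp add: linear_maps_closed[OF T(2)] t)
  have 2: "tensor_map R X Y X' Y' x y (tensor_op R A B V W X Y f g s t)
      = tensor_lift R A B (tensor R X' Y') (\<lambda>p q. tensor_lift R V W (tensor R X' Y')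
          (\<lambda>p' q'. pure_tensor R X' Y' (x (f p p')) (y (g q q'))) t) s"
    unfolding tensor_map_def by (rule tensor_lift_tensor_op) (simp_all add: f g s t 1)
  have 3: "(\<lambda>p q. tensor_lift R V' W' (tensor R X' Y') (\<lambda>p' q'. pure_tensor R X' Y' (f' p p') (g' q q'))
        (tensor_map R V W V' W' v w t)) \<in> bilinear_maps R A' B' (tensor R X' Y')"
    by (simp add: bilinear_maps_iff F' t')
  have 4: "tensor_op R A' B' V' W' X' Y' f' g' (tensor_map R A B A' B' a b s) (tensor_map R V W V' W' v w t)
      = tensor_lift R A B (tensor R X' Y') (\<lambda>p q. tensor_lift R V' W' (tensor R X' Y')
          (\<lambda>p' q'. pure_tensor R X' Y' (f' (a p) p') (g' (b q) q')) (tensor_map R V W V' W' v w t)) s"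
    unfolding tensor_op_def tensor_lift_tensor_module
    by (rule tensor_lift_tensor_map[OF _ _ _ _ _ a b 3 s]) simp_all
  also have "\<dots> = tensor_lift R A B (tensor R X' Y') (\<lambda>p q. tensor_lift R V W (tensor R X' Y')
          (\<lambda>p' q'. pure_tensor R X' Y' (f' (a p) (v p')) (g' (b q) (w q'))) t) s"
    by (intro tensor_lift_cong refl tensor_lift_tensor_map[OF _ _ _ _ _ v w _ t])
      (simp_all add: bilinear_maps_iff F' c)
  also have "\<dots> = tensor_lift R A B (tensor R X' Y') (\<lambda>p q. tensor_lift R V W (tensor R X' Y')
          (\<lambda>p' q'. pure_tensor R X' Y' (x (f p p')) (y (g q q'))) t) s"
    by (intro tensor_lift_cong refl) (simp add: fx gy)
  finally show ?thesis using 2 by simp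
qed


text \<open>Meant for e the projection \<open>E\<close>, whose fixed points are the coinvariants.
  The fields are listed separately because W may be of another record type than V.\<close>

lemma module_fixed_points:
  assumes "module R V" "e \<in> linear_maps R V V" "carrier W = {v \<in> carrier V. e v = v}"
    and [simp]: "zero W = zero V" "add W = add V" "smult W = smult V"
  shows "module R W"
proof -
  interpret V: module R V by fact
  note lin = linear_maps_add[OF assms(2)] linear_maps_smult[OF assms(2)] linear_maps_zero[OF assms(1,1,2)]
  have carrier: "v \<in> carrier W \<longleftrightarrow> v \<in> carrier V \<and> e v = v" for v by (simp add: assms(3))
  have "e (\<ominus>\<^bsub>V\<^esub> v) = \<ominus>\<^bsub>V\<^esub> v" if "v \<in> carrier V" "e v = v" for v
  proof -
    have "e (\<ominus>\<^bsub>V\<^esub> v) = e ((\<ominus>\<^bsub>R\<^esub> \<one>\<^bsub>R\<^esub>) \<odot>\<^bsub>V\<^esub> v)" using that by (simp add: V.smult_l_minus)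
    also have "\<dots> = (\<ominus>\<^bsub>R\<^esub> \<one>\<^bsub>R\<^esub>) \<odot>\<^bsub>V\<^esub> e v"
      by (rule linear_maps_smult[OF assms(2)]) (simp_all add: that)
    also have "\<dots> = \<ominus>\<^bsub>V\<^esub> v" using that by (simp add: V.smult_l_minus)
    finally show ?thesis .
  qed
  then have neg: "\<exists>y\<in>carrier W. y \<oplus>\<^bsub>W\<^esub> x = \<zero>\<^bsub>W\<^esub>" if "x \<in> carrier W" for x
    using that by (intro bexI[of _ "\<ominus>\<^bsub>V\<^esub> x"]) (simp_all add: V.l_neg carrier)
  show ?thesis
    by (intro moduleI abelian_groupI V.R.is_cring neg)
      (simp_all add: carrier lin V.a_ac V.smult_l_distr V.smult_r_distr V.smult_assoc1)
qed


section \<open>Tensor products of algebras\<close>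

text \<open>Shaped for the pentagon: the outer factors a and e are moved to the other side, using a
  left inverse of a and a right inverse of e.\<close>

lemma (in monoid) mult_inverses_eq:
  assumes "a \<otimes> b = c \<otimes> d \<otimes> e" "a' \<otimes> a = \<one>" "e \<otimes> e' = \<one>"
    and "a \<in> carrier G" "b \<in> carrier G" "c \<in> carrier G" "d \<in> carrier G" "e \<in> carrier G"
      "a' \<in> carrier G" "e' \<in> carrier G"
  shows "b \<otimes> e' = a' \<otimes> (c \<otimes> d)"
proof -
  have "b \<otimes> e' = a' \<otimes> a \<otimes> b \<otimes> e'" using assms by simp
  also have "\<dots> = a' \<otimes> (a \<otimes> b) \<otimes> e'" using assms(4-) by (simp add: m_assoc)
  also have "\<dots> = a' \<otimes> (c \<otimes> d) \<otimes> (e \<otimes> e')" using assms(4-) unfolding assms(1) by (simp add: m_assoc)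
  finally show ?thesis using assms by simp
qed

text \<open>A unital algebra, with distributivity and compatibility with scalars both expressed by
  bilinearity. The notion is stable under \<open>tensor\<close>, so it passes to the iterated tensor
  powers of H.\<close>

definition bilinear_monoid where
  "bilinear_monoid R A \<longleftrightarrow> module R A \<and> monoid A \<and> mult A \<in> bilinear_maps R A A A"

lemma bilinear_monoidD:
  assumes "bilinear_monoid R A"
  shows "module R A" "monoid A" "mult A \<in> bilinear_maps R A A A"
  using assms by (simp_all add: bilinear_monoid_def)

lemma tensor_bilinear_monoid:
  assumes "bilinear_monoid R A" "bilinear_monoid R B"
  shows "bilinear_monoid R (tensor R A B)"
proof -
  interpret A: monoid A using assms by (simp add: bilinear_monoid_def)
  interpret B: monoid B using assms by (simp add: bilinear_monoid_def)
  note [simp] = bilinear_monoidD(1)[OF assms(1)] bilinear_monoidD(1)[OF assms(2)]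
  note mA = bilinear_monoidD(3)[OF assms(1)] note mB = bilinear_monoidD(3)[OF assms(2)]
  let ?T = "tensor R A B"
  have M: "mult ?T \<in> bilinear_maps R ?T ?T ?T"
    unfolding tensor_simps(5) by (intro tensor_op_bilinear mA mB) simp_all
  note cl [simp] = bilinear_mapsD(3)[OF M]
  have pure: "pure_tensor R A B a b \<otimes>\<^bsub>?T\<^esub> pure_tensor R A B a' b' = pure_tensor R A B (a \<otimes>\<^bsub>A\<^esub> a') (b \<otimes>\<^bsub>B\<^esub> b')"
    if "a \<in> carrier A" "a' \<in> carrier A" "b \<in> carrier B" "b' \<in> carrier B" for a a' b b'
    unfolding tensor_simps(5) using that by (intro tensor_op_pure mA mB) simp_all
  note add = linear_maps_add[OF bilinear_mapsD(1)[OF M]] linear_maps_add[OF bilinear_mapsD(2)[OF M]]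
  interpret T: module R ?T by simp
  have assoc: "x \<otimes>\<^bsub>?T\<^esub> y \<otimes>\<^bsub>?T\<^esub> z = x \<otimes>\<^bsub>?T\<^esub> (y \<otimes>\<^bsub>?T\<^esub> z)"
    if x: "x \<in> carrier ?T" and y: "y \<in> carrier ?T" and z: "z \<in> carrier ?T" for x y z
  proof -
    \<comment> \<open>Associativity is proved by three nested tensor inductions, the outermost on z
      and the innermost on x.\<close>
    have 1: "x \<otimes>\<^bsub>?T\<^esub> y \<otimes>\<^bsub>?T\<^esub> pure_tensor R A B a b = x \<otimes>\<^bsub>?T\<^esub> (y \<otimes>\<^bsub>?T\<^esub> pure_tensor R A B a b)"
      if ab: "a \<in> carrier A" "b \<in> carrier B" for a b
    proof -
      have 2: "x \<otimes>\<^bsub>?T\<^esub> pure_tensor R A B c d \<otimes>\<^bsub>?T\<^esub> pure_tensor R A B a b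
          = x \<otimes>\<^bsub>?T\<^esub> (pure_tensor R A B c d \<otimes>\<^bsub>?T\<^esub> pure_tensor R A B a b)"
        if cd: "c \<in> carrier A" "d \<in> carrier B" for c d
        using bilinear_monoidD(1)[OF assms(1)] bilinear_monoidD(1)[OF assms(2)] x
        by (induction rule: tensor_induct) (use ab cd in \<open>simp_all add: pure A.m_assoc B.m_assoc add\<close>)
      show ?thesis
        using bilinear_monoidD(1)[OF assms(1)] bilinear_monoidD(1)[OF assms(2)] y
        by (induction rule: tensor_induct) (use ab x in \<open>simp_all add: 2 add\<close>)
    qed
    show ?thesis
      using bilinear_monoidD(1)[OF assms(1)] bilinear_monoidD(1)[OF assms(2)] z
      by (induction rule: tensor_induct) (use x y in \<open>simp_all add: 1 add\<close>)
  qed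
  have one: "\<one>\<^bsub>?T\<^esub> = pure_tensor R A B \<one>\<^bsub>A\<^esub> \<one>\<^bsub>B\<^esub>" by (rule tensor_simps(6))
  have one_closed: "\<one>\<^bsub>?T\<^esub> \<in> carrier ?T" unfolding one by simp
  have l_one: "\<one>\<^bsub>?T\<^esub> \<otimes>\<^bsub>?T\<^esub> x = x" if "x \<in> carrier ?T" for x
    using bilinear_monoidD(1)[OF assms(1)] bilinear_monoidD(1)[OF assms(2)] that
    by (induction rule: tensor_induct) (simp_all add: one pure add)
  have r_one: "x \<otimes>\<^bsub>?T\<^esub> \<one>\<^bsub>?T\<^esub> = x" if "x \<in> carrier ?T" for x
    using bilinear_monoidD(1)[OF assms(1)] bilinear_monoidD(1)[OF assms(2)] that
    by (induction rule: tensor_induct) (simp_all add: one pure add)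
  have "monoid ?T" by (rule monoidI) (simp_all add: assoc one_closed l_one r_one)
  then show ?thesis using M by (simp add: bilinear_monoid_def)
qed


section \<open>Identities in quasi-bialgebras\<close>

context quasi_bialgebra
begin

abbreviation hmult (infixl "\<bullet>" 70) where "hmult \<equiv> mult H"
abbreviation hone ("\<one>\<^sub>H") where "hone \<equiv> one H"
abbreviation "\<epsilon> \<equiv> counit H"
abbreviation "HH \<equiv> tensor R H H"
abbreviation "HHH \<equiv> tensor3 R H H H"
abbreviation "\<phi> \<equiv> reassoc H"
abbreviation "\<Delta>_sum U f a \<equiv> tensor_lift R H H U f (comult H a)"
abbreviation "\<phi>_sum U f \<equiv> tensor_lift3 R H H H U f (reassoc H)"
abbreviation "\<phi>inv_sum U f \<equiv> tensor_lift3 R H H H U f (inv\<^bsub>tensor3 R H H H\<^esub> (reassoc H))"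

lemma module_H [simp]: "module R H"
  by unfold_locales

lemma monoid_H: "monoid H"
  by unfold_locales

lemmas hassoc = monoid.m_assoc[OF monoid_H]
lemmas hmult_one [simp] = monoid.r_one[OF monoid_H]

lemma hmult_bilinear [simp]: "hmult \<in> bilinear_maps R H H H"
  unfolding bilinear_maps_iff
  by (intro conjI ballI linear_mapsI)
    (simp_all add: smult_mult_left smult_mult_right ring.ring_simprules[OF ring_axioms])

lemmas hmult_linear [simp] = bilinear_maps_compose_linear[OF hmult_bilinear]

lemma bilinear_monoid_H: "bilinear_monoid R H"
  by (simp add: bilinear_monoid_def monoid_H)

lemma bilinear_monoid_HH: "bilinear_monoid R HH"
  and bilinear_monoid_HHH: "bilinear_monoid R HHH"
  by (intro tensor_bilinear_monoid bilinear_monoid_H)+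

lemmas monoid_HHH = bilinear_monoidD(2)[OF bilinear_monoid_HHH]

lemma comult_linear_map [simp]: "comult H \<in> linear_maps R H HH"
  by (rule comult_linear)

lemma comult_closed [simp]: "a \<in> carrier H \<Longrightarrow> comult H a \<in> carrier HH"
  using linear_maps_closed[OF comult_linear] .

lemma reassoc_closed [simp]: "\<phi> \<in> carrier HHH"
  using reassoc_unit by (simp add: Units_def)

lemma inv_reassoc_closed [simp]: "inv\<^bsub>HHH\<^esub> \<phi> \<in> carrier HHH"
  by (rule monoid.Units_inv_closed[OF monoid_HHH reassoc_unit])

lemma eps_closed [simp]: "a \<in> carrier H \<Longrightarrow> \<epsilon> a \<in> carrier R"
  using counit_hom by (rule ring_hom_closed)

lemma eps_mult [simp]: "a \<in> carrier H \<Longrightarrow> b \<in> carrier H \<Longrightarrow> \<epsilon> (a \<bullet> b) = \<epsilon> a \<otimes>\<^bsub>R\<^esub> \<epsilon> b"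
  using counit_hom by (rule ring_hom_mult)

lemma eps_one [simp]: "\<epsilon> \<one>\<^sub>H = \<one>\<^bsub>R\<^esub>"
  using counit_hom by (rule ring_hom_one)

text \<open>The counit takes values in R, which is a ring and not a module record. Its linearity is
  therefore expressed through the multiples \<epsilon>(x) u, the form in which the counit identities
  below are stated.\<close>

lemma eps_smult_linear [simp]:
  assumes "module R U" "f \<in> linear_maps R X H" "u \<in> carrier U"
  shows "(\<lambda>x. \<epsilon> (f x) \<odot>\<^bsub>U\<^esub> u) \<in> linear_maps R X U"
proof -
  interpret U: module R U by fact
  show ?thesis
    by (rule linear_mapsI)
      (simp_all add: linear_maps_closed[OF assms(2)] linear_maps_add[OF assms(2)] linear_maps_smult[OF assms(2)]
        assms(3) ring_hom_add[OF counit_hom] counit_smult U.smult_l_distr U.smult_assoc1)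
qed

section \<open>The axioms as identities between Sweedler sums\<close>

lemma tensor_lift3_mult:
  assumes "module R U" "f \<in> trilinear_maps R H H H U" "s \<in> carrier HHH" "t \<in> carrier HHH"
  shows "tensor_lift3 R H H H U f (s \<otimes>\<^bsub>HHH\<^esub> t)
    = tensor_lift3 R H H H U (\<lambda>a b c. tensor_lift3 R H H H U (\<lambda>x y z. f (a \<bullet> x) (b \<bullet> y) (c \<bullet> z)) t) s"
  unfolding tensor_simps(5) using assms by (intro tensor_lift3_tensor_op) simp_all

lemma comult_mult_sum:
  assumes "module R U" "f \<in> bilinear_maps R H H U" "a \<in> carrier H" "b \<in> carrier H"
  shows "\<Delta>_sum U f (a \<bullet> b) = \<Delta>_sum U (\<lambda>x y. \<Delta>_sum U (\<lambda>u v. f (x \<bullet> u) (y \<bullet> v)) b) a"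
  unfolding ring_hom_mult[OF comult_hom assms(3,4)] tensor_simps(5)
  using assms by (intro tensor_lift_tensor_op) simp_all

lemma comult_one: "comult H \<one>\<^sub>H = pure_tensor R H H \<one>\<^sub>H \<one>\<^sub>H"
  using ring_hom_one[OF comult_hom] by (simp add: tensor_simps(6))

text \<open>Both products of \<phi> with its inverse are the unit, seen through f. Choosing f with
  further factors built in allows a cancellation inside a longer expression.\<close>

lemma reassoc_inverse_sum:
  assumes U: "module R U" and f: "f \<in> trilinear_maps R H H H U"
  shows "\<phi>_sum U (\<lambda>a b c. \<phi>inv_sum U (\<lambda>x y z. f (a \<bullet> x) (b \<bullet> y) (c \<bullet> z))) = f \<one>\<^sub>H \<one>\<^sub>H \<one>\<^sub>H"
    and "\<phi>inv_sum U (\<lambda>a b c. \<phi>_sum U (\<lambda>x y z. f (a \<bullet> x) (b \<bullet> y) (c \<bullet> z))) = f \<one>\<^sub>H \<one>\<^sub>H \<one>\<^sub>H"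
proof -
  have one: "\<one>\<^bsub>HHH\<^esub> = pure_tensor R HH H (pure_tensor R H H \<one>\<^sub>H \<one>\<^sub>H) \<one>\<^sub>H"
    by (simp add: tensor_simps(6))
  have f1: "tensor_lift3 R H H H U f \<one>\<^bsub>HHH\<^esub> = f \<one>\<^sub>H \<one>\<^sub>H \<one>\<^sub>H"
    unfolding one using U f trilinear_mapsD[OF f] by (simp add: bilinear_maps_iff)
  show "\<phi>_sum U (\<lambda>a b c. \<phi>inv_sum U (\<lambda>x y z. f (a \<bullet> x) (b \<bullet> y) (c \<bullet> z))) = f \<one>\<^sub>H \<one>\<^sub>H \<one>\<^sub>H"
    using tensor_lift3_mult[OF U f reassoc_closed inv_reassoc_closed]
    by (simp only: monoid.Units_r_inv[OF monoid_HHH reassoc_unit] f1)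
  show "\<phi>inv_sum U (\<lambda>a b c. \<phi>_sum U (\<lambda>x y z. f (a \<bullet> x) (b \<bullet> y) (c \<bullet> z))) = f \<one>\<^sub>H \<one>\<^sub>H \<one>\<^sub>H"
    using tensor_lift3_mult[OF U f inv_reassoc_closed reassoc_closed]
    by (simp only: monoid.Units_l_inv[OF monoid_HHH reassoc_unit] f1)
qed

text \<open>The lift of f is applied to both sides of the axiom. Reassociation becomes invisible, as
  f receives only the components.\<close>

lemma quasi_coassoc_sum:
  assumes U [simp]: "module R U" and f: "f \<in> trilinear_maps R H H H U" and a [simp]: "a \<in> carrier H"
  shows "\<Delta>_sum U (\<lambda>x y. \<Delta>_sum U (\<lambda>u v. \<phi>_sum U (\<lambda>X Y Z. f (x \<bullet> X) (u \<bullet> Y) (v \<bullet> Z))) y) a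
    = \<phi>_sum U (\<lambda>X Y Z. \<Delta>_sum U (\<lambda>x y. \<Delta>_sum U (\<lambda>u v. f (X \<bullet> u) (Y \<bullet> v) (Z \<bullet> y)) x) a)"
proof -
  note [simp] = f trilinear_mapsD[OF f] trilinear_compose[OF f]
  have 1: "tensor_map R H H H HH id (comult H) (comult H a) \<in> carrier (tensor R H HH)"
    by (simp add: linear_maps_closed[OF tensor_map_linear])
  have 2: "tensor_assoc R H H H (tensor_map R H H H HH id (comult H) (comult H a)) \<in> carrier HHH"
    by (simp add: linear_maps_closed[OF tensor_assoc_linear] 1)
  have 3: "tensor_map R H H HH H (comult H) id (comult H a) \<in> carrier HHH"
    by (simp add: linear_maps_closed[OF tensor_map_linear])
  show ?thesis
    using arg_cong[OF quasi_coassoc[OF a], of "tensor_lift3 R H H H U f"]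
    by (simp add: tensor_lift3_mult 1 2 3 tensor_lift3_tensor_assoc tensor_lift3_tensor_map tensor_lift_tensor_map
      trilinear_maps_iff bilinear_maps_iff)
qed


lemma counit_left_sum:
  assumes U [simp]: "module R U" and g: "g \<in> linear_maps R H U" and a [simp]: "a \<in> carrier H"
  shows "\<Delta>_sum U (\<lambda>x y. \<epsilon> x \<odot>\<^bsub>U\<^esub> g y) a = g a"
proof -
  have "g (\<Delta>_sum H (\<lambda>x y. \<epsilon> x \<odot>\<^bsub>H\<^esub> y) a) = \<Delta>_sum U (\<lambda>x y. g (\<epsilon> x \<odot>\<^bsub>H\<^esub> y)) a"
    by (rule linear_tensor_lift) (simp_all add: bilinear_maps_iff g)
  then show ?thesis by (simp add: counit_left linear_maps_smult[OF g])
qed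

lemma counit_right_sum:
  assumes U [simp]: "module R U" and g: "g \<in> linear_maps R H U" and a [simp]: "a \<in> carrier H"
  shows "\<Delta>_sum U (\<lambda>x y. \<epsilon> y \<odot>\<^bsub>U\<^esub> g x) a = g a"
proof -
  have "g (\<Delta>_sum H (\<lambda>x y. \<epsilon> y \<odot>\<^bsub>H\<^esub> x) a) = \<Delta>_sum U (\<lambda>x y. g (\<epsilon> y \<odot>\<^bsub>H\<^esub> x)) a"
    by (rule linear_tensor_lift) (simp_all add: bilinear_maps_iff g)
  then show ?thesis by (simp add: counit_right linear_maps_smult[OF g])
qed

lemma counit_reassoc_sum:
  assumes U [simp]: "module R U" and f: "f \<in> bilinear_maps R H H U"
  shows "\<phi>_sum U (\<lambda>X Y Z. \<epsilon> Y \<odot>\<^bsub>U\<^esub> f X Z) = f \<one>\<^sub>H \<one>\<^sub>H"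
proof -
  note [simp] = f bilinear_mapsD[OF f] bilinear_maps_compose_linear[OF f]
  have "tensor_lift R H H U f (tensor_map R HH H H H (tensor_lift R H H H (\<lambda>x y. \<epsilon> y \<odot>\<^bsub>H\<^esub> x)) id \<phi>)
      = tensor_lift R HH H U (\<lambda>s Z. f (tensor_lift R H H H (\<lambda>x y. \<epsilon> y \<odot>\<^bsub>H\<^esub> x) s) Z) \<phi>"
    by (simp add: tensor_lift_tensor_map bilinear_maps_iff)
  also have "\<dots> = tensor_lift R HH H U (\<lambda>s Z. tensor_lift R H H U (\<lambda>x y. f (\<epsilon> y \<odot>\<^bsub>H\<^esub> x) Z) s) \<phi>"
    by (intro tensor_lift_cong refl linear_tensor_lift[of R H H H U "\<lambda>x. f x Z" for Z])
      (simp_all add: bilinear_maps_iff)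
  also have "\<dots> = \<phi>_sum U (\<lambda>X Y Z. \<epsilon> Y \<odot>\<^bsub>U\<^esub> f X Z)"
    unfolding tensor_lift3_def by (intro tensor_lift_cong refl) (simp add: linear_maps_smult[OF bilinear_mapsD(2)[OF f]])
  finally show ?thesis by (simp add: counit_reassoc)
qed

section \<open>Fourfold tensors and the pentagon\<close>

definition quadrilinear where
  "quadrilinear U k \<longleftrightarrow>
    (\<forall>b\<in>carrier H. \<forall>c\<in>carrier H. \<forall>d\<in>carrier H. (\<lambda>a. k a b c d) \<in> linear_maps R H U)
    \<and> (\<forall>a\<in>carrier H. \<forall>c\<in>carrier H. \<forall>d\<in>carrier H. (\<lambda>b. k a b c d) \<in> linear_maps R H U)
    \<and> (\<forall>a\<in>carrier H. \<forall>b\<in>carrier H. \<forall>d\<in>carrier H. (\<lambda>c. k a b c d) \<in> linear_maps R H U)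
    \<and> (\<forall>a\<in>carrier H. \<forall>b\<in>carrier H. \<forall>c\<in>carrier H. (\<lambda>d. k a b c d) \<in> linear_maps R H U)"

lemma quadrilinearD:
  assumes "quadrilinear U k"
  shows "\<lbrakk>b \<in> carrier H; c \<in> carrier H; d \<in> carrier H\<rbrakk> \<Longrightarrow> (\<lambda>a. k a b c d) \<in> linear_maps R H U"
    and "\<lbrakk>a \<in> carrier H; c \<in> carrier H; d \<in> carrier H\<rbrakk> \<Longrightarrow> (\<lambda>b. k a b c d) \<in> linear_maps R H U"
    and "\<lbrakk>a \<in> carrier H; b \<in> carrier H; d \<in> carrier H\<rbrakk> \<Longrightarrow> (\<lambda>c. k a b c d) \<in> linear_maps R H U"
    and "\<lbrakk>a \<in> carrier H; b \<in> carrier H; c \<in> carrier H\<rbrakk> \<Longrightarrow> (\<lambda>d. k a b c d) \<in> linear_maps R H U"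
  using assms by (simp_all add: quadrilinear_def)

lemma quadrilinear_compose:
  assumes "quadrilinear U k"
  shows "\<lbrakk>g \<in> linear_maps R X H; b \<in> carrier H; c \<in> carrier H; d \<in> carrier H\<rbrakk> \<Longrightarrow> (\<lambda>a. k (g a) b c d) \<in> linear_maps R X U"
    and "\<lbrakk>g \<in> linear_maps R X H; a \<in> carrier H; c \<in> carrier H; d \<in> carrier H\<rbrakk> \<Longrightarrow> (\<lambda>b. k a (g b) c d) \<in> linear_maps R X U"
    and "\<lbrakk>g \<in> linear_maps R X H; a \<in> carrier H; b \<in> carrier H; d \<in> carrier H\<rbrakk> \<Longrightarrow> (\<lambda>c. k a b (g c) d) \<in> linear_maps R X U"
    and "\<lbrakk>g \<in> linear_maps R X H; a \<in> carrier H; b \<in> carrier H; c \<in> carrier H\<rbrakk> \<Longrightarrow> (\<lambda>d. k a b c (g d)) \<in> linear_maps R X U"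
  subgoal by (rule linear_maps_compose[OF _ quadrilinearD(1)[OF assms]])
  subgoal by (rule linear_maps_compose[OF _ quadrilinearD(2)[OF assms]])
  subgoal by (rule linear_maps_compose[OF _ quadrilinearD(3)[OF assms]])
  subgoal by (rule linear_maps_compose[OF _ quadrilinearD(4)[OF assms]])
  done

abbreviation "HHHH \<equiv> tensor R HHH H"
abbreviation "lift4 U k t \<equiv> tensor_lift R HHH H U (\<lambda>r d. tensor_lift3 R H H H U (\<lambda>a b c. k a b c d) r) t"

lemma lift4_mult:
  assumes U [simp]: "module R U" and k: "quadrilinear U k"
    and s [simp]: "s \<in> carrier HHHH" and t [simp]: "t \<in> carrier HHHH"
  shows "lift4 U k (s \<otimes>\<^bsub>HHHH\<^esub> t)
    = lift4 U (\<lambda>a b c d. lift4 U (\<lambda>a' b' c' d'. k (a \<bullet> a') (b \<bullet> b') (c \<bullet> c') (d \<bullet> d')) t) s"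
proof -
  note [simp] = quadrilinearD[OF k] quadrilinear_compose[OF k]
  note B = bilinear_monoidD(3)[OF bilinear_monoid_HHH]
  have "lift4 U k (s \<otimes>\<^bsub>HHHH\<^esub> t)
    = tensor_lift R HHH H U (\<lambda>r d. tensor_lift R HHH H U (\<lambda>r' d'.
        tensor_lift3 R H H H U (\<lambda>a b c. k a b c (d \<bullet> d')) (r \<otimes>\<^bsub>HHH\<^esub> r')) t) s"
    unfolding tensor_simps(5)[of R HHH H]
    by (rule tensor_lift_tensor_op[OF _ _ _ _ _ _ B hmult_bilinear])
      (simp_all add: bilinear_maps_iff trilinear_maps_iff)
  also have "\<dots> = tensor_lift R HHH H U (\<lambda>r d. tensor_lift R HHH H U (\<lambda>r' d'.
        tensor_lift3 R H H H U (\<lambda>a b c. tensor_lift3 R H H H U (\<lambda>a' b' c'.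
          k (a \<bullet> a') (b \<bullet> b') (c \<bullet> c') (d \<bullet> d')) r') r) t) s"
    by (intro tensor_lift_cong refl tensor_lift3_mult) (simp_all add: trilinear_maps_iff)
  also have "\<dots> = lift4 U (\<lambda>a b c d. lift4 U (\<lambda>a' b' c' d'. k (a \<bullet> a') (b \<bullet> b') (c \<bullet> c') (d \<bullet> d')) t) s"
    by (intro tensor_lift_cong refl tensor_lift3_swap[symmetric]) (simp_all add: bilinear_maps_iff trilinear_maps_iff)
  finally show ?thesis .
qed

lemma HHHH_mult_closed [simp]:
  "s \<in> carrier HHHH \<Longrightarrow> t \<in> carrier HHHH \<Longrightarrow> s \<otimes>\<^bsub>HHHH\<^esub> t \<in> carrier HHHH"
  using monoid.m_closed[OF bilinear_monoidD(2)[OF tensor_bilinear_monoid[OF bilinear_monoid_HHH bilinear_monoid_H]]]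
  by blast

lemma tensor_map_comult_closed [simp]:
  "s \<in> carrier HH \<Longrightarrow> tensor_map R H H H HH id (comult H) s \<in> carrier (tensor R H HH)"
  "t \<in> carrier HHH \<Longrightarrow> tensor_map R HH H HH HH id (comult H) t \<in> carrier (tensor R HH HH)"
  by (simp_all add: linear_maps_closed[OF tensor_map_linear])

lemma tensor_map_comult_linear [simp]:
  "tensor_map R H H HH H (comult H) id \<in> linear_maps R HH HHH"
  "tensor_assoc R H H H \<circ> tensor_map R H H H HH id (comult H) \<in> linear_maps R HH HHH"
  unfolding comp_def
  by (simp_all add: tensor_map_linear linear_maps_compose[OF tensor_map_linear tensor_assoc_linear])

text \<open>The factors of the pentagon in exactly the bracketing of the axiom, but as functions of
  t, so that \<phi>^-1 can be inserted too. They stand for (id \<otimes> id \<otimes> \<Delta>)(t),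
  (\<Delta> \<otimes> id \<otimes> id)(t), (id \<otimes> \<Delta> \<otimes> id)(t) and 1 \<otimes>
  t.\<close>

abbreviation "comult_4 t \<equiv> tensor_assoc R HH H H (tensor_map R HH H HH HH id (comult H) t)"
abbreviation "comult_12 t \<equiv> tensor_map R HH H HHH H (tensor_map R H H HH H (comult H) id) id t"
abbreviation "comult_23 t \<equiv> tensor_map R HH H HHH H (tensor_assoc R H H H \<circ> tensor_map R H H H HH id (comult H)) id t"
abbreviation "one_left t \<equiv> tensor_map R (tensor R H HH) H HHH H (tensor_assoc R H H H) id
  (tensor_assoc R H HH H (pure_tensor R H HHH \<one>\<^sub>H t))"

lemma tensor4_closed [simp]:
  assumes "t \<in> carrier HHH"
  shows "comult_4 t \<in> carrier HHHH" "comult_12 t \<in> carrier HHHH" "comult_23 t \<in> carrier HHHH"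
    "one_left t \<in> carrier HHHH" "pure_tensor R HHH H t \<one>\<^sub>H \<in> carrier HHHH"
  using assms by (simp_all add: linear_maps_closed[OF tensor_assoc_linear] linear_maps_closed[OF tensor_map_linear]
      tensor_assoc_linear)

context
  fixes U :: "('k, 'u, 'c) module_scheme" and h
  assumes U [simp]: "module R U" and h: "quadrilinear U h"
begin

lemmas [simp] = quadrilinearD[OF h] quadrilinear_compose[OF h]

lemma lift4_comult_4:
  assumes [simp]: "t \<in> carrier HHH"
  shows "lift4 U h (comult_4 t) = tensor_lift3 R H H H U (\<lambda>X Y Z. \<Delta>_sum U (\<lambda>Z1 Z2. h X Y Z1 Z2) Z) t"
proof -
  have "lift4 U h (comult_4 t) = tensor_lift R HH H U (\<lambda>s Z. \<Delta>_sum U (\<lambda>Z1 Z2.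
      tensor_lift R H H U (\<lambda>X Y. h X Y Z1 Z2) s) Z) t"
    by (simp add: tensor_lift_tensor_assoc tensor_lift_tensor_map bilinear_maps_iff trilinear_maps_iff)
  also have "\<dots> = tensor_lift R HH H U (\<lambda>s Z. tensor_lift R H H U (\<lambda>X Y.
      \<Delta>_sum U (\<lambda>Z1 Z2. h X Y Z1 Z2) Z) s) t"
    by (intro tensor_lift_cong refl tensor_lift_swap) simp_all
  finally show ?thesis by (simp only: tensor_lift3_def)
qed

lemma lift4_comult_12:
  assumes [simp]: "t \<in> carrier HHH"
  shows "lift4 U h (comult_12 t) = tensor_lift3 R H H H U (\<lambda>X Y Z. \<Delta>_sum U (\<lambda>X1 X2. h X1 X2 Y Z) X) t"
proof -
  have "lift4 U h (comult_12 t) = tensor_lift R HH H U (\<lambda>s Z. tensor_lift R H H U (\<lambda>X Y.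
      \<Delta>_sum U (\<lambda>X1 X2. h X1 X2 Y Z) X) s) t"
    by (simp add: tensor_lift3_tensor_map tensor_lift_tensor_map bilinear_maps_iff trilinear_maps_iff)
  then show ?thesis by (simp only: tensor_lift3_def)
qed

lemma lift4_comult_23:
  assumes [simp]: "t \<in> carrier HHH"
  shows "lift4 U h (comult_23 t) = tensor_lift3 R H H H U (\<lambda>X Y Z. \<Delta>_sum U (\<lambda>Y1 Y2. h X Y1 Y2 Z) Y) t"
proof -
  have "lift4 U h (comult_23 t) = tensor_lift R HH H U (\<lambda>s Z. tensor_lift R H H U (\<lambda>X Y.
      \<Delta>_sum U (\<lambda>Y1 Y2. h X Y1 Y2 Z) Y) s) t"
    by (simp add: tensor_lift3_tensor_assoc tensor_lift_tensor_map bilinear_maps_iff trilinear_maps_iff)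
  then show ?thesis by (simp only: tensor_lift3_def)
qed

lemma lift4_one_left:
  assumes [simp]: "t \<in> carrier HHH"
  shows "lift4 U h (one_left t) = tensor_lift3 R H H H U (\<lambda>X Y Z. h \<one>\<^sub>H X Y Z) t"
proof -
  have [simp]: "tensor_assoc R H HH H (pure_tensor R H HHH \<one>\<^sub>H t) \<in> carrier (tensor R (tensor R H HH) H)"
    by (simp add: linear_maps_closed[OF tensor_assoc_linear])
  have "lift4 U h (one_left t) = tensor_lift R HH H U (\<lambda>s Z. tensor_lift R H H U (\<lambda>X Y. h \<one>\<^sub>H X Y Z) s) t"
    by (simp add: tensor_lift3_tensor_assoc tensor_lift_tensor_assoc tensor_lift_tensor_map
        bilinear_maps_iff trilinear_maps_iff tensor_assoc_linear)
  then show ?thesis by (simp only: tensor_lift3_def)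
qed

lemma lift4_one_right:
  assumes [simp]: "t \<in> carrier HHH"
  shows "lift4 U h (pure_tensor R HHH H t \<one>\<^sub>H) = tensor_lift3 R H H H U (\<lambda>X Y Z. h X Y Z \<one>\<^sub>H) t"
  by (simp add: bilinear_maps_iff trilinear_maps_iff)

end

lemmas lift4_simps = lift4_comult_4 lift4_comult_12 lift4_comult_23 lift4_one_left lift4_one_right

text \<open>The pentagon evaluated under k. On the left the unprimed copy of \<phi> comes from (id
  \<otimes> id \<otimes> \<Delta>)(\<phi>) and the primed one from (\<Delta> \<otimes> id \<otimes>
  id)(\<phi>). On the right the unprimed, primed and doubly primed copies come from 1 \<otimes>
  \<phi>, (id \<otimes> \<Delta> \<otimes> id)(\<phi>) and \<phi> \<otimes> 1.\<close>

lemma pentagon_sum: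
  assumes U [simp]: "module R U" and k: "quadrilinear U k"
  shows "\<phi>_sum U (\<lambda>X Y Z. \<Delta>_sum U (\<lambda>Z1 Z2. \<phi>_sum U (\<lambda>X' Y' Z'. \<Delta>_sum U (\<lambda>X1 X2.
            k (X \<bullet> X1) (Y \<bullet> X2) (Z1 \<bullet> Y') (Z2 \<bullet> Z')) X')) Z)
    = \<phi>_sum U (\<lambda>X Y Z. \<phi>_sum U (\<lambda>X' Y' Z'. \<Delta>_sum U (\<lambda>Y1 Y2. \<phi>_sum U (\<lambda>X'' Y'' Z''.
            k (X' \<bullet> X'') (X \<bullet> Y1 \<bullet> Y'') (Y \<bullet> Y2 \<bullet> Z'') (Z \<bullet> Z'))) Y'))"
proof -
  note [simp] = quadrilinearD[OF k] quadrilinear_compose[OF k]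
  show ?thesis
    using arg_cong[OF pentagon, of "lift4 U k"]
    by (simp add: lift4_mult k lift4_simps quadrilinear_def bilinear_maps_iff trilinear_maps_iff)
qed

text \<open>Testing against the universal quadrilinear map loses nothing. This leads back from sums
  to an equation in the algebra \<open>HHHH\<close>, where factors can be cancelled.\<close>

lemma lift4_pure:
  assumes "t \<in> carrier HHHH"
  shows "lift4 HHHH (\<lambda>a b c d. pure_tensor R HHH H (pure_tensor R HH H (pure_tensor R H H a b) c) d) t = t"
proof -
  let ?k = "\<lambda>a b c d. pure_tensor R HHH H (pure_tensor R HH H (pure_tensor R H H a b) c) d"
  have 1: "tensor_lift R H H HHHH (\<lambda>a b. ?k a b c d) s = pure_tensor R HHH H (pure_tensor R HH H s c) d"
    if "s \<in> carrier HH" "c \<in> carrier H" "d \<in> carrier H" for s c d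
    by (rule tensor_linear_maps_eqI[where U = HHHH, OF _ _ _ _ _ _ that(1)]) (simp_all add: bilinear_maps_iff that)
  have 2: "tensor_lift3 R H H H HHHH (\<lambda>a b c. ?k a b c d) r = pure_tensor R HHH H r d"
    if "r \<in> carrier HHH" "d \<in> carrier H" for r d
    by (rule tensor_linear_maps_eqI[where U = HHHH, OF _ _ _ _ _ _ that(1)]) (simp_all add: trilinear_maps_iff that 1)
  show ?thesis
    by (rule tensor_linear_maps_eqI[where U = HHHH, OF _ _ _ _ _ _ assms(1)])
      (simp_all add: bilinear_maps_iff trilinear_maps_iff 2)
qed

text \<open>The map id \<otimes> id \<otimes> \<Delta> is multiplicative and unital, so it preserves
  \<phi>^-1 \<phi> = 1. Multiplicativity enters through \<open>comult_mult_sum\<close> after the sum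
  over \<phi> has been moved outside the coproduct of the last leg of \<phi>^-1.\<close>

lemma comult_4_inv: "comult_4 (inv\<^bsub>HHH\<^esub> \<phi>) \<otimes>\<^bsub>HHHH\<^esub> comult_4 \<phi> = \<one>\<^bsub>HHHH\<^esub>"
proof -
  let ?k = "\<lambda>a b c d. pure_tensor R HHH H (pure_tensor R HH H (pure_tensor R H H a b) c) d"
  have k: "quadrilinear HHHH ?k" by (simp add: quadrilinear_def)
  have "comult_4 (inv\<^bsub>HHH\<^esub> \<phi>) \<otimes>\<^bsub>HHHH\<^esub> comult_4 \<phi> = lift4 HHHH ?k (comult_4 (inv\<^bsub>HHH\<^esub> \<phi>) \<otimes>\<^bsub>HHHH\<^esub> comult_4 \<phi>)"
    by (rule lift4_pure[symmetric]) simp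
  also have "\<dots> = \<phi>inv_sum HHHH (\<lambda>x y z. \<Delta>_sum HHHH (\<lambda>z1 z2. \<phi>_sum HHHH (\<lambda>X Y Z. \<Delta>_sum HHHH (\<lambda>Z1 Z2.
      ?k (x \<bullet> X) (y \<bullet> Y) (z1 \<bullet> Z1) (z2 \<bullet> Z2)) Z)) z)"
    by (simp add: lift4_mult k lift4_simps quadrilinear_def bilinear_maps_iff trilinear_maps_iff)
  also have "\<dots> = \<phi>inv_sum HHHH (\<lambda>x y z. \<phi>_sum HHHH (\<lambda>X Y Z. \<Delta>_sum HHHH (\<lambda>z1 z2. \<Delta>_sum HHHH (\<lambda>Z1 Z2.
      ?k (x \<bullet> X) (y \<bullet> Y) (z1 \<bullet> Z1) (z2 \<bullet> Z2)) Z) z))"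
    by (intro tensor_lift3_cong refl tensor_lift3_swap[symmetric]) (simp_all add: bilinear_maps_iff trilinear_maps_iff)
  also have "\<dots> = \<phi>inv_sum HHHH (\<lambda>x y z. \<phi>_sum HHHH (\<lambda>X Y Z. \<Delta>_sum HHHH (\<lambda>z1 z2. ?k (x \<bullet> X) (y \<bullet> Y) z1 z2) (z \<bullet> Z)))"
    by (simp add: comult_mult_sum bilinear_maps_iff)
  also have "\<dots> = \<Delta>_sum HHHH (\<lambda>z1 z2. ?k \<one>\<^sub>H \<one>\<^sub>H z1 z2) \<one>\<^sub>H"
    by (rule reassoc_inverse_sum(2)) (simp_all add: bilinear_maps_iff trilinear_maps_iff)
  also have "\<dots> = \<one>\<^bsub>HHHH\<^esub>"
    by (simp add: comult_one bilinear_maps_iff tensor_simps(6))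
  finally show ?thesis .
qed

text \<open>The pentagon multiplied by (id \<otimes> id \<otimes> \<Delta>)(\<phi>^-1) on the left
  and by \<phi>^-1 \<otimes> 1 on the right.\<close>

lemma pentagon_inv:
  "comult_12 \<phi> \<otimes>\<^bsub>HHHH\<^esub> pure_tensor R HHH H (inv\<^bsub>HHH\<^esub> \<phi>) \<one>\<^sub>H
    = comult_4 (inv\<^bsub>HHH\<^esub> \<phi>) \<otimes>\<^bsub>HHHH\<^esub> (one_left \<phi> \<otimes>\<^bsub>HHHH\<^esub> comult_23 \<phi>)"
proof -
  interpret T: monoid HHHH
    by (rule bilinear_monoidD(2)[OF tensor_bilinear_monoid[OF bilinear_monoid_HHH bilinear_monoid_H]])
  let ?E = "pure_tensor R HHH H \<phi> \<one>\<^sub>H" and ?E' = "pure_tensor R HHH H (inv\<^bsub>HHH\<^esub> \<phi>) \<one>\<^sub>H"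
  have E: "?E \<otimes>\<^bsub>HHHH\<^esub> ?E' = \<one>\<^bsub>HHHH\<^esub>"
    unfolding tensor_simps(5,6)[of R HHH H]
    using tensor_op_pure[of R HHH H HHH H HHH H "mult HHH" "mult H"]
    by (simp add: bilinear_monoidD(3)[OF bilinear_monoid_HHH] monoid.Units_r_inv[OF monoid_HHH reassoc_unit])
  show ?thesis
    by (rule T.mult_inverses_eq[OF pentagon comult_4_inv E]) simp_all
qed

lemma pentagon_inv_sum:
  assumes U [simp]: "module R U" and h: "quadrilinear U h"
  shows "\<phi>_sum U (\<lambda>X Y Z. \<Delta>_sum U (\<lambda>X1 X2. \<phi>inv_sum U (\<lambda>x y z. h (X1 \<bullet> x) (X2 \<bullet> y) (Y \<bullet> z) Z)) X)
    = \<phi>inv_sum U (\<lambda>x y z. \<Delta>_sum U (\<lambda>z1 z2. \<phi>_sum U (\<lambda>X Y Z. \<phi>_sum U (\<lambda>X' Y' Z'. \<Delta>_sum U (\<lambda>Y1 Y2.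
        h (x \<bullet> X') (y \<bullet> (X \<bullet> Y1)) (z1 \<bullet> (Y \<bullet> Y2)) (z2 \<bullet> (Z \<bullet> Z'))) Y'))) z)"
proof -
  note [simp] = quadrilinearD[OF h] quadrilinear_compose[OF h]
  show ?thesis
    using arg_cong[OF pentagon_inv, of "lift4 U h"]
    by (simp add: lift4_mult h lift4_simps quadrilinear_def bilinear_maps_iff trilinear_maps_iff)
qed

section \<open>The counit on the outer legs of the reassociator\<close>

lemmas smult_sum_simps = module_smult_smult tensor_lift_smult tensor_lift3_smult

text \<open>The counit is applied to the second leg of the pentagon. It falls on the middle leg of
  one copy of \<phi> on each side and removes it, and it undoes the coproducts. What remains is
  \<phi> = (1 \<otimes> (\<epsilon> \<otimes> id \<otimes> id)(\<phi>)) \<phi>.\<close>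

lemma counit_pentagon_first:
  assumes U [simp]: "module R U" and h: "h \<in> trilinear_maps R H H H U"
  shows "\<phi>_sum U h = \<phi>_sum U (\<lambda>X Y Z. \<epsilon> X \<odot>\<^bsub>U\<^esub> \<phi>_sum U (\<lambda>X' Y' Z'. h X' (Y \<bullet> Y') (Z \<bullet> Z')))"
proof -
  note [simp] = trilinear_mapsD[OF h] trilinear_compose[OF h]
  have "quadrilinear U (\<lambda>a b c d. \<epsilon> b \<odot>\<^bsub>U\<^esub> h a c d)"
    by (simp add: quadrilinear_def)
  from pentagon_sum[OF U this] show ?thesis
    by (simp add: smult_sum_simps counit_left_sum counit_right_sum counit_reassoc_sum comult_one
      bilinear_maps_iff trilinear_maps_iff)
qed

text \<open>The mirror image, with the counit on the third leg: \<phi> = \<phi> ((id \<otimes> id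
  \<otimes> \<epsilon>)(\<phi>) \<otimes> 1).\<close>

lemma counit_pentagon_third:
  assumes U [simp]: "module R U" and h: "h \<in> trilinear_maps R H H H U"
  shows "\<phi>_sum U h = \<phi>_sum U (\<lambda>X Y Z. \<phi>_sum U (\<lambda>X' Y' Z'. \<epsilon> Z' \<odot>\<^bsub>U\<^esub> h (X \<bullet> X') (Y \<bullet> Y') Z))"
proof -
  note [simp] = trilinear_mapsD[OF h] trilinear_compose[OF h]
  have "quadrilinear U (\<lambda>a b c d. \<epsilon> c \<odot>\<^bsub>U\<^esub> h a b d)"
    by (simp add: quadrilinear_def)
  from pentagon_sum[OF U this] show ?thesis
    by (simp add: smult_sum_simps counit_left_sum counit_right_sum counit_reassoc_sum comult_one
      bilinear_maps_iff trilinear_maps_iff)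
qed


text \<open>In \<open>counit_pentagon_first\<close> the right factor \<phi> is cancelled. To do this
  the test map \<open>?h\<close> multiplies by \<phi>^-1 from the right before it applies \<epsilon>
  to the first leg and f to the other two.\<close>

lemma counit_reassoc_first_sum:
  assumes U [simp]: "module R U" and f: "f \<in> bilinear_maps R H H U"
  shows "\<phi>_sum U (\<lambda>X Y Z. \<epsilon> X \<odot>\<^bsub>U\<^esub> f Y Z) = f \<one>\<^sub>H \<one>\<^sub>H"
proof -
  note [simp] = f bilinear_mapsD[OF f] bilinear_maps_compose_linear[OF f]
  note [simp del] = eps_mult
  let ?h = "\<lambda>a b c. \<phi>inv_sum U (\<lambda>x y z. \<epsilon> (a \<bullet> x) \<odot>\<^bsub>U\<^esub> f (b \<bullet> y) (c \<bullet> z))"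
  have 1: "\<phi>_sum U (\<lambda>a b c. ?h a (u \<bullet> b) (v \<bullet> c)) = f u v" if [simp]: "u \<in> carrier H" "v \<in> carrier H" for u v
    using reassoc_inverse_sum(1)[of U "\<lambda>a b c. \<epsilon> a \<odot>\<^bsub>U\<^esub> f (u \<bullet> b) (v \<bullet> c)"]
    by (simp add: trilinear_maps_iff hassoc)
  have "\<phi>_sum U (\<lambda>X Y Z. \<epsilon> X \<odot>\<^bsub>U\<^esub> f Y Z) = \<phi>_sum U (\<lambda>X Y Z. \<epsilon> X \<odot>\<^bsub>U\<^esub> \<phi>_sum U (\<lambda>X' Y' Z'. ?h X' (Y \<bullet> Y') (Z \<bullet> Z')))"
    by (intro tensor_lift3_cong refl) (simp only: 1)
  also have "\<dots> = \<phi>_sum U ?h"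
    by (rule counit_pentagon_first[symmetric]) (simp_all add: trilinear_maps_iff)
  also have "\<dots> = \<phi>_sum U (\<lambda>a b c. ?h a (\<one>\<^sub>H \<bullet> b) (\<one>\<^sub>H \<bullet> c))"
    by (intro tensor_lift3_cong refl) simp
  also have "\<dots> = f \<one>\<^sub>H \<one>\<^sub>H" by (rule 1) simp_all
  finally show ?thesis .
qed

text \<open>Now \<phi> is cancelled from the left. The sum over \<phi>^-1 sits inside the test map
  \<open>?h\<close>, but the cancellation needs it outermost; hence the exchanges of two threefold
  sums.\<close>

lemma counit_reassoc_third_sum:
  assumes U [simp]: "module R U" and f: "f \<in> bilinear_maps R H H U"
  shows "\<phi>_sum U (\<lambda>X Y Z. \<epsilon> Z \<odot>\<^bsub>U\<^esub> f X Y) = f \<one>\<^sub>H \<one>\<^sub>H"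
proof -
  note [simp] = f bilinear_mapsD[OF f] bilinear_maps_compose_linear[OF f]
  let ?h = "\<lambda>a b c. \<phi>inv_sum U (\<lambda>x y z. \<epsilon> (z \<bullet> c) \<odot>\<^bsub>U\<^esub> f (x \<bullet> a) (y \<bullet> b))"
  have eps: "\<epsilon> (z \<bullet> c) \<odot>\<^bsub>U\<^esub> (\<epsilon> c' \<odot>\<^bsub>U\<^esub> u) = \<epsilon> c' \<odot>\<^bsub>U\<^esub> (\<epsilon> (z \<bullet> c) \<odot>\<^bsub>U\<^esub> u)"
    if "z \<in> carrier H" "c \<in> carrier H" "c' \<in> carrier H" "u \<in> carrier U" for z c c' u
  proof -
    show ?thesis using that by (intro smult_left_commute[where R = R]) simp_all
  qed
  note [simp del] = eps_mult
  have inv: "\<phi>inv_sum U (\<lambda>x y z. \<phi>_sum U (\<lambda>X Y Z. \<epsilon> (z \<bullet> Z) \<odot>\<^bsub>U\<^esub> f (x \<bullet> (X \<bullet> a)) (y \<bullet> (Y \<bullet> b)))) = f a b"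
    if [simp]: "a \<in> carrier H" "b \<in> carrier H" for a b
    using reassoc_inverse_sum(2)[of U "\<lambda>x y z. \<epsilon> z \<odot>\<^bsub>U\<^esub> f (x \<bullet> a) (y \<bullet> b)"]
    by (simp add: trilinear_maps_iff hassoc)
  have "f \<one>\<^sub>H \<one>\<^sub>H = \<phi>inv_sum U (\<lambda>x y z. \<phi>_sum U (\<lambda>X Y Z. \<epsilon> (z \<bullet> Z) \<odot>\<^bsub>U\<^esub> f (x \<bullet> (X \<bullet> \<one>\<^sub>H)) (y \<bullet> (Y \<bullet> \<one>\<^sub>H))))"
    by (rule inv[symmetric]) simp_all
  also have "\<dots> = \<phi>_sum U ?h"
    by (subst tensor_lift33_swap) (simp_all add: trilinear_maps_iff)
  also have "\<dots> = \<phi>_sum U (\<lambda>X Y Z. \<phi>_sum U (\<lambda>X' Y' Z'. \<epsilon> Z' \<odot>\<^bsub>U\<^esub> ?h (X \<bullet> X') (Y \<bullet> Y') Z))"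
    by (rule counit_pentagon_third) (simp_all add: trilinear_maps_iff)
  also have "\<dots> = \<phi>_sum U (\<lambda>X' Y' Z'. \<phi>_sum U (\<lambda>X Y Z. \<epsilon> Z' \<odot>\<^bsub>U\<^esub> ?h (X \<bullet> X') (Y \<bullet> Y') Z))"
    by (rule tensor_lift33_swap) (simp_all add: trilinear_maps_iff)
  also have "\<dots> = \<phi>_sum U (\<lambda>X' Y' Z'. \<epsilon> Z' \<odot>\<^bsub>U\<^esub> \<phi>_sum U (\<lambda>X Y Z. ?h (X \<bullet> X') (Y \<bullet> Y') Z))"
    by (intro tensor_lift3_cong refl tensor_lift3_smult) (simp_all add: trilinear_maps_iff)
  also have "\<dots> = \<phi>_sum U (\<lambda>X' Y' Z'. \<epsilon> Z' \<odot>\<^bsub>U\<^esub> \<phi>inv_sum U (\<lambda>x y z. \<phi>_sum U (\<lambda>X Y Z. \<epsilon> (z \<bullet> Z) \<odot>\<^bsub>U\<^esub> f (x \<bullet> (X \<bullet> X')) (y \<bullet> (Y \<bullet> Y')))))"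
    by (intro tensor_lift3_cong refl arg_cong[of _ _ "\<lambda>u. \<epsilon> Z' \<odot>\<^bsub>U\<^esub> u" for Z'] tensor_lift33_swap)
      (simp_all add: trilinear_maps_iff)
  also have "\<dots> = \<phi>_sum U (\<lambda>X' Y' Z'. \<epsilon> Z' \<odot>\<^bsub>U\<^esub> f X' Y')"
    by (intro tensor_lift3_cong refl) (simp only: inv)
  finally show ?thesis by simp
qed

text \<open>Insert \<phi>^-1 \<phi> = 1 and remove the copy of \<phi> by the preceding
  lemma.\<close>

lemma counit_inv_reassoc_third_sum:
  assumes U [simp]: "module R U" and f: "f \<in> bilinear_maps R H H U"
  shows "\<phi>inv_sum U (\<lambda>X Y Z. \<epsilon> Z \<odot>\<^bsub>U\<^esub> f X Y) = f \<one>\<^sub>H \<one>\<^sub>H"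
proof -
  note [simp] = f bilinear_mapsD[OF f] bilinear_maps_compose_linear[OF f]
  have "f \<one>\<^sub>H \<one>\<^sub>H = \<phi>inv_sum U (\<lambda>x y z. \<phi>_sum U (\<lambda>X Y Z. \<epsilon> (z \<bullet> Z) \<odot>\<^bsub>U\<^esub> f (x \<bullet> X) (y \<bullet> Y)))"
    using reassoc_inverse_sum(2)[of U "\<lambda>x y z. \<epsilon> z \<odot>\<^bsub>U\<^esub> f x y"] by (simp add: trilinear_maps_iff del: eps_mult)
  also have "\<dots> = \<phi>inv_sum U (\<lambda>x y z. \<epsilon> z \<odot>\<^bsub>U\<^esub> f x y)"
    by (simp add: smult_sum_simps counit_reassoc_third_sum trilinear_maps_iff bilinear_maps_iff)
  finally show ?thesis by simp
qed

end


section \<open>Identities in quasi-Hopf algebras\<close>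

context quasi_hopf_algebra
begin

abbreviation "S \<equiv> antipode H"
abbreviation "\<alpha> \<equiv> alpha H"
abbreviation "\<beta> \<equiv> beta H"

lemmas [simp] = alpha_closed beta_closed antipode_linear

lemma antipode_closed [simp]: "a \<in> carrier H \<Longrightarrow> S a \<in> carrier H"
  by (rule linear_maps_closed[OF antipode_linear])

lemma antipode_compose_linear [simp]: "f \<in> linear_maps R X H \<Longrightarrow> (\<lambda>x. S (f x)) \<in> linear_maps R X H"
  by (rule linear_maps_compose[OF _ antipode_linear])

text \<open>Products are nested to the right, the normal form produced by \<open>hassoc\<close>; the
  later computations bring their terms into this form so that the antipode identities match.\<close>

lemma antipode_alpha_sum:
  assumes U [simp]: "module R U" and g: "g \<in> linear_maps R H U" and a [simp]: "a \<in> carrier H"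
  shows "\<Delta>_sum U (\<lambda>x y. g (S x \<bullet> (\<alpha> \<bullet> y))) a = \<epsilon> a \<odot>\<^bsub>U\<^esub> g \<alpha>"
proof -
  have "g (\<Delta>_sum H (\<lambda>x y. S x \<bullet> \<alpha> \<bullet> y) a) = \<Delta>_sum U (\<lambda>x y. g (S x \<bullet> \<alpha> \<bullet> y)) a"
    by (rule linear_tensor_lift) (simp_all add: bilinear_maps_iff g)
  then have "\<Delta>_sum U (\<lambda>x y. g (S x \<bullet> \<alpha> \<bullet> y)) a = \<epsilon> a \<odot>\<^bsub>U\<^esub> g \<alpha>"
    by (simp add: antipode_alpha linear_maps_smult[OF g])
  then show ?thesis by (simp add: hassoc)
qed

lemma antipode_beta_sum:
  assumes U [simp]: "module R U" and g: "g \<in> linear_maps R H U" and a [simp]: "a \<in> carrier H"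
  shows "\<Delta>_sum U (\<lambda>x y. g (x \<bullet> (\<beta> \<bullet> S y))) a = \<epsilon> a \<odot>\<^bsub>U\<^esub> g \<beta>"
proof -
  have "g (\<Delta>_sum H (\<lambda>x y. x \<bullet> \<beta> \<bullet> S y) a) = \<Delta>_sum U (\<lambda>x y. g (x \<bullet> \<beta> \<bullet> S y)) a"
    by (rule linear_tensor_lift) (simp_all add: bilinear_maps_iff g)
  then have "\<Delta>_sum U (\<lambda>x y. g (x \<bullet> \<beta> \<bullet> S y)) a = \<epsilon> a \<odot>\<^bsub>U\<^esub> g \<beta>"
    by (simp add: antipode_beta linear_maps_smult[OF g])
  then show ?thesis by (simp add: hassoc)
qed

lemma antipode_reassoc_sum:
  assumes U [simp]: "module R U" and g: "g \<in> linear_maps R H U"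
  shows "\<phi>_sum U (\<lambda>X Y Z. g (X \<bullet> (\<beta> \<bullet> (S Y \<bullet> (\<alpha> \<bullet> Z))))) = g \<one>\<^sub>H"
proof -
  have "g (\<phi>_sum H (\<lambda>X Y Z. X \<bullet> \<beta> \<bullet> S Y \<bullet> \<alpha> \<bullet> Z)) = \<phi>_sum U (\<lambda>X Y Z. g (X \<bullet> \<beta> \<bullet> S Y \<bullet> \<alpha> \<bullet> Z))"
    by (rule linear_tensor_lift3) (simp_all add: trilinear_maps_iff g)
  then have "\<phi>_sum U (\<lambda>X Y Z. g (X \<bullet> \<beta> \<bullet> S Y \<bullet> \<alpha> \<bullet> Z)) = g \<one>\<^sub>H"
    by (simp add: antipode_reassoc)
  then show ?thesis by (simp add: hassoc)
qed

text \<open>Apply \<epsilon> to S(a1) \<alpha> a2 = \<epsilon>(a) \<alpha> and use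
  \<epsilon>(\<alpha>) = 1; the factor \<epsilon>(a2) is absorbed by the counit axiom.\<close>

lemma eps_antipode [simp]:
  assumes [simp]: "a \<in> carrier H"
  shows "\<epsilon> (S a) = \<epsilon> a"
proof -
  \<comment> \<open>The sums need a module as target, so the scalars are carried as multiples of 1
    in H and recovered by applying \<epsilon>.\<close>
  have eps: "\<epsilon> b = \<epsilon> c" if "\<epsilon> b \<odot>\<^bsub>H\<^esub> \<one>\<^sub>H = \<epsilon> c \<odot>\<^bsub>H\<^esub> \<one>\<^sub>H" "b \<in> carrier H" "c \<in> carrier H" for b c
    using arg_cong[OF that(1), of \<epsilon>] that(2,3) by (simp add: counit_smult)
  have "\<epsilon> (S a) \<odot>\<^bsub>H\<^esub> \<one>\<^sub>H = \<Delta>_sum H (\<lambda>x y. \<epsilon> y \<odot>\<^bsub>H\<^esub> (\<epsilon> (S x) \<odot>\<^bsub>H\<^esub> \<one>\<^sub>H)) a"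
    by (rule counit_right_sum[symmetric]) simp_all
  also have "\<dots> = \<Delta>_sum H (\<lambda>x y. \<epsilon> (S x \<bullet> (\<alpha> \<bullet> y)) \<odot>\<^bsub>H\<^esub> \<one>\<^sub>H) a"
    by (intro tensor_lift_cong refl) (simp add: counit_alpha module_smult_smult smult_left_commute[where R = R])
  also have "\<dots> = \<epsilon> a \<odot>\<^bsub>H\<^esub> (\<epsilon> \<alpha> \<odot>\<^bsub>H\<^esub> \<one>\<^sub>H)"
    by (rule antipode_alpha_sum[where g = "\<lambda>u. \<epsilon> u \<odot>\<^bsub>H\<^esub> \<one>\<^sub>H"]) simp_all
  finally show ?thesis by (intro eps) (simp_all add: counit_alpha)
qed

text \<open>The map a \<otimes> b \<otimes> c \<otimes> d \<mapsto> f(a, b \<beta> S(c) \<alpha> d)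
  is applied to \<open>pentagon_inv_sum\<close>. The right-hand side collapses from inside out: Y1
  \<beta> S(Y2) leaves \<epsilon>(Y') \<beta>, which removes the primed \<phi>; S(z1) \<alpha> z2
  leaves \<epsilon>(z) \<alpha>; then X \<beta> S(Y) \<alpha> Z = 1. The remaining \<epsilon> on the
  last leg of \<phi>^-1 removes that copy too.\<close>

lemma reassoc_coinvariance_sum:
  assumes U [simp]: "module R U" and f: "f \<in> bilinear_maps R H H U"
  shows "\<phi>_sum U (\<lambda>X Y Z. \<Delta>_sum U (\<lambda>X1 X2. \<phi>inv_sum U (\<lambda>x y z.
      f (X1 \<bullet> x) (X2 \<bullet> (y \<bullet> (\<beta> \<bullet> (S z \<bullet> (S Y \<bullet> (\<alpha> \<bullet> Z)))))))) X) = f \<one>\<^sub>H \<one>\<^sub>H"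
proof -
  note [simp] = f bilinear_mapsD[OF f] bilinear_maps_compose_linear[OF f] hassoc antipode_mult
  let ?h = "\<lambda>a b c d. f a (b \<bullet> (\<beta> \<bullet> (S c \<bullet> (\<alpha> \<bullet> d))))"
  have h: "quadrilinear U ?h" by (simp add: quadrilinear_def)
  have 1: "\<Delta>_sum U (\<lambda>Y1 Y2. ?h (x \<bullet> X') (y \<bullet> (X \<bullet> Y1)) (z1 \<bullet> (Y \<bullet> Y2)) (z2 \<bullet> (Z \<bullet> Z'))) Y'
      = \<epsilon> Y' \<odot>\<^bsub>U\<^esub> f (x \<bullet> X') (y \<bullet> (X \<bullet> (\<beta> \<bullet> (S Y \<bullet> (S z1 \<bullet> (\<alpha> \<bullet> (z2 \<bullet> (Z \<bullet> Z'))))))))"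
    if "x \<in> carrier H" "y \<in> carrier H" "z1 \<in> carrier H" "z2 \<in> carrier H"
      "X \<in> carrier H" "Y \<in> carrier H" "Z \<in> carrier H" "X' \<in> carrier H" "Y' \<in> carrier H" "Z' \<in> carrier H"
    for x y z1 z2 X Y Z X' Y' Z'
    using antipode_beta_sum[of U "\<lambda>u. f (x \<bullet> X') (y \<bullet> (X \<bullet> (u \<bullet> (S Y \<bullet> (S z1 \<bullet> (\<alpha> \<bullet> (z2 \<bullet> (Z \<bullet> Z'))))))))" Y'] that
    by simp
  have 2: "\<phi>_sum U (\<lambda>X' Y' Z'. \<epsilon> Y' \<odot>\<^bsub>U\<^esub> f (x \<bullet> X') (y \<bullet> (X \<bullet> (\<beta> \<bullet> (S Y \<bullet> (S z1 \<bullet> (\<alpha> \<bullet> (z2 \<bullet> (Z \<bullet> Z')))))))))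
      = f x (y \<bullet> (X \<bullet> (\<beta> \<bullet> (S Y \<bullet> (S z1 \<bullet> (\<alpha> \<bullet> (z2 \<bullet> Z)))))))"
    if "x \<in> carrier H" "y \<in> carrier H" "z1 \<in> carrier H" "z2 \<in> carrier H"
      "X \<in> carrier H" "Y \<in> carrier H" "Z \<in> carrier H"
    for x y z1 z2 X Y Z
    using that by (subst counit_reassoc_sum) (simp_all add: bilinear_maps_iff)
  have 3: "\<Delta>_sum U (\<lambda>z1 z2. f x (y \<bullet> (X \<bullet> (\<beta> \<bullet> (S Y \<bullet> (S z1 \<bullet> (\<alpha> \<bullet> (z2 \<bullet> Z)))))))) z
      = \<epsilon> z \<odot>\<^bsub>U\<^esub> f x (y \<bullet> (X \<bullet> (\<beta> \<bullet> (S Y \<bullet> (\<alpha> \<bullet> Z)))))"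
    if "x \<in> carrier H" "y \<in> carrier H" "z \<in> carrier H" "X \<in> carrier H" "Y \<in> carrier H" "Z \<in> carrier H"
    for x y z X Y Z
    using antipode_alpha_sum[of U "\<lambda>u. f x (y \<bullet> (X \<bullet> (\<beta> \<bullet> (S Y \<bullet> (u \<bullet> Z)))))" z] that by simp
  have 4: "\<phi>_sum U (\<lambda>X Y Z. \<epsilon> z \<odot>\<^bsub>U\<^esub> f x (y \<bullet> (X \<bullet> (\<beta> \<bullet> (S Y \<bullet> (\<alpha> \<bullet> Z)))))) = \<epsilon> z \<odot>\<^bsub>U\<^esub> f x y"
    if "x \<in> carrier H" "y \<in> carrier H" "z \<in> carrier H" for x y z
    using antipode_reassoc_sum[of U "\<lambda>u. \<epsilon> z \<odot>\<^bsub>U\<^esub> f x (y \<bullet> u)"] that by simp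
  have "\<phi>_sum U (\<lambda>X Y Z. \<Delta>_sum U (\<lambda>X1 X2. \<phi>inv_sum U (\<lambda>x y z.
      f (X1 \<bullet> x) (X2 \<bullet> (y \<bullet> (\<beta> \<bullet> (S z \<bullet> (S Y \<bullet> (\<alpha> \<bullet> Z)))))))) X)
    = \<phi>_sum U (\<lambda>X Y Z. \<Delta>_sum U (\<lambda>X1 X2. \<phi>inv_sum U (\<lambda>x y z. ?h (X1 \<bullet> x) (X2 \<bullet> y) (Y \<bullet> z) Z)) X)"
    by (intro tensor_lift3_cong tensor_lift_cong refl) simp
  also have "\<dots> = \<phi>inv_sum U (\<lambda>x y z. \<Delta>_sum U (\<lambda>z1 z2. \<phi>_sum U (\<lambda>X Y Z. \<phi>_sum U (\<lambda>X' Y' Z'. \<Delta>_sum U (\<lambda>Y1 Y2.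
        ?h (x \<bullet> X') (y \<bullet> (X \<bullet> Y1)) (z1 \<bullet> (Y \<bullet> Y2)) (z2 \<bullet> (Z \<bullet> Z'))) Y'))) z)"
    by (rule pentagon_inv_sum[OF U h])
  also have "\<dots> = \<phi>inv_sum U (\<lambda>x y z. \<Delta>_sum U (\<lambda>z1 z2. \<phi>_sum U (\<lambda>X Y Z.
      f x (y \<bullet> (X \<bullet> (\<beta> \<bullet> (S Y \<bullet> (S z1 \<bullet> (\<alpha> \<bullet> (z2 \<bullet> Z))))))))) z)"
    by (intro tensor_lift3_cong tensor_lift_cong refl) (simp only: 1 2 cong: tensor_lift3_cong)
  also have "\<dots> = \<phi>inv_sum U (\<lambda>x y z. \<phi>_sum U (\<lambda>X Y Z. \<Delta>_sum U (\<lambda>z1 z2.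
      f x (y \<bullet> (X \<bullet> (\<beta> \<bullet> (S Y \<bullet> (S z1 \<bullet> (\<alpha> \<bullet> (z2 \<bullet> Z)))))))) z))"
    by (intro tensor_lift3_cong refl tensor_lift3_swap[symmetric]) (simp_all add: bilinear_maps_iff trilinear_maps_iff)
  also have "\<dots> = \<phi>inv_sum U (\<lambda>x y z. \<epsilon> z \<odot>\<^bsub>U\<^esub> f x y)"
    by (intro tensor_lift3_cong refl) (simp only: 3 4 cong: tensor_lift3_cong)
  also have "\<dots> = f \<one>\<^sub>H \<one>\<^sub>H" by (rule counit_inv_reassoc_third_sum[OF U f])
  finally show ?thesis .
qed

end


section \<open>Quasi-Hopf bimodules and the projection onto coinvariants\<close>

locale quasi_hopf_bimodule_over = quasi_hopf_algebra R H + M: quasi_hopf_bimodule R H M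
  for R :: "('k, 'r) ring_scheme"
    and H :: "('k, 'h, 'a) quasi_hopf_algebra_scheme"
    and M :: "('k, 'h, 'm, 'b) quasi_hopf_bimodule_scheme"
begin

section \<open>Actions and coaction under Sweedler sums\<close>

abbreviation la (infixr "\<rightharpoonup>" 69) where "la \<equiv> lact M"
abbreviation ra (infixl "\<leftharpoonup>" 68) where "ra \<equiv> ract M"
abbreviation "\<rho>_sum U f m \<equiv> tensor_lift R M H U f (coact M m)"
abbreviation "E \<equiv> coinv_proj R H M"

lemma module_M [simp]: "module R M"
  by unfold_locales

lemma lact_bilinear [simp]: "la \<in> bilinear_maps R H M M"
  unfolding bilinear_maps_iff
  using linear_maps_closed[OF M.lact_linear]
  by (intro conjI ballI linear_mapsI) (simp_all add: M.lact_add M.lact_smult linear_maps_add[OF M.lact_linear] linear_maps_smult[OF M.lact_linear])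

lemma ract_bilinear [simp]: "ra \<in> bilinear_maps R M H M"
  unfolding bilinear_maps_iff
  using linear_maps_closed[OF M.ract_linear]
  by (intro conjI ballI linear_mapsI) (simp_all add: M.ract_add M.ract_smult linear_maps_add[OF M.ract_linear] linear_maps_smult[OF M.ract_linear])

lemmas act_linear [simp] = bilinear_maps_compose_linear[OF lact_bilinear] bilinear_maps_compose_linear[OF ract_bilinear]
lemmas act_closed [simp] = bilinear_mapsD(3)[OF lact_bilinear] bilinear_mapsD(3)[OF ract_bilinear]
lemmas act_one [simp] = M.lact_one M.ract_one

lemma coact_compose_linear [simp]: "f \<in> linear_maps R X M \<Longrightarrow> (\<lambda>x. coact M (f x)) \<in> linear_maps R X (tensor R M H)"
  by (rule linear_maps_compose[OF _ M.coact_linear])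

lemma coact_closed [simp]: "m \<in> carrier M \<Longrightarrow> coact M m \<in> carrier (tensor R M H)"
  by (rule linear_maps_closed[OF M.coact_linear])

lemmas [simp] = M.coact_linear

lemma coact_lact_sum:
  assumes "module R U" "f \<in> bilinear_maps R M H U" "a \<in> carrier H" "m \<in> carrier M"
  shows "\<rho>_sum U f (a \<rightharpoonup> m) = \<Delta>_sum U (\<lambda>x y. \<rho>_sum U (\<lambda>m0 m1. f (x \<rightharpoonup> m0) (y \<bullet> m1)) m) a"
  unfolding M.coact_lact[OF assms(3,4)] lact2_def
  using assms by (intro tensor_lift_tensor_op) simp_all

lemma coact_ract_sum:
  assumes "module R U" "f \<in> bilinear_maps R M H U" "a \<in> carrier H" "m \<in> carrier M"
  shows "\<rho>_sum U f (m \<leftharpoonup> a) = \<rho>_sum U (\<lambda>m0 m1. \<Delta>_sum U (\<lambda>x y. f (m0 \<leftharpoonup> x) (m1 \<bullet> y)) a) m"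
  unfolding M.coact_ract[OF assms(3,4)] ract2_def
  using assms by (intro tensor_lift_tensor_op) simp_all

lemma coact_counit_sum:
  assumes U [simp]: "module R U" and g: "g \<in> linear_maps R M U" and m [simp]: "m \<in> carrier M"
  shows "\<rho>_sum U (\<lambda>n x. \<epsilon> x \<odot>\<^bsub>U\<^esub> g n) m = g m"
proof -
  have "g (\<rho>_sum M (\<lambda>n x. \<epsilon> x \<odot>\<^bsub>M\<^esub> n) m) = \<rho>_sum U (\<lambda>n x. g (\<epsilon> x \<odot>\<^bsub>M\<^esub> n)) m"
    by (rule linear_tensor_lift) (simp_all add: bilinear_maps_iff g)
  then show ?thesis by (simp add: M.coact_counit linear_maps_smult[OF g])
qed

lemma coact_coassoc_sum:
  assumes U [simp]: "module R U" and f: "f \<in> trilinear_maps R M H H U" and m [simp]: "m \<in> carrier M"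
  shows "\<phi>_sum U (\<lambda>X Y Z. \<rho>_sum U (\<lambda>m0 m1. \<rho>_sum U (\<lambda>n0 n1. f (X \<rightharpoonup> n0) (Y \<bullet> n1) (Z \<bullet> m1)) m0) m)
    = \<rho>_sum U (\<lambda>m0 m1. \<Delta>_sum U (\<lambda>u v. \<phi>_sum U (\<lambda>X Y Z. f (m0 \<leftharpoonup> X) (u \<bullet> Y) (v \<bullet> Z))) m1) m"
proof -
  note [simp] = f trilinear_mapsD[OF f] trilinear_compose[OF f]
  have 1: "tensor_map R M H M HH id (comult H) (coact M m) \<in> carrier (tensor R M HH)"
    by (simp add: linear_maps_closed[OF tensor_map_linear])
  have 2: "tensor_assoc R M H H (tensor_map R M H M HH id (comult H) (coact M m)) \<in> carrier (tensor3 R M H H)"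
    by (simp add: linear_maps_closed[OF tensor_assoc_linear] 1)
  have 3: "tensor_map R M H (tensor R M H) H (coact M) id (coact M m) \<in> carrier (tensor3 R M H H)"
    by (simp add: linear_maps_closed[OF tensor_map_linear])
  have 4: "tensor_lift3 R M H H U f (lact3 R H M \<phi> t) =
     \<phi>_sum U (\<lambda>X Y Z. tensor_lift3 R M H H U (\<lambda>n x y. f (X \<rightharpoonup> n) (Y \<bullet> x) (Z \<bullet> y)) t)"
    if "t \<in> carrier (tensor3 R M H H)" for t
    unfolding lact3_def lact2_def using that by (intro tensor_lift3_tensor_op) simp_all
  have 5: "tensor_lift3 R M H H U f (ract3 R H M t \<phi>) =
     tensor_lift3 R M H H U (\<lambda>n x y. \<phi>_sum U (\<lambda>X Y Z. f (n \<leftharpoonup> X) (x \<bullet> Y) (y \<bullet> Z))) t"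
    if "t \<in> carrier (tensor3 R M H H)" for t
    unfolding ract3_def ract2_def using that by (intro tensor_lift3_tensor_op) simp_all
  show ?thesis
    using arg_cong[OF M.coact_coassoc[OF m], of "tensor_lift3 R M H H U f"]
    by (simp add: 1 2 3 4 5 tensor_lift3_tensor_assoc tensor_lift3_tensor_map tensor_lift_tensor_map
      trilinear_maps_iff bilinear_maps_iff)
qed

text \<open>The coassociativity axiom solved for the iterated coaction: (\<rho> \<otimes>
  id)(\<rho>(m)) = \<phi>^-1 (id \<otimes> \<Delta>)(\<rho>(m)) \<phi>.\<close>

lemma coact_coassoc_inv_sum:
  assumes U [simp]: "module R U" and f: "f \<in> trilinear_maps R M H H U" and m [simp]: "m \<in> carrier M"
  shows "\<rho>_sum U (\<lambda>m0 m1. \<rho>_sum U (\<lambda>n0 n1. f n0 n1 m1) m0) m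
    = \<phi>inv_sum U (\<lambda>x y z. \<rho>_sum U (\<lambda>m0 m1. \<Delta>_sum U (\<lambda>u v. \<phi>_sum U (\<lambda>X Y Z.
        f (x \<rightharpoonup> (m0 \<leftharpoonup> X)) (y \<bullet> (u \<bullet> Y)) (z \<bullet> (v \<bullet> Z)))) m1) m)"
proof -
  note [simp] = f trilinear_mapsD[OF f] trilinear_compose[OF f]
  \<comment> \<open>The extra arguments act factorwise. At three units \<open>?g\<close> is the sum
    in question, and there \<phi>^-1 \<phi> is inserted.\<close>
  let ?g = "\<lambda>a b c. \<rho>_sum U (\<lambda>m0 m1. \<rho>_sum U (\<lambda>n0 n1. f (a \<rightharpoonup> n0) (b \<bullet> n1) (c \<bullet> m1)) m0) m"
  have g: "?g \<in> trilinear_maps R H H H U" by (simp add: trilinear_maps_iff bilinear_maps_iff)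
  have "\<rho>_sum U (\<lambda>m0 m1. \<rho>_sum U (\<lambda>n0 n1. f n0 n1 m1) m0) m = ?g \<one>\<^sub>H \<one>\<^sub>H \<one>\<^sub>H"
    by (intro tensor_lift_cong refl) simp
  also have "\<dots> = \<phi>inv_sum U (\<lambda>x y z. \<phi>_sum U (\<lambda>X Y Z. ?g (x \<bullet> X) (y \<bullet> Y) (z \<bullet> Z)))"
    by (rule reassoc_inverse_sum(2)[OF U g, symmetric])
  also have "\<dots> = \<phi>inv_sum U (\<lambda>x y z. \<phi>_sum U (\<lambda>X Y Z. \<rho>_sum U (\<lambda>m0 m1. \<rho>_sum U (\<lambda>n0 n1.
      f (x \<rightharpoonup> (X \<rightharpoonup> n0)) (y \<bullet> (Y \<bullet> n1)) (z \<bullet> (Z \<bullet> m1))) m0) m))"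
    by (intro tensor_lift3_cong tensor_lift_cong refl) (simp add: hassoc M.lact_mult)
  also have "\<dots> = \<phi>inv_sum U (\<lambda>x y z. \<rho>_sum U (\<lambda>m0 m1. \<Delta>_sum U (\<lambda>u v. \<phi>_sum U (\<lambda>X Y Z.
        f (x \<rightharpoonup> (m0 \<leftharpoonup> X)) (y \<bullet> (u \<bullet> Y)) (z \<bullet> (v \<bullet> Z)))) m1) m)"
    by (intro tensor_lift3_cong refl coact_coassoc_sum) (simp_all add: trilinear_maps_iff)
  finally show ?thesis .
qed

section \<open>The projection onto coinvariants\<close>

lemma antipode_inv_simps [simp]:
  "a \<in> carrier H \<Longrightarrow> inv_into (carrier H) S a \<in> carrier H"
  "a \<in> carrier H \<Longrightarrow> S (inv_into (carrier H) S a) = a"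
  using bij_betw_inv_into[OF antipode_bij] bij_betw_inv_into_right[OF antipode_bij]
  by (auto dest: bij_betwE)

lemma antipode_inv_linear: "inv_into (carrier H) S \<in> linear_maps R H H"
proof (rule linear_mapsI)
  have inj: "inv_into (carrier H) S (S a) = a" if "a \<in> carrier H" for a
    using bij_betw_inv_into_left[OF antipode_bij that] .
  interpret H: module R H by simp
  fix a b x assume [simp]: "a \<in> carrier H"
  { assume [simp]: "b \<in> carrier H"
    show "inv_into (carrier H) S (a \<oplus>\<^bsub>H\<^esub> b) = inv_into (carrier H) S a \<oplus>\<^bsub>H\<^esub> inv_into (carrier H) S b"
      using inj[of "inv_into (carrier H) S a \<oplus>\<^bsub>H\<^esub> inv_into (carrier H) S b"]
      by (simp add: linear_maps_add[OF antipode_linear]) }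
  assume [simp]: "x \<in> carrier R"
  show "inv_into (carrier H) S (x \<odot>\<^bsub>H\<^esub> a) = x \<odot>\<^bsub>H\<^esub> inv_into (carrier H) S a"
    using inj[of "x \<odot>\<^bsub>H\<^esub> inv_into (carrier H) S a"]
    by (simp add: linear_maps_smult[OF antipode_linear])
qed simp

lemma E_eq:
  assumes [simp]: "m \<in> carrier M"
  shows "E m = \<phi>_sum M (\<lambda>X Y Z. \<rho>_sum M (\<lambda>m0 m1. X \<rightharpoonup> m0 \<leftharpoonup> \<beta> \<bullet> (S m1 \<bullet> (S Y \<bullet> (\<alpha> \<bullet> Z)))) m)"
proof -
  note [simp] = linear_maps_compose[OF _ antipode_inv_linear]
  have "E m = \<phi>_sum M (\<lambda>X Y Z. \<rho>_sum M (\<lambda>m0 m1.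
      X \<rightharpoonup> m0 \<leftharpoonup> \<beta> \<bullet> S (inv_into (carrier H) S (\<alpha> \<bullet> Z) \<bullet> Y \<bullet> m1)) m)"
    unfolding coinv_proj_def q_R_def by (simp add: trilinear_maps_iff bilinear_maps_iff)
  also have "\<dots> = \<phi>_sum M (\<lambda>X Y Z. \<rho>_sum M (\<lambda>m0 m1. X \<rightharpoonup> m0 \<leftharpoonup> \<beta> \<bullet> (S m1 \<bullet> (S Y \<bullet> (\<alpha> \<bullet> Z)))) m)"
    by (intro tensor_lift3_cong tensor_lift_cong refl) (simp add: antipode_mult)
  finally show ?thesis .
qed

lemma E_linear [simp]: "E \<in> linear_maps R M M"
proof -
  have "(\<lambda>m. \<phi>_sum M (\<lambda>X Y Z. \<rho>_sum M (\<lambda>m0 m1. X \<rightharpoonup> m0 \<leftharpoonup> \<beta> \<bullet> (S m1 \<bullet> (S Y \<bullet> (\<alpha> \<bullet> Z)))) m)) \<in> linear_maps R M M"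
    by (simp add: trilinear_maps_iff bilinear_maps_iff)
  moreover have "E m \<in> carrier M" if "m \<in> carrier M" for m
    using that by (simp add: E_eq trilinear_maps_iff bilinear_maps_iff)
  ultimately show ?thesis
    unfolding linear_maps_def by (auto simp: E_eq)
qed

lemma E_compose_linear [simp]: "f \<in> linear_maps R X M \<Longrightarrow> (\<lambda>x. E (f x)) \<in> linear_maps R X M"
  by (rule linear_maps_compose[OF _ E_linear])

lemma E_closed [simp]: "m \<in> carrier M \<Longrightarrow> E m \<in> carrier M"
  by (rule linear_maps_closed[OF E_linear])


lemmas mult_simps = hassoc antipode_mult M.lact_mult M.ract_mult M.lact_ract
lemmas multilinear_iffs = bilinear_maps_iff trilinear_maps_iff

lemma ract_sum:
  assumes "module R V" "module R W" "f \<in> bilinear_maps R V W M" "t \<in> carrier (tensor R V W)" "a \<in> carrier H"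
  shows "tensor_lift R V W M f t \<leftharpoonup> a = tensor_lift R V W M (\<lambda>v w. f v w \<leftharpoonup> a) t"
  by (rule linear_tensor_lift[where h = "\<lambda>m. m \<leftharpoonup> a"]) (simp_all add: assms)

lemma ract_sum3:
  assumes "module R A" "module R B" "module R C" "f \<in> trilinear_maps R A B C M"
    "t \<in> carrier (tensor3 R A B C)" "a \<in> carrier H"
  shows "tensor_lift3 R A B C M f t \<leftharpoonup> a = tensor_lift3 R A B C M (\<lambda>x y z. f x y z \<leftharpoonup> a) t"
  by (rule linear_tensor_lift3[where h = "\<lambda>m. m \<leftharpoonup> a"]) (simp_all add: assms)

lemma lact_sum:
  assumes "module R V" "module R W" "f \<in> bilinear_maps R V W M" "t \<in> carrier (tensor R V W)" "a \<in> carrier H"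
  shows "a \<rightharpoonup> tensor_lift R V W M f t = tensor_lift R V W M (\<lambda>v w. a \<rightharpoonup> f v w) t"
  by (rule linear_tensor_lift[where h = "\<lambda>m. a \<rightharpoonup> m"]) (simp_all add: assms)

lemma lact_sum3:
  assumes "module R A" "module R B" "module R C" "f \<in> trilinear_maps R A B C M"
    "t \<in> carrier (tensor3 R A B C)" "a \<in> carrier H"
  shows "a \<rightharpoonup> tensor_lift3 R A B C M f t = tensor_lift3 R A B C M (\<lambda>x y z. a \<rightharpoonup> f x y z) t"
  by (rule linear_tensor_lift3[where h = "\<lambda>m. a \<rightharpoonup> m"]) (simp_all add: assms)

text \<open>Since S reverses products, m0 a1 \<beta> S(m1 a2) contains a1 \<beta> S(a2), which is
  \<epsilon>(a) \<beta>.\<close>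

lemma E_ract:
  assumes [simp]: "m \<in> carrier M" "a \<in> carrier H"
  shows "E (m \<leftharpoonup> a) = \<epsilon> a \<odot>\<^bsub>M\<^esub> E m"
proof -
  have 1: "\<Delta>_sum M (\<lambda>x y. X \<rightharpoonup> (m0 \<leftharpoonup> x) \<leftharpoonup> \<beta> \<bullet> (S (m1 \<bullet> y) \<bullet> (S Y \<bullet> (\<alpha> \<bullet> Z)))) a
      = \<epsilon> a \<odot>\<^bsub>M\<^esub> (X \<rightharpoonup> m0 \<leftharpoonup> \<beta> \<bullet> (S m1 \<bullet> (S Y \<bullet> (\<alpha> \<bullet> Z))))"
    if "m0 \<in> carrier M" "m1 \<in> carrier H" "X \<in> carrier H" "Y \<in> carrier H" "Z \<in> carrier H" for m0 m1 X Y Z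
    using antipode_beta_sum[of M "\<lambda>u. X \<rightharpoonup> (m0 \<leftharpoonup> u \<bullet> (S m1 \<bullet> (S Y \<bullet> (\<alpha> \<bullet> Z))))" a] that
    by (simp add: mult_simps)
  have "E (m \<leftharpoonup> a) = \<phi>_sum M (\<lambda>X Y Z. \<rho>_sum M (\<lambda>m0 m1. \<Delta>_sum M (\<lambda>x y.
      X \<rightharpoonup> (m0 \<leftharpoonup> x) \<leftharpoonup> \<beta> \<bullet> (S (m1 \<bullet> y) \<bullet> (S Y \<bullet> (\<alpha> \<bullet> Z)))) a) m)"
    by (simp add: E_eq) (intro tensor_lift3_cong refl coact_ract_sum, simp_all add: bilinear_maps_iff)
  also have "\<dots> = \<epsilon> a \<odot>\<^bsub>M\<^esub> E m"
    by (simp add: 1 E_eq smult_sum_simps multilinear_iffs)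
  finally show ?thesis .
qed

text \<open>In the formula for E(m) everything to the right of m0 is turned into its counit by
  \<open>E_ract\<close>. The counits on m1 and on \<phi> then remove both sums, leaving
  E(m).\<close>

lemma E_E:
  assumes [simp]: "m \<in> carrier M"
  shows "E (E m) = E m"
proof -
  have "E (E m) = \<phi>_sum M (\<lambda>X Y Z. E (\<rho>_sum M (\<lambda>m0 m1. X \<rightharpoonup> m0 \<leftharpoonup> \<beta> \<bullet> (S m1 \<bullet> (S Y \<bullet> (\<alpha> \<bullet> Z)))) m))"
    unfolding E_eq[OF assms] by (rule linear_tensor_lift3) (simp_all add: multilinear_iffs)
  also have "\<dots> = \<phi>_sum M (\<lambda>X Y Z. \<rho>_sum M (\<lambda>m0 m1. E (X \<rightharpoonup> m0 \<leftharpoonup> \<beta> \<bullet> (S m1 \<bullet> (S Y \<bullet> (\<alpha> \<bullet> Z))))) m)"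
    by (intro tensor_lift3_cong refl linear_tensor_lift) (simp_all add: multilinear_iffs)
  also have "\<dots> = \<phi>_sum M (\<lambda>X Y Z. \<rho>_sum M (\<lambda>m0 m1. \<epsilon> m1 \<odot>\<^bsub>M\<^esub> (\<epsilon> Y \<odot>\<^bsub>M\<^esub> (\<epsilon> Z \<odot>\<^bsub>M\<^esub> E (X \<rightharpoonup> m0)))) m)"
    by (intro tensor_lift3_cong tensor_lift_cong refl) (simp add: E_ract module_smult_smult counit_alpha counit_beta)
  also have "\<dots> = \<phi>_sum M (\<lambda>X Y Z. \<epsilon> Y \<odot>\<^bsub>M\<^esub> (\<epsilon> Z \<odot>\<^bsub>M\<^esub> E (X \<rightharpoonup> m)))"
    by (intro tensor_lift3_cong refl coact_counit_sum) simp_all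
  also have "\<dots> = E m"
    by (subst counit_reassoc_sum) (simp_all add: multilinear_iffs)
  finally show ?thesis .
qed

text \<open>Written through \<open>?f\<close>, the left side contains the element \<phi> (\<Delta>
  \<otimes> id)(\<Delta>(a)). Quasi-coassociativity turns it into (id \<otimes>
  \<Delta>)(\<Delta>(a)) \<phi>, where the two halves u, v of a2 meet in S(u Y) \<alpha> v Z and
  reduce to \<epsilon>(a2) S(Y) \<alpha> Z.\<close>

lemma lact_E:
  assumes m [simp]: "m \<in> carrier M" and a [simp]: "a \<in> carrier H"
  shows "\<Delta>_sum M (\<lambda>x y. E (x \<rightharpoonup> m) \<leftharpoonup> y) a = a \<rightharpoonup> E m"
proof -
  let ?f = "\<lambda>a b c. \<rho>_sum M (\<lambda>m0 m1. a \<rightharpoonup> m0 \<leftharpoonup> \<beta> \<bullet> (S m1 \<bullet> (S b \<bullet> (\<alpha> \<bullet> c)))) m"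
  have f: "?f \<in> trilinear_maps R H H H M" by (simp add: multilinear_iffs)
  note [simp] = trilinear_mapsD[OF f] trilinear_compose[OF f]
  have 1: "E (x \<rightharpoonup> m) \<leftharpoonup> y = \<phi>_sum M (\<lambda>X Y Z. \<Delta>_sum M (\<lambda>u v. ?f (X \<bullet> u) (Y \<bullet> v) (Z \<bullet> y)) x)"
    if [simp]: "x \<in> carrier H" "y \<in> carrier H" for x y
  proof -
    have "E (x \<rightharpoonup> m) \<leftharpoonup> y = \<phi>_sum M (\<lambda>X Y Z. \<rho>_sum M (\<lambda>m0 m1. X \<rightharpoonup> m0 \<leftharpoonup> \<beta> \<bullet> (S m1 \<bullet> (S Y \<bullet> (\<alpha> \<bullet> (Z \<bullet> y))))) (x \<rightharpoonup> m))"
      by (simp add: E_eq ract_sum ract_sum3 multilinear_iffs) (simp add: mult_simps)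
    also have "\<dots> = \<phi>_sum M (\<lambda>X Y Z. \<Delta>_sum M (\<lambda>u v. \<rho>_sum M (\<lambda>m0 m1.
        X \<rightharpoonup> u \<rightharpoonup> m0 \<leftharpoonup> \<beta> \<bullet> (S (v \<bullet> m1) \<bullet> (S Y \<bullet> (\<alpha> \<bullet> (Z \<bullet> y))))) m) x)"
      by (intro tensor_lift3_cong refl coact_lact_sum) (simp_all add: multilinear_iffs)
    also have "\<dots> = \<phi>_sum M (\<lambda>X Y Z. \<Delta>_sum M (\<lambda>u v. ?f (X \<bullet> u) (Y \<bullet> v) (Z \<bullet> y)) x)"
      by (intro tensor_lift3_cong tensor_lift_cong refl) (simp add: mult_simps)
    finally show ?thesis .
  qed
  have 2: "\<Delta>_sum M (\<lambda>u v. ?f (x \<bullet> X) (u \<bullet> Y) (v \<bullet> Z)) y = \<epsilon> y \<odot>\<^bsub>M\<^esub> (x \<rightharpoonup> ?f X Y Z)"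
    if [simp]: "x \<in> carrier H" "y \<in> carrier H" "X \<in> carrier H" "Y \<in> carrier H" "Z \<in> carrier H" for x y X Y Z
  proof -
    have *: "\<Delta>_sum M (\<lambda>u v. x \<bullet> X \<rightharpoonup> m0 \<leftharpoonup> \<beta> \<bullet> (S m1 \<bullet> (S (u \<bullet> Y) \<bullet> (\<alpha> \<bullet> (v \<bullet> Z))))) y
        = \<epsilon> y \<odot>\<^bsub>M\<^esub> (x \<rightharpoonup> (X \<rightharpoonup> m0 \<leftharpoonup> \<beta> \<bullet> (S m1 \<bullet> (S Y \<bullet> (\<alpha> \<bullet> Z)))))"
      if [simp]: "m0 \<in> carrier M" "m1 \<in> carrier H" for m0 m1
      using antipode_alpha_sum[of M "\<lambda>w. x \<rightharpoonup> (X \<rightharpoonup> m0 \<leftharpoonup> \<beta> \<bullet> (S m1 \<bullet> (S Y \<bullet> (w \<bullet> Z))))" y]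
      by (simp add: mult_simps)
    have "\<Delta>_sum M (\<lambda>u v. ?f (x \<bullet> X) (u \<bullet> Y) (v \<bullet> Z)) y = \<rho>_sum M (\<lambda>m0 m1.
        \<Delta>_sum M (\<lambda>u v. x \<bullet> X \<rightharpoonup> m0 \<leftharpoonup> \<beta> \<bullet> (S m1 \<bullet> (S (u \<bullet> Y) \<bullet> (\<alpha> \<bullet> (v \<bullet> Z))))) y) m"
      by (rule tensor_lift_swap) simp_all
    also have "\<dots> = \<epsilon> y \<odot>\<^bsub>M\<^esub> (x \<rightharpoonup> ?f X Y Z)"
      by (simp add: * smult_sum_simps lact_sum multilinear_iffs)
    finally show ?thesis .
  qed
  have "\<Delta>_sum M (\<lambda>x y. E (x \<rightharpoonup> m) \<leftharpoonup> y) a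
      = \<Delta>_sum M (\<lambda>x y. \<phi>_sum M (\<lambda>X Y Z. \<Delta>_sum M (\<lambda>u v. ?f (X \<bullet> u) (Y \<bullet> v) (Z \<bullet> y)) x)) a"
    by (intro tensor_lift_cong refl 1)
  also have "\<dots> = \<phi>_sum M (\<lambda>X Y Z. \<Delta>_sum M (\<lambda>x y. \<Delta>_sum M (\<lambda>u v. ?f (X \<bullet> u) (Y \<bullet> v) (Z \<bullet> y)) x) a)"
    by (rule tensor_lift3_swap[symmetric]) (simp_all add: multilinear_iffs)
  also have "\<dots> = \<Delta>_sum M (\<lambda>x y. \<Delta>_sum M (\<lambda>u v. \<phi>_sum M (\<lambda>X Y Z. ?f (x \<bullet> X) (u \<bullet> Y) (v \<bullet> Z))) y) a"
    by (rule quasi_coassoc_sum[symmetric, OF _ f]) simp_all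
  also have "\<dots> = \<Delta>_sum M (\<lambda>x y. \<phi>_sum M (\<lambda>X Y Z. \<Delta>_sum M (\<lambda>u v. ?f (x \<bullet> X) (u \<bullet> Y) (v \<bullet> Z)) y)) a"
    by (intro tensor_lift_cong refl tensor_lift3_swap[symmetric]) (simp_all add: multilinear_iffs)
  also have "\<dots> = \<Delta>_sum M (\<lambda>x y. \<phi>_sum M (\<lambda>X Y Z. \<epsilon> y \<odot>\<^bsub>M\<^esub> (x \<rightharpoonup> ?f X Y Z))) a"
    by (intro tensor_lift_cong tensor_lift3_cong refl 2)
  also have "\<dots> = \<Delta>_sum M (\<lambda>x y. \<epsilon> y \<odot>\<^bsub>M\<^esub> (x \<rightharpoonup> E m)) a"
    by (intro tensor_lift_cong refl) (simp add: E_eq smult_sum_simps lact_sum3 multilinear_iffs)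
  also have "\<dots> = a \<rightharpoonup> E m"
    by (rule counit_right_sum) simp_all
  finally show ?thesis .
qed

text \<open>Apply \<open>E\<close> to \<open>lact_E\<close>: the right factor becomes a counit and
  undoes the coproduct of a. This is what makes the action \<triangleright> associative.\<close>

lemma E_lact_E:
  assumes [simp]: "m \<in> carrier M" "a \<in> carrier H"
  shows "E (a \<rightharpoonup> E m) = E (a \<rightharpoonup> m)"
proof -
  have "E (a \<rightharpoonup> E m) = \<Delta>_sum M (\<lambda>x y. E (E (x \<rightharpoonup> m) \<leftharpoonup> y)) a"
    unfolding lact_E[OF assms, symmetric] by (rule linear_tensor_lift) (simp_all add: multilinear_iffs)
  also have "\<dots> = \<Delta>_sum M (\<lambda>x y. \<epsilon> y \<odot>\<^bsub>M\<^esub> E (x \<rightharpoonup> m)) a"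
    by (intro tensor_lift_cong refl) (simp add: E_ract E_E)
  also have "\<dots> = E (a \<rightharpoonup> m)"
    by (rule counit_right_sum) simp_all
  finally show ?thesis .
qed

text \<open>The left side is n \<otimes> b \<otimes> c \<mapsto> n \<beta> S(b) \<alpha> c applied
  to \<phi> (\<rho> \<otimes> id)(\<rho>(m)). After coassociativity, \<phi> acts from the right:
  S(u) \<alpha> v collapses the coproduct of m1, and X \<beta> S(Y) \<alpha> Z = 1 removes
  \<phi>.\<close>

lemma E_ract_sum:
  assumes m [simp]: "m \<in> carrier M"
  shows "\<rho>_sum M (\<lambda>m0 m1. E m0 \<leftharpoonup> m1) m = m"
proof -
  let ?f = "\<lambda>n b c. n \<leftharpoonup> \<beta> \<bullet> (S b \<bullet> (\<alpha> \<bullet> c))"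
  have f: "?f \<in> trilinear_maps R M H H M" by (simp add: multilinear_iffs)
  have 1: "\<Delta>_sum M (\<lambda>u v. ?f (m0 \<leftharpoonup> X) (u \<bullet> Y) (v \<bullet> Z)) m1
      = \<epsilon> m1 \<odot>\<^bsub>M\<^esub> (m0 \<leftharpoonup> X \<bullet> (\<beta> \<bullet> (S Y \<bullet> (\<alpha> \<bullet> Z))))"
    if [simp]: "m0 \<in> carrier M" "m1 \<in> carrier H" "X \<in> carrier H" "Y \<in> carrier H" "Z \<in> carrier H" for m0 m1 X Y Z
    using antipode_alpha_sum[of M "\<lambda>w. m0 \<leftharpoonup> X \<bullet> (\<beta> \<bullet> (S Y \<bullet> (w \<bullet> Z)))" m1]
    by (simp add: mult_simps)
  have 2: "\<phi>_sum M (\<lambda>X Y Z. \<epsilon> m1 \<odot>\<^bsub>M\<^esub> (m0 \<leftharpoonup> X \<bullet> (\<beta> \<bullet> (S Y \<bullet> (\<alpha> \<bullet> Z))))) = \<epsilon> m1 \<odot>\<^bsub>M\<^esub> m0"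
    if [simp]: "m0 \<in> carrier M" "m1 \<in> carrier H" for m0 m1
    using antipode_reassoc_sum[of M "\<lambda>w. \<epsilon> m1 \<odot>\<^bsub>M\<^esub> (m0 \<leftharpoonup> w)"] by simp
  have "\<rho>_sum M (\<lambda>m0 m1. E m0 \<leftharpoonup> m1) m
      = \<rho>_sum M (\<lambda>m0 m1. \<phi>_sum M (\<lambda>X Y Z. \<rho>_sum M (\<lambda>n0 n1. ?f (X \<rightharpoonup> n0) (Y \<bullet> n1) (Z \<bullet> m1)) m0)) m"
    by (intro tensor_lift_cong refl) (simp add: E_eq ract_sum ract_sum3 multilinear_iffs, simp add: mult_simps)
  also have "\<dots> = \<phi>_sum M (\<lambda>X Y Z. \<rho>_sum M (\<lambda>m0 m1. \<rho>_sum M (\<lambda>n0 n1. ?f (X \<rightharpoonup> n0) (Y \<bullet> n1) (Z \<bullet> m1)) m0) m)"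
    by (rule tensor_lift3_swap[symmetric]) (simp_all add: multilinear_iffs)
  also have "\<dots> = \<rho>_sum M (\<lambda>m0 m1. \<Delta>_sum M (\<lambda>u v. \<phi>_sum M (\<lambda>X Y Z. ?f (m0 \<leftharpoonup> X) (u \<bullet> Y) (v \<bullet> Z))) m1) m"
    by (rule coact_coassoc_sum[OF _ f]) simp_all
  also have "\<dots> = \<rho>_sum M (\<lambda>m0 m1. \<phi>_sum M (\<lambda>X Y Z. \<Delta>_sum M (\<lambda>u v. ?f (m0 \<leftharpoonup> X) (u \<bullet> Y) (v \<bullet> Z)) m1)) m"
    by (intro tensor_lift_cong refl tensor_lift3_swap[symmetric]) (simp_all add: multilinear_iffs)
  also have "\<dots> = \<rho>_sum M (\<lambda>m0 m1. \<epsilon> m1 \<odot>\<^bsub>M\<^esub> m0) m"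
    by (intro tensor_lift_cong refl) (simp only: 1 2 cong: tensor_lift3_cong)
  also have "\<dots> = m" by (rule M.coact_counit[OF m])
  finally show ?thesis .
qed


text \<open>The identity E(n0) \<otimes> n1 = n \<otimes> 1 for n = E(m), seen through f. Three
  reductions bring the left side to the expression treated by
  \<open>reassoc_coinvariance_sum\<close>, with a \<otimes> b \<mapsto> f(E(a m), b) as its test
  map.\<close>

lemma coact_E:
  assumes U [simp]: "module R U" and f: "f \<in> bilinear_maps R M H U" and m [simp]: "m \<in> carrier M"
  shows "\<rho>_sum U (\<lambda>n0 n1. f (E n0) n1) (E m) = f (E m) \<one>\<^sub>H"
proof -
  note [simp] = f bilinear_mapsD[OF f] bilinear_maps_compose_linear[OF f]
  let ?F = "\<lambda>n b. f (E n) b"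
  let ?w = "\<lambda>c Y Z. \<beta> \<bullet> (S c \<bullet> (S Y \<bullet> (\<alpha> \<bullet> Z)))"
  let ?K = "\<lambda>X1 X2 Y Z n b c. f (E (X1 \<rightharpoonup> n)) (X2 \<bullet> (b \<bullet> ?w c Y Z))"
  \<comment> \<open>Of the coproduct of w, the first leg is absorbed by \<open>E\<close> as a
    counit, so w survives whole on the second leg.\<close>
  have 1: "\<rho>_sum U ?F (X \<rightharpoonup> m0 \<leftharpoonup> w) = \<Delta>_sum U (\<lambda>X1 X2. \<rho>_sum U (\<lambda>n0 n1. f (E (X1 \<rightharpoonup> n0)) (X2 \<bullet> (n1 \<bullet> w))) m0) X"
    if [simp]: "X \<in> carrier H" "m0 \<in> carrier M" "w \<in> carrier H" for X m0 w
  proof -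
    have "\<rho>_sum U ?F (X \<rightharpoonup> m0 \<leftharpoonup> w) = \<rho>_sum U (\<lambda>n0 n1. \<Delta>_sum U (\<lambda>x y. f (E (n0 \<leftharpoonup> x)) (n1 \<bullet> y)) w) (X \<rightharpoonup> m0)"
      by (rule coact_ract_sum) (simp_all add: multilinear_iffs)
    also have "\<dots> = \<rho>_sum U (\<lambda>n0 n1. \<Delta>_sum U (\<lambda>x y. \<epsilon> x \<odot>\<^bsub>U\<^esub> f (E n0) (n1 \<bullet> y)) w) (X \<rightharpoonup> m0)"
      by (intro tensor_lift_cong refl) (simp add: E_ract linear_maps_smult[OF bilinear_mapsD(2)[OF f]])
    also have "\<dots> = \<rho>_sum U (\<lambda>n0 n1. f (E n0) (n1 \<bullet> w)) (X \<rightharpoonup> m0)"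
      by (intro tensor_lift_cong refl counit_left_sum) simp_all
    also have "\<dots> = \<Delta>_sum U (\<lambda>X1 X2. \<rho>_sum U (\<lambda>n0 n1. f (E (X1 \<rightharpoonup> n0)) (X2 \<bullet> n1 \<bullet> w)) m0) X"
      by (rule coact_lact_sum) (simp_all add: multilinear_iffs)
    finally show ?thesis by (simp add: hassoc)
  qed
  \<comment> \<open>The copy of \<phi> acting from the right has its first leg under
    \<open>E\<close>; this puts a counit on that leg and removes the copy.\<close>
  have 2: "\<phi>_sum U (\<lambda>X' Y' Z'. ?K X1 X2 Y Z (x \<rightharpoonup> (m0 \<leftharpoonup> X')) (y \<bullet> (u \<bullet> Y')) (z \<bullet> (v \<bullet> Z')))
      = f (E (X1 \<bullet> x \<rightharpoonup> m0)) (X2 \<bullet> (y \<bullet> (u \<bullet> ?w (z \<bullet> v) Y Z)))"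
    if [simp]: "X1 \<in> carrier H" "X2 \<in> carrier H" "Y \<in> carrier H" "Z \<in> carrier H" "x \<in> carrier H" "y \<in> carrier H"
      "z \<in> carrier H" "u \<in> carrier H" "v \<in> carrier H" "m0 \<in> carrier M" for X1 X2 Y Z x y z u v m0
  proof -
    have "\<phi>_sum U (\<lambda>X' Y' Z'. ?K X1 X2 Y Z (x \<rightharpoonup> (m0 \<leftharpoonup> X')) (y \<bullet> (u \<bullet> Y')) (z \<bullet> (v \<bullet> Z')))
        = \<phi>_sum U (\<lambda>X' Y' Z'. \<epsilon> X' \<odot>\<^bsub>U\<^esub> f (E (X1 \<bullet> x \<rightharpoonup> m0)) (X2 \<bullet> (y \<bullet> (u \<bullet> (Y' \<bullet> ?w (z \<bullet> (v \<bullet> Z')) Y Z)))))"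
      by (intro tensor_lift3_cong refl)
        (simp add: E_ract M.lact_ract[symmetric] M.lact_mult hassoc linear_maps_smult[OF bilinear_mapsD(2)[OF f]])
    also have "\<dots> = f (E (X1 \<bullet> x \<rightharpoonup> m0)) (X2 \<bullet> (y \<bullet> (u \<bullet> (\<one>\<^sub>H \<bullet> ?w (z \<bullet> (v \<bullet> \<one>\<^sub>H)) Y Z))))"
      by (rule counit_reassoc_first_sum) (simp_all add: multilinear_iffs)
    finally show ?thesis by simp
  qed
  \<comment> \<open>The two legs of the coproduct of m1 now meet as u \<beta> S(v), leaving only
    \<epsilon>(m1), which the counit axiom for \<rho> removes.\<close>
  have 3: "\<Delta>_sum U (\<lambda>u v. f (E (X1 \<bullet> x \<rightharpoonup> m0)) (X2 \<bullet> (y \<bullet> (u \<bullet> ?w (z \<bullet> v) Y Z)))) m1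
      = \<epsilon> m1 \<odot>\<^bsub>U\<^esub> f (E (X1 \<bullet> x \<rightharpoonup> m0)) (X2 \<bullet> (y \<bullet> ?w z Y Z))"
    if [simp]: "X1 \<in> carrier H" "X2 \<in> carrier H" "Y \<in> carrier H" "Z \<in> carrier H" "x \<in> carrier H" "y \<in> carrier H"
      "z \<in> carrier H" "m0 \<in> carrier M" "m1 \<in> carrier H" for X1 X2 Y Z x y z m0 m1
    using antipode_beta_sum[of U "\<lambda>t. f (E (X1 \<bullet> x \<rightharpoonup> m0)) (X2 \<bullet> (y \<bullet> (t \<bullet> (S z \<bullet> (S Y \<bullet> (\<alpha> \<bullet> Z))))))" m1]
    by (simp add: hassoc antipode_mult)
  have "\<rho>_sum U ?F (E m) = \<phi>_sum U (\<lambda>X Y Z. \<rho>_sum U ?F (\<rho>_sum M (\<lambda>m0 m1. X \<rightharpoonup> m0 \<leftharpoonup> ?w m1 Y Z) m))"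
    unfolding E_eq[OF m]
    by (rule linear_tensor_lift3[where h = "\<lambda>t. \<rho>_sum U ?F t"]) (simp_all add: multilinear_iffs)
  also have "\<dots> = \<phi>_sum U (\<lambda>X Y Z. \<rho>_sum U (\<lambda>m0 m1. \<rho>_sum U ?F (X \<rightharpoonup> m0 \<leftharpoonup> ?w m1 Y Z)) m)"
    by (intro tensor_lift3_cong refl linear_tensor_lift[where h = "\<lambda>t. \<rho>_sum U ?F t"]) (simp_all add: multilinear_iffs)
  also have "\<dots> = \<phi>_sum U (\<lambda>X Y Z. \<rho>_sum U (\<lambda>m0 m1. \<Delta>_sum U (\<lambda>X1 X2. \<rho>_sum U (\<lambda>n0 n1. ?K X1 X2 Y Z n0 n1 m1) m0) X) m)"
    by (intro tensor_lift3_cong tensor_lift_cong refl 1) simp_all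
  also have "\<dots> = \<phi>_sum U (\<lambda>X Y Z. \<Delta>_sum U (\<lambda>X1 X2. \<rho>_sum U (\<lambda>m0 m1. \<rho>_sum U (\<lambda>n0 n1. ?K X1 X2 Y Z n0 n1 m1) m0) m) X)"
    by (intro tensor_lift3_cong refl tensor_lift_swap) (simp_all add: multilinear_iffs)
  also have "\<dots> = \<phi>_sum U (\<lambda>X Y Z. \<Delta>_sum U (\<lambda>X1 X2. \<phi>inv_sum U (\<lambda>x y z. \<rho>_sum U (\<lambda>m0 m1. \<Delta>_sum U (\<lambda>u v. \<phi>_sum U (\<lambda>X' Y' Z'.
        ?K X1 X2 Y Z (x \<rightharpoonup> (m0 \<leftharpoonup> X')) (y \<bullet> (u \<bullet> Y')) (z \<bullet> (v \<bullet> Z')))) m1) m)) X)"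
    by (intro tensor_lift3_cong tensor_lift_cong refl coact_coassoc_inv_sum) (simp_all add: multilinear_iffs)
  also have "\<dots> = \<phi>_sum U (\<lambda>X Y Z. \<Delta>_sum U (\<lambda>X1 X2. \<phi>inv_sum U (\<lambda>x y z. \<rho>_sum U (\<lambda>m0 m1.
        \<epsilon> m1 \<odot>\<^bsub>U\<^esub> f (E (X1 \<bullet> x \<rightharpoonup> m0)) (X2 \<bullet> (y \<bullet> ?w z Y Z))) m)) X)"
    by (intro tensor_lift3_cong tensor_lift_cong refl) (simp only: 2 3 cong: tensor_lift_cong)
  also have "\<dots> = \<phi>_sum U (\<lambda>X Y Z. \<Delta>_sum U (\<lambda>X1 X2. \<phi>inv_sum U (\<lambda>x y z.
        f (E (X1 \<bullet> x \<rightharpoonup> m)) (X2 \<bullet> (y \<bullet> ?w z Y Z)))) X)"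
    by (intro tensor_lift3_cong tensor_lift_cong refl coact_counit_sum) simp_all
  also have "\<dots> = f (E (\<one>\<^sub>H \<rightharpoonup> m)) \<one>\<^sub>H"
    by (rule reassoc_coinvariance_sum[where f = "\<lambda>a b. f (E (a \<rightharpoonup> m)) b"]) (simp_all add: multilinear_iffs)
  finally show ?thesis by simp
qed

text \<open>Substitute n0 = E(p) q, where p \<otimes> q is \<rho>(n0), and rewrite the iterated
  coaction by coassociativity. The copy of \<phi> on the right is absorbed by \<open>E\<close>. The
  sum over \<rho>(n) then occurs only through E(m0) \<otimes> m1, which is n \<otimes> 1 by
  \<open>coact_E\<close>, leaving \<phi>^-1.\<close>

lemma coact_coinvariant:
  assumes U [simp]: "module R U" and f: "f \<in> bilinear_maps R M H U" and n [simp]: "n \<in> carrier M" and En: "E n = n"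
  shows "\<rho>_sum U f n = \<phi>inv_sum U (\<lambda>x y z. f (E (x \<rightharpoonup> n) \<leftharpoonup> y) z)"
proof -
  note [simp] = f bilinear_mapsD[OF f] bilinear_maps_compose_linear[OF f]
  let ?G = "\<lambda>x y z a b. \<Delta>_sum U (\<lambda>u v. f (E (x \<rightharpoonup> a) \<leftharpoonup> y \<bullet> u) (z \<bullet> v)) b"
  have 1: "\<phi>_sum U (\<lambda>X Y Z. f (E (x \<rightharpoonup> (m0 \<leftharpoonup> X)) \<leftharpoonup> y \<bullet> (u \<bullet> Y)) (z \<bullet> (v \<bullet> Z)))
      = f (E (x \<rightharpoonup> E m0) \<leftharpoonup> y \<bullet> u) (z \<bullet> v)"
    if [simp]: "x \<in> carrier H" "y \<in> carrier H" "z \<in> carrier H" "u \<in> carrier H" "v \<in> carrier H" "m0 \<in> carrier M"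
    for x y z u v m0
  proof -
    have "\<phi>_sum U (\<lambda>X Y Z. f (E (x \<rightharpoonup> (m0 \<leftharpoonup> X)) \<leftharpoonup> y \<bullet> (u \<bullet> Y)) (z \<bullet> (v \<bullet> Z)))
        = \<phi>_sum U (\<lambda>X Y Z. \<epsilon> X \<odot>\<^bsub>U\<^esub> f (E (x \<rightharpoonup> m0) \<leftharpoonup> y \<bullet> (u \<bullet> Y)) (z \<bullet> (v \<bullet> Z)))"
      by (intro tensor_lift3_cong refl)
        (simp add: E_ract M.lact_ract[symmetric] linear_maps_smult[OF bilinear_mapsD(2)[OF f]]
          linear_maps_smult[OF bilinear_mapsD(2)[OF ract_bilinear]])
    also have "\<dots> = f (E (x \<rightharpoonup> m0) \<leftharpoonup> y \<bullet> (u \<bullet> \<one>\<^sub>H)) (z \<bullet> (v \<bullet> \<one>\<^sub>H))"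
      by (rule counit_reassoc_first_sum) (simp_all add: multilinear_iffs)
    \<comment> \<open>The inner \<open>E\<close> is inserted on purpose: \<open>coact_E\<close>
      applies only to sums that depend on E(m0).\<close>
    finally show ?thesis by (simp add: E_lact_E)
  qed
  have "\<rho>_sum U f n = \<rho>_sum U (\<lambda>n0 n1. f (\<rho>_sum M (\<lambda>p q. E p \<leftharpoonup> q) n0) n1) n"
    by (intro tensor_lift_cong refl) (simp add: E_ract_sum)
  also have "\<dots> = \<rho>_sum U (\<lambda>n0 n1. \<rho>_sum U (\<lambda>p q. f (E p \<leftharpoonup> q) n1) n0) n"
    by (intro tensor_lift_cong refl linear_tensor_lift[where h = "\<lambda>t. f t z" for z]) (simp_all add: multilinear_iffs)
  also have "\<dots> = \<phi>inv_sum U (\<lambda>x y z. \<rho>_sum U (\<lambda>m0 m1. \<Delta>_sum U (\<lambda>u v. \<phi>_sum U (\<lambda>X Y Z.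
        f (E (x \<rightharpoonup> (m0 \<leftharpoonup> X)) \<leftharpoonup> y \<bullet> (u \<bullet> Y)) (z \<bullet> (v \<bullet> Z)))) m1) n)"
    by (rule coact_coassoc_inv_sum) (simp_all add: multilinear_iffs)
  also have "\<dots> = \<phi>inv_sum U (\<lambda>x y z. \<rho>_sum U (\<lambda>m0 m1. ?G x y z (E m0) m1) n)"
    by (intro tensor_lift3_cong tensor_lift_cong refl 1)
  also have "\<dots> = \<phi>inv_sum U (\<lambda>x y z. ?G x y z n \<one>\<^sub>H)"
    by (intro tensor_lift3_cong refl coact_E[where m = n, unfolded En]) (simp_all add: multilinear_iffs)
  also have "\<dots> = \<phi>inv_sum U (\<lambda>x y z. f (E (x \<rightharpoonup> n) \<leftharpoonup> y) z)"
    by (intro tensor_lift3_cong refl) (simp add: comult_one multilinear_iffs)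
  finally show ?thesis .
qed

end


section \<open>Transport of structure and the isomorphism\<close>

context quasi_hopf_bimodule_over
begin

text \<open>Each axiom of M' is checked after applying \<nu>, or its tensor products with identities
  on H, where it becomes the axiom of M. The inverse \<mu> makes these maps injective; closure of
  the operations of M' has to be assumed, since injectivity is known only on carriers.\<close>

lemma quasi_hopf_bimodule_transport:
  fixes M' :: "('k, 'h, 'n, 'd) quasi_hopf_bimodule_scheme"
  assumes M' [simp]: "module R M'"
    and nu [simp]: "\<nu> \<in> linear_maps R M' M" and mu [simp]: "\<mu> \<in> linear_maps R M M'"
    and mu_nu: "\<And>t. t \<in> carrier M' \<Longrightarrow> \<mu> (\<nu> t) = t"
    and nu_mu: "\<And>m. m \<in> carrier M \<Longrightarrow> \<nu> (\<mu> m) = m"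
    and lact_closed: "\<And>a t. a \<in> carrier H \<Longrightarrow> t \<in> carrier M' \<Longrightarrow> lact M' a t \<in> carrier M'"
    and lact: "\<And>a t. a \<in> carrier H \<Longrightarrow> t \<in> carrier M' \<Longrightarrow> \<nu> (lact M' a t) = a \<rightharpoonup> \<nu> t"
    and ract_closed: "\<And>a t. a \<in> carrier H \<Longrightarrow> t \<in> carrier M' \<Longrightarrow> ract M' t a \<in> carrier M'"
    and ract: "\<And>a t. a \<in> carrier H \<Longrightarrow> t \<in> carrier M' \<Longrightarrow> \<nu> (ract M' t a) = \<nu> t \<leftharpoonup> a"
    and coact_closed: "\<And>t. t \<in> carrier M' \<Longrightarrow> coact M' t \<in> carrier (tensor R M' H)"
    and coact: "\<And>t. t \<in> carrier M' \<Longrightarrow> tensor_map R M' H M H \<nu> id (coact M' t) = coact M (\<nu> t)"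
  shows "quasi_hopf_bimodule R H M'" "\<nu> \<in> quasi_hopf_bimodule_iso R H M' M"
proof -
  interpret M': module R M' by fact
  note nc [simp] = linear_maps_closed[OF nu] and mc [simp] = linear_maps_closed[OF mu]
  note clos [simp] = lact_closed ract_closed coact_closed
  note nu_simps = linear_maps_add[OF nu] linear_maps_smult[OF nu] lact ract
  have inj: "s = t" if "\<nu> s = \<nu> t" "s \<in> carrier M'" "t \<in> carrier M'" for s t
    using that mu_nu by metis
  have lact_lin: "lact M' a \<in> linear_maps R M' M'" if "a \<in> carrier H" for a
    by (rule linear_mapsI; (rule inj)?)
      (use that in \<open>simp_all add: nu_simps linear_maps_add[OF bilinear_mapsD(1)[OF lact_bilinear]]
        linear_maps_smult[OF bilinear_mapsD(1)[OF lact_bilinear]]\<close>)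
  have ract_lin: "(\<lambda>t. ract M' t a) \<in> linear_maps R M' M'" if "a \<in> carrier H" for a
    by (rule linear_mapsI; (rule inj)?)
      (use that in \<open>simp_all add: nu_simps linear_maps_add[OF bilinear_mapsD(2)[OF ract_bilinear]]
        linear_maps_smult[OF bilinear_mapsD(2)[OF ract_bilinear]]\<close>)
  interpret H: module R H by simp
  have left: "left_module R H M'"
    by (intro left_module.intro left_module_axioms.intro M' lact_lin; (rule inj)?)
      (simp_all add: nu_simps M.lact_add M.lact_smult M.lact_mult)
  have bimod: "bimodule R H M'"
    by (intro bimodule.intro bimodule_axioms.intro left ract_lin; (rule inj)?)
      (simp_all add: nu_simps M.ract_add M.ract_smult M.ract_mult M.lact_ract)
  interpret B: bimodule R H M' by (rule bimod)
  have lactB: "lact M' \<in> bilinear_maps R H M' M'"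
    by (intro bilinear_mapsI linear_mapsI)
      (simp_all add: B.lact_add B.lact_smult linear_maps_add[OF lact_lin] linear_maps_smult[OF lact_lin])
  have ractB: "ract M' \<in> bilinear_maps R M' H M'"
    by (intro bilinear_mapsI linear_mapsI)
      (simp_all add: B.ract_add B.ract_smult linear_maps_add[OF ract_lin] linear_maps_smult[OF ract_lin])
  \<comment> \<open>The maps \<nu> \<otimes> id and \<nu> \<otimes> id \<otimes> id, with their left
    inverses built from \<mu>, serve for the axioms whose values lie in M' \<otimes> H and M'
    \<otimes> H \<otimes> H.\<close>
  let ?\<nu>2 = "tensor_map R M' H M H \<nu> id" and ?\<mu>2 = "tensor_map R M H M' H \<mu> id"
  let ?\<nu>3 = "tensor_map R (tensor R M' H) H (tensor R M H) H ?\<nu>2 id"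
  let ?\<mu>3 = "tensor_map R (tensor R M H) H (tensor R M' H) H ?\<mu>2 id"
  have nu2 [simp]: "?\<nu>2 \<in> linear_maps R (tensor R M' H) (tensor R M H)"
    and mu2 [simp]: "?\<mu>2 \<in> linear_maps R (tensor R M H) (tensor R M' H)"
    by (simp_all add: tensor_map_linear)
  note nu2c [simp] = linear_maps_closed[OF nu2] and mu2c [simp] = linear_maps_closed[OF mu2]
  have nu3 [simp]: "?\<nu>3 \<in> linear_maps R (tensor3 R M' H H) (tensor3 R M H H)"
    by (simp add: tensor_map_linear)
  note nu3c [simp] = linear_maps_closed[OF nu3]
  note [simp] = nu2[unfolded id_def] nu3[unfolded id_def] nu2c[unfolded id_def] nu3c[unfolded id_def]
    linear_maps_compose[OF _ nu2[unfolded id_def]] linear_maps_compose[OF _ nu3[unfolded id_def]]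
  have mu_nu2: "?\<mu>2 (?\<nu>2 t) = t" if "t \<in> carrier (tensor R M' H)" for t
  proof -
    have "?\<mu>2 (?\<nu>2 t) = tensor_map R M' H M' H (\<lambda>x. \<mu> (\<nu> x)) (\<lambda>x. id (id x)) t"
      by (rule tensor_map_tensor_map) (simp_all add: that)
    also have "\<dots> = tensor_map R M' H M' H (\<lambda>x. x) (\<lambda>x. x) t"
      by (rule tensor_map_cong) (simp_all add: mu_nu)
    finally show ?thesis using that by (simp add: tensor_map_id)
  qed
  have mu_nu3: "?\<mu>3 (?\<nu>3 t) = t" if "t \<in> carrier (tensor3 R M' H H)" for t
  proof -
    have "?\<mu>3 (?\<nu>3 t) = tensor_map R (tensor R M' H) H (tensor R M' H) H (\<lambda>x. ?\<mu>2 (?\<nu>2 x)) (\<lambda>x. id (id x)) t"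
      by (rule tensor_map_tensor_map) (simp_all add: that)
    also have "\<dots> = tensor_map R (tensor R M' H) H (tensor R M' H) H (\<lambda>x. x) (\<lambda>x. x) t"
      by (rule tensor_map_cong) (simp_all add: mu_nu2)
    finally show ?thesis using that by (simp add: tensor_map_id)
  qed
  have inj2: "s = t" if "?\<nu>2 s = ?\<nu>2 t" "s \<in> carrier (tensor R M' H)" "t \<in> carrier (tensor R M' H)" for s t
    using that mu_nu2 by metis
  have inj3: "s = t" if "?\<nu>3 s = ?\<nu>3 t" "s \<in> carrier (tensor3 R M' H H)" "t \<in> carrier (tensor3 R M' H H)" for s t
    using that mu_nu3 by metis
  \<comment> \<open>The coaction of M' is given only through its image under \<nu> \<otimes> id.
    Solving for it writes it as a composite of linear maps, which proves its linearity.\<close>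
  have coact_mu: "coact M' t = ?\<mu>2 (coact M (\<nu> t))" if "t \<in> carrier M'" for t
    using mu_nu2[of "coact M' t"] coact[OF that] that by simp
  have coact_lin [simp]: "coact M' \<in> linear_maps R M' (tensor R M' H)"
  proof -
    have "(\<lambda>t. ?\<mu>2 (coact M (\<nu> t))) \<in> linear_maps R M' (tensor R M' H)"
      by (intro linear_maps_compose[OF _ mu2]) simp
    then show ?thesis unfolding linear_maps_def by (simp add: coact_mu Pi_iff)
  qed
  have id2: "tensor_map R V W V W id id t = t" if "module R V" "module R W" "t \<in> carrier (tensor R V W)"
    for V :: "('k, 'v, 'e) module_scheme" and W :: "('k, 'w, 'f) module_scheme" and t
    using tensor_map_id[OF that] by (simp add: id_def)
  have lact2B: "lact2 R H M' \<in> bilinear_maps R HH (tensor R M' H) (tensor R M' H)"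
    and lact2M: "lact2 R H M \<in> bilinear_maps R HH (tensor R M H) (tensor R M H)"
    unfolding lact2_def by (intro tensor_op_bilinear; simp add: lactB)+
  have ract2B: "ract2 R H M' \<in> bilinear_maps R (tensor R M' H) HH (tensor R M' H)"
    and ract2M: "ract2 R H M \<in> bilinear_maps R (tensor R M H) HH (tensor R M H)"
    unfolding ract2_def by (intro tensor_op_bilinear; simp add: ractB)+
  have lact3B: "lact3 R H M' \<in> bilinear_maps R HHH (tensor3 R M' H H) (tensor3 R M' H H)"
    unfolding lact3_def by (intro tensor_op_bilinear lact2B; simp)
  have ract3B: "ract3 R H M' \<in> bilinear_maps R (tensor3 R M' H H) HHH (tensor3 R M' H H)"
    unfolding ract3_def by (intro tensor_op_bilinear ract2B; simp)
  note Bc [simp] = bilinear_mapsD(3)[OF lact2B] bilinear_mapsD(3)[OF ract2B] bilinear_mapsD(3)[OF lact3B] bilinear_mapsD(3)[OF ract3B]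
  have L2: "?\<nu>2 (lact2 R H M' s t) = lact2 R H M s (?\<nu>2 t)"
    if "s \<in> carrier HH" "t \<in> carrier (tensor R M' H)" for s t
    unfolding lact2_def
    by (subst tensor_map_tensor_op[where a = id and b = id and v = \<nu> and w = id and f' = la and A' = H and B' = H and V' = M and W' = H and g' = hmult])
      (simp_all add: lactB that lact id2)
  have R2: "?\<nu>2 (ract2 R H M' t s) = ract2 R H M (?\<nu>2 t) s"
    if "s \<in> carrier HH" "t \<in> carrier (tensor R M' H)" for s t
    unfolding ract2_def
    by (subst tensor_map_tensor_op[where a = \<nu> and b = id and v = id and w = id and f' = ra and A' = M and B' = H and V' = H and W' = H and g' = hmult])
      (simp_all add: ractB that ract id2)
  have L3: "?\<nu>3 (lact3 R H M' s t) = lact3 R H M s (?\<nu>3 t)"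
    if "s \<in> carrier HHH" "t \<in> carrier (tensor3 R M' H H)" for s t
    unfolding lact3_def
    by (subst tensor_map_tensor_op[where a = id and b = id and v = ?\<nu>2 and w = id and f' = "lact2 R H M"
        and A' = HH and B' = H and V' = "tensor R M H" and W' = H and g' = hmult])
      (simp_all add: lact2B lact2M that L2 id2)
  have R3: "?\<nu>3 (ract3 R H M' t s) = ract3 R H M (?\<nu>3 t) s"
    if "s \<in> carrier HHH" "t \<in> carrier (tensor3 R M' H H)" for s t
    unfolding ract3_def
    by (subst tensor_map_tensor_op[where a = ?\<nu>2 and b = id and v = id and w = id and f' = "ract2 R H M"
        and A' = "tensor R M H" and B' = H and V' = HH and W' = H and g' = hmult])
      (simp_all add: ract2B ract2M that R2 id2)
  \<comment> \<open>Naturality of reassociation. The second factor s is a tensor in its own right,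
    so it is decomposed first; the next fact then decomposes w and uses this one at a
    coproduct.\<close>
  have assoc1: "?\<nu>3 (tensor_assoc R M' H H (pure_tensor R M' HH n s)) = tensor_assoc R M H H (pure_tensor R M HH (\<nu> n) s)"
    if "n \<in> carrier M'" "s \<in> carrier HH" for n s
    by (rule tensor_linear_maps_eqI[where U = "tensor3 R M H H", OF _ _ _ _ _ _ that(2)])
      (simp_all add: that linear_maps_compose[OF _ tensor_assoc_linear]
        tensor_assoc_pure tensor_map_pure)
  have assoc: "?\<nu>3 (tensor_assoc R M' H H (tensor_map R M' H M' HH id (comult H) w))
      = tensor_assoc R M H H (tensor_map R M H M HH id (comult H) (?\<nu>2 w))"
    if "w \<in> carrier (tensor R M' H)" for w
    by (rule tensor_linear_maps_eqI[where U = "tensor3 R M H H", OF _ _ _ _ _ _ that])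
      (simp_all add: linear_maps_compose[OF _ tensor_assoc_linear]
        linear_maps_compose[OF _ tensor_map_linear] linear_maps_compose[OF nu2] tensor_map_linear tensor_map_pure assoc1[unfolded id_def])
  have coact_coact: "?\<nu>3 (tensor_map R M' H (tensor R M' H) H (coact M') id (coact M' t))
      = tensor_map R M H (tensor R M H) H (coact M) id (coact M (\<nu> t))" if t: "t \<in> carrier M'" for t
  proof -
    have "?\<nu>3 (tensor_map R M' H (tensor R M' H) H (coact M') id (coact M' t))
        = tensor_map R M' H (tensor R M H) H (\<lambda>x. ?\<nu>2 (coact M' x)) (\<lambda>x. id (id x)) (coact M' t)"
      by (rule tensor_map_tensor_map) (simp_all add: t)
    also have "\<dots> = tensor_map R M' H (tensor R M H) H (\<lambda>x. coact M (\<nu> x)) (\<lambda>x. id (id x)) (coact M' t)"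
      by (rule tensor_map_cong) (simp_all add: coact)
    also have "\<dots> = tensor_map R M H (tensor R M H) H (coact M) id (?\<nu>2 (coact M' t))"
      by (rule tensor_map_tensor_map[symmetric]) (simp_all add: t)
    finally show ?thesis by (simp add: coact t)
  qed
  have map_closed [simp]: "tensor_map R M' H (tensor R M' H) H (coact M') id (coact M' t) \<in> carrier (tensor3 R M' H H)"
    "tensor_assoc R M' H H (tensor_map R M' H M' HH id (comult H) (coact M' t)) \<in> carrier (tensor3 R M' H H)"
    if "t \<in> carrier M'" for t
    using that by (simp_all add: linear_maps_closed[OF tensor_map_linear] linear_maps_closed[OF tensor_assoc_linear])
  show "quasi_hopf_bimodule R H M'"
  proof (intro quasi_hopf_bimodule.intro quasi_hopf_bimodule_axioms.intro bimod coact_lin)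
    fix a t assume t [simp]: "t \<in> carrier M'"
    show "tensor_lift R M' H M' (\<lambda>n x. \<epsilon> x \<odot>\<^bsub>M'\<^esub> n) (coact M' t) = t"
    proof (rule inj)
      have "\<nu> (tensor_lift R M' H M' (\<lambda>n x. \<epsilon> x \<odot>\<^bsub>M'\<^esub> n) (coact M' t))
          = tensor_lift R M' H M (\<lambda>n x. \<nu> (\<epsilon> x \<odot>\<^bsub>M'\<^esub> n)) (coact M' t)"
        by (rule linear_tensor_lift) (simp_all add: bilinear_maps_iff)
      also have "\<dots> = tensor_lift R M' H M (\<lambda>n x. \<epsilon> (id x) \<odot>\<^bsub>M\<^esub> \<nu> n) (coact M' t)"
        by (intro tensor_lift_cong refl) (simp add: linear_maps_smult[OF nu])
      also have "\<dots> = tensor_lift R M H M (\<lambda>n x. \<epsilon> x \<odot>\<^bsub>M\<^esub> n) (?\<nu>2 (coact M' t))"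
        by (rule tensor_lift_tensor_map[symmetric]) (simp_all add: bilinear_maps_iff)
      finally show "\<nu> (tensor_lift R M' H M' (\<lambda>n x. \<epsilon> x \<odot>\<^bsub>M'\<^esub> n) (coact M' t)) = \<nu> t"
        by (simp add: coact M.coact_counit)
    qed (simp_all add: bilinear_maps_iff)
    show "lact3 R H M' \<phi> (tensor_map R M' H (tensor R M' H) H (coact M') id (coact M' t))
        = ract3 R H M' (tensor_assoc R M' H H (tensor_map R M' H M' HH id (comult H) (coact M' t))) \<phi>"
      by (rule inj3) (simp_all add: L3 R3 assoc coact coact_coact M.coact_coassoc)
    assume a [simp]: "a \<in> carrier H"
    show "coact M' (lact M' a t) = lact2 R H M' (comult H a) (coact M' t)"
      by (rule inj2) (simp_all add: L2 coact lact M.coact_lact)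
    show "coact M' (ract M' t a) = ract2 R H M' (coact M' t) (comult H a)"
      by (rule inj2) (simp_all add: R2 coact ract M.coact_ract)
  qed
  have "\<nu> \<in> quasi_hopf_bimodule_hom R H M' M"
    by (simp add: quasi_hopf_bimodule_hom_def lact ract coact)
  moreover have "\<mu> \<in> quasi_hopf_bimodule_hom R H M M'"
  proof -
    have "\<mu> (a \<rightharpoonup> m) = lact M' a (\<mu> m)" "\<mu> (m \<leftharpoonup> a) = ract M' (\<mu> m) a"
      if "a \<in> carrier H" "m \<in> carrier M" for a m
      by (rule inj; simp add: that nu_mu lact ract)+
    moreover have "coact M' (\<mu> m) = ?\<mu>2 (coact M m)" if "m \<in> carrier M" for m
      using that by (simp add: coact_mu nu_mu)
    ultimately show ?thesis by (simp add: quasi_hopf_bimodule_hom_def)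
  qed
  ultimately show "\<nu> \<in> quasi_hopf_bimodule_iso R H M' M"
    unfolding quasi_hopf_bimodule_iso_def using mu_nu nu_mu by blast
qed


section \<open>The coinvariants, the induced bimodule and the two inverse maps\<close>

abbreviation "N \<equiv> coinvariants R H M"
abbreviation "NH \<equiv> induced_bimodule R H N"
abbreviation "T \<equiv> tensor R N H"
abbreviation "\<nu> \<equiv> tensor_lift R N H M (\<lambda>n a. n \<leftharpoonup> a)"
abbreviation "\<mu> \<equiv> (\<lambda>m. tensor_map R M H N H E id (coact M m))"

lemma coinvariants_simps [simp]:
  "zero N = zero M" "add N = add M" "smult N = smult M" "lact N = (\<lambda>a n. E (a \<rightharpoonup> n))"
  by (simp_all add: coinvariants_def)

text \<open>The image of an idempotent map is its set of fixed points.\<close>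

lemma carrier_N [simp]: "n \<in> carrier N \<longleftrightarrow> n \<in> carrier M \<and> E n = n"
  by (auto simp: coinvariants_def E_E image_iff) (metis E_E)

lemma module_N [simp]: "module R N"
  by (rule module_fixed_points[OF module_M E_linear]) (simp_all add: set_eq_iff)

lemma linear_maps_from_N [simp]: "f \<in> linear_maps R M U \<Longrightarrow> f \<in> linear_maps R N U"
  by (simp add: linear_maps_def Pi_iff)

lemma linear_maps_to_N:
  assumes "f \<in> linear_maps R X M" "\<And>x. x \<in> carrier X \<Longrightarrow> E (f x) = f x"
  shows "f \<in> linear_maps R X N"
  using assms by (simp add: linear_maps_def Pi_iff)

lemma E_compose_linear_N [simp]: "f \<in> linear_maps R X M \<Longrightarrow> (\<lambda>x. E (f x)) \<in> linear_maps R X N"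
  by (rule linear_maps_to_N) (simp_all add: E_E linear_maps_closed)

text \<open>The only axiom with content is associativity of \<triangleright>, that is E(a E(b n)) =
  E(a b n).\<close>

lemma left_module_N: "left_module R H N"
proof -
  note L = linear_maps_add[OF bilinear_mapsD(2)[OF lact_bilinear]] linear_maps_smult[OF bilinear_mapsD(2)[OF lact_bilinear]]
  show ?thesis
    by (intro left_module.intro left_module_axioms.intro module_N)
      (simp_all add: L linear_maps_add[OF E_linear] linear_maps_smult[OF E_linear] M.lact_mult E_lact_E)
qed

lemma same_NH: "same_module NH T" "mult NH = mult T" "one NH = one T"
  by (simp_all add: same_module_def induced_bimodule_def)

lemma carrier_NH: "carrier NH = carrier T"
  by (simp add: induced_bimodule_def)

lemma module_NH [simp]: "module R NH"
  by (rule module_same[OF same_NH(1)]) simp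

lemmas NH_same = linear_maps_same[OF same_NH(1)] tensor_lift_same[OF same_NH(1)] tensor_same[OF same_NH] carrier_NH

lemma nu_bilinear [simp]: "(\<lambda>n a. n \<leftharpoonup> a) \<in> bilinear_maps R N H M"
  by (simp add: bilinear_maps_iff)

lemma nu_linear [simp]: "\<nu> \<in> linear_maps R T M"
  by simp

lemma mu_linear [simp]: "\<mu> \<in> linear_maps R M T"
  by (rule linear_maps_compose[OF M.coact_linear tensor_map_linear]) simp_all

lemma nu_mu: "m \<in> carrier M \<Longrightarrow> \<nu> (\<mu> m) = m"
  by (simp add: tensor_lift_tensor_map E_ract_sum)

text \<open>On n \<otimes> a, the coaction of n a is \<rho>(n) \<Delta>(a). The first leg of
  \<Delta>(a) is absorbed by \<open>E\<close>, so the value is E(n0) \<otimes> n1 a, and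
  \<open>coact_E\<close> makes it n \<otimes> a.\<close>

lemma mu_nu:
  assumes "t \<in> carrier T"
  shows "\<mu> (\<nu> t) = t"
proof (rule tensor_linear_maps_eqI[where U = T, OF _ _ _ _ _ _ assms])
  show "(\<lambda>t. \<mu> (\<nu> t)) \<in> linear_maps R T T"
    by (rule linear_maps_compose[OF nu_linear mu_linear])
  fix n a assume n: "n \<in> carrier N" and a [simp]: "a \<in> carrier H"
  have [simp]: "n \<in> carrier M" "E n = n" using n by simp_all
  let ?f = "\<lambda>n b. pure_tensor R N H (E n) (b \<bullet> a)"
  have f: "?f \<in> bilinear_maps R M H T" by (simp add: bilinear_maps_iff E_E)
  have "\<mu> (n \<leftharpoonup> a) = \<rho>_sum T (\<lambda>n0 n1. \<Delta>_sum T (\<lambda>x y. pure_tensor R N H (E (n0 \<leftharpoonup> x)) (n1 \<bullet> y)) a) n"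
    unfolding tensor_map_def id_apply by (rule coact_ract_sum) (simp_all add: bilinear_maps_iff E_E)
  also have "\<dots> = \<rho>_sum T (\<lambda>n0 n1. \<Delta>_sum T (\<lambda>x y. \<epsilon> x \<odot>\<^bsub>T\<^esub> pure_tensor R N H (E n0) (n1 \<bullet> y)) a) n"
  proof (intro tensor_lift_cong refl)
    fix n0 n1 x y assume [simp]: "n0 \<in> carrier M" "n1 \<in> carrier H" "x \<in> carrier H" "y \<in> carrier H"
    show "pure_tensor R N H (E (n0 \<leftharpoonup> x)) (n1 \<bullet> y) = \<epsilon> x \<odot>\<^bsub>T\<^esub> pure_tensor R N H (E n0) (n1 \<bullet> y)"
      using linear_maps_smult[OF bilinear_mapsD(2)[OF pure_tensor_bilinear[OF module_N module_H]], of "n1 \<bullet> y" "\<epsilon> x" "E n0"]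
      by (simp add: E_ract E_E)
  qed
  also have "\<dots> = \<rho>_sum T (\<lambda>n0 n1. pure_tensor R N H (E n0) (n1 \<bullet> a)) n"
    by (intro tensor_lift_cong refl counit_left_sum) (simp_all add: E_E)
  \<comment> \<open>Idempotence and E(n) = n bring the sum into the form of
    \<open>coact_E\<close>.\<close>
  also have "\<dots> = \<rho>_sum T (\<lambda>n0 n1. ?f (E n0) n1) (E n)"
    by (simp add: E_E)
  also have "\<dots> = ?f (E n) \<one>\<^sub>H"
    by (rule coact_E[OF _ f]) simp_all
  finally show "\<mu> (\<nu> (pure_tensor R N H n a)) = pure_tensor R N H n a"
    by simp
qed simp_all

lemma NH_lact:
  "lact NH a = tensor_lift R N H T (\<lambda>n x. \<Delta>_sum T (\<lambda>a1 a2. pure_tensor R N H (E (a1 \<rightharpoonup> n)) (a2 \<bullet> x)) a)"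
  by (simp add: induced_bimodule_def)

lemma NH_ract: "ract NH t b = tensor_lift R N H T (\<lambda>n x. pure_tensor R N H n (x \<bullet> b)) t"
  by (simp add: induced_bimodule_def)

lemma NH_coact:
  "coact NH = tensor_lift R N H (tensor R T H) (\<lambda>n x. \<phi>inv_sum (tensor R T H) (\<lambda>X Y Z. \<Delta>_sum (tensor R T H)
      (\<lambda>x1 x2. pure_tensor R T H (pure_tensor R N H (E (X \<rightharpoonup> n)) (Y \<bullet> x1)) (Z \<bullet> x2)) x))"
  by (simp add: induced_bimodule_def)

lemma NH_linear:
  "a \<in> carrier H \<Longrightarrow> lact NH a \<in> linear_maps R T T"
  "a \<in> carrier H \<Longrightarrow> (\<lambda>t. ract NH t a) \<in> linear_maps R T T"
  "coact NH \<in> linear_maps R T (tensor R T H)"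
  unfolding NH_lact NH_ract NH_coact
  by (simp_all add: bilinear_maps_iff trilinear_maps_iff E_E)

text \<open>On n \<otimes> x the left side is E(a1 n) a2 x, which is (a E(n)) x by
  \<open>lact_E\<close>, with E(n) = n.\<close>

lemma nu_lact:
  assumes a [simp]: "a \<in> carrier H" and "t \<in> carrier T"
  shows "\<nu> (lact NH a t) = a \<rightharpoonup> \<nu> t"
proof (rule tensor_linear_maps_eqI[where U = M, OF _ _ _ _ _ _ assms(2)])
  show "(\<lambda>t. \<nu> (lact NH a t)) \<in> linear_maps R T M"
    by (rule linear_maps_compose[OF NH_linear(1) nu_linear]) simp
  fix n x assume n: "n \<in> carrier N" and x [simp]: "x \<in> carrier H"
  have [simp]: "n \<in> carrier M" "E n = n" using n by simp_all
  have "\<nu> (lact NH a (pure_tensor R N H n x)) = \<Delta>_sum M (\<lambda>a1 a2. E (a1 \<rightharpoonup> n) \<leftharpoonup> (a2 \<bullet> x)) a"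
    unfolding NH_lact by (simp add: bilinear_maps_iff E_E)
  also have "\<dots> = \<Delta>_sum M (\<lambda>a1 a2. E (a1 \<rightharpoonup> n) \<leftharpoonup> a2) a \<leftharpoonup> x"
    by (subst ract_sum) (simp_all add: bilinear_maps_iff M.ract_mult)
  also have "\<dots> = a \<rightharpoonup> (n \<leftharpoonup> x)"
    by (simp add: lact_E M.lact_ract)
  finally show "\<nu> (lact NH a (pure_tensor R N H n x)) = a \<rightharpoonup> \<nu> (pure_tensor R N H n x)"
    by simp
qed simp_all

lemma nu_ract:
  assumes a [simp]: "a \<in> carrier H" and "t \<in> carrier T"
  shows "\<nu> (ract NH t a) = \<nu> t \<leftharpoonup> a"
  by (rule tensor_linear_maps_eqI[where U = M, OF _ _ _ _ _ _ assms(2)])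
    (simp_all add: NH_ract bilinear_maps_iff M.ract_mult)

text \<open>On n \<otimes> x the left side is E(X n) Y x1 \<otimes> Z x2, summed over \<phi>^-1 and
  \<Delta>(x). By \<open>coact_coinvariant\<close> this is \<rho>(n) \<Delta>(x), hence \<rho>(n
  x).\<close>

lemma nu_coact:
  assumes "t \<in> carrier T"
  shows "tensor_map R T H M H \<nu> id (coact NH t) = coact M (\<nu> t)"
proof (rule tensor_linear_maps_eqI[where U = "tensor R M H", OF _ _ _ _ _ _ assms])
  let ?U = "tensor R M H" let ?h = "tensor_map R T H M H \<nu> id"
  have h: "?h \<in> linear_maps R (tensor R T H) ?U" by (rule tensor_map_linear) simp_all
  show "(\<lambda>t. ?h (coact NH t)) \<in> linear_maps R T ?U"
    by (rule linear_maps_compose[OF NH_linear(3) h])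
  fix n x assume n: "n \<in> carrier N" and x [simp]: "x \<in> carrier H"
  have [simp]: "n \<in> carrier M" "E n = n" using n by simp_all
  let ?f = "\<lambda>a b. \<Delta>_sum ?U (\<lambda>u v. pure_tensor R M H (a \<leftharpoonup> u) (b \<bullet> v)) x"
  have "?h (coact NH (pure_tensor R N H n x)) = ?h (\<phi>inv_sum (tensor R T H) (\<lambda>X Y Z. \<Delta>_sum (tensor R T H)
      (\<lambda>x1 x2. pure_tensor R T H (pure_tensor R N H (E (X \<rightharpoonup> n)) (Y \<bullet> x1)) (Z \<bullet> x2)) x))"
    unfolding NH_coact by (subst tensor_lift_pure) (simp_all add: bilinear_maps_iff trilinear_maps_iff E_E)
  also have "\<dots> = \<phi>inv_sum ?U (\<lambda>X Y Z. ?h (\<Delta>_sum (tensor R T H)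
      (\<lambda>x1 x2. pure_tensor R T H (pure_tensor R N H (E (X \<rightharpoonup> n)) (Y \<bullet> x1)) (Z \<bullet> x2)) x))"
    by (rule linear_tensor_lift3[OF _ _ _ _ _ h]) (simp_all add: bilinear_maps_iff trilinear_maps_iff E_E)
  also have "\<dots> = \<phi>inv_sum ?U (\<lambda>X Y Z. \<Delta>_sum ?U
      (\<lambda>x1 x2. ?h (pure_tensor R T H (pure_tensor R N H (E (X \<rightharpoonup> n)) (Y \<bullet> x1)) (Z \<bullet> x2))) x)"
    by (intro tensor_lift3_cong refl linear_tensor_lift[OF _ _ _ _ h]) (simp_all add: bilinear_maps_iff E_E)
  also have "\<dots> = \<phi>inv_sum ?U (\<lambda>X Y Z. ?f (E (X \<rightharpoonup> n) \<leftharpoonup> Y) Z)"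
    by (intro tensor_lift3_cong tensor_lift_cong refl) (simp add: tensor_map_pure E_E M.ract_mult)
  also have "\<dots> = \<rho>_sum ?U ?f n"
    by (rule coact_coinvariant[symmetric]) (simp_all add: bilinear_maps_iff)
  also have "\<dots> = \<rho>_sum ?U (pure_tensor R M H) (n \<leftharpoonup> x)"
    by (rule coact_ract_sum[symmetric]) (simp_all add: bilinear_maps_iff)
  also have "\<dots> = coact M (\<nu> (pure_tensor R N H n x))"
    by (simp add: tensor_lift_pure_tensor)
  finally show "?h (coact NH (pure_tensor R N H n x)) = coact M (\<nu> (pure_tensor R N H n x))" .
qed simp_all

text \<open>The facts above are stated over the plain tensor product \<open>T\<close>, while the
  transport lemma concerns the record \<open>NH\<close>. The rules \<open>NH_same\<close> identify
  the linear maps, lifts and tensor products over the two.\<close>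

lemma nu_iso: "quasi_hopf_bimodule R H NH" "\<nu> \<in> quasi_hopf_bimodule_iso R H NH M"
proof -
  note c = linear_maps_closed[OF NH_linear(1)] linear_maps_closed[OF NH_linear(2)] linear_maps_closed[OF NH_linear(3)]
  show "quasi_hopf_bimodule R H NH"
    by (rule quasi_hopf_bimodule_transport(1)[of NH \<nu> \<mu>])
      (simp_all only: NH_same nu_linear mu_linear module_NH mu_nu nu_mu nu_lact nu_ract c nu_coact tensor_map_def[of R NH] tensor_map_def[of R T, symmetric])
  show "\<nu> \<in> quasi_hopf_bimodule_iso R H NH M"
    by (rule quasi_hopf_bimodule_transport(2)[of NH \<nu> \<mu>])
      (simp_all only: NH_same nu_linear mu_linear module_NH mu_nu nu_mu nu_lact nu_ract c nu_coact tensor_map_def[of R NH] tensor_map_def[of R T, symmetric])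
qed

lemma inv_nu:
  assumes "m \<in> carrier M"
  shows "inv_into (carrier NH) \<nu> m = \<mu> m"
proof (rule inv_into_f_eq)
  show "inj_on \<nu> (carrier NH)"
    unfolding carrier_NH by (rule inj_on_inverseI[of _ \<mu>]) (rule mu_nu)
  show "\<mu> m \<in> carrier NH"
    unfolding carrier_NH by (rule linear_maps_closed[OF mu_linear assms])
qed (rule nu_mu[OF assms])

end

theorem theorem3p8:
  fixes R :: "('k, 'r) ring_scheme"
    and H :: "('k, 'h, 'a) quasi_hopf_algebra_scheme"
    and M :: "('k, 'h, 'm, 'b) quasi_hopf_bimodule_scheme"
  assumes "quasi_hopf_algebra R H"
    and "quasi_hopf_bimodule R H M"
  shows "let N = coinvariants R H M;
             NH = induced_bimodule R H N;
             \<nu> = tensor_lift R N H M (\<lambda>n a. ract M n a)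
         in left_module R H N
            \<and> quasi_hopf_bimodule R H NH
            \<and> \<nu> \<in> quasi_hopf_bimodule_iso R H NH M
            \<and> (\<forall>m\<in>carrier M. inv_into (carrier NH) \<nu> m
                 = tensor_map R M H N H (coinv_proj R H M) id (coact M m))"
proof -
  interpret quasi_hopf_bimodule_over R H M
    using assms by (intro quasi_hopf_bimodule_over.intro)
  show ?thesis
    unfolding Let_def by (intro conjI ballI left_module_N nu_iso inv_nu)
qed

end
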